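(* Let $k$ be a field, let $A_1,\dots,A_n$ be non-empty disjoint finite sets, let $T\subseteq A_1\times\cdots\times A_n$ and let $T^c=(A_1\times\cdots\times A_n)\setminus T$. If the rainbow monomial ideal $I(T)$ has a linear resolution, then the complement rainbow ideal $I(T^c)$ also has a linear resolution. Hence $T$ is acyclic if and only if $T^c$ is acyclic.
   Context: Let $A=\bigcup_iA_i$ and let $k[A]$ be the polynomial ring with variables the elements of $A$. For a subset $U\subseteq A_1\times\cdots\times A_n$, the rainbow ideal $I(U)\subseteq k[A]$ is generated by the monomials $a_1\cdots a_n$ with $(a_1,\dots,a_n)\in U$. Linear resolution means $n$-linear: the $i$-th module in the minimal graded free resolution is generated in degree $n+i$ for all $i\ge0$ (the zero ideal satisfies this vacuously). For a finite set $V$ let $\Delta(V)\subseteq\mathbb R^V$ be the geometric simplex with vertices $V$. The cell complex $C(U)$ consists of all cells $\Delta(R_1)\times\cdots\times\Delta(R_n)$ with $\emptyset\ne R_i\subseteq A_i$ and $R_1\times\cdots\times R_n\subseteq U$. The set $U$ is acyclic if for all families of non-empty subsets $R_i\subseteq A_i$, the reduced cellular homology over $k$ of $C(U\cap(R_1\times\cdots\times R_n))$ vanishes in all degrees $i\ge0$. *)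

theory Defs
  imports
    Complex_Main
    "HOL-Library.Poly_Mapping"
    "HOL-Library.FuncSet"
    "HOL-Library.Countable_Set"
    "HOL-Library.Disjoint_Sets"
    "HOL-Algebra.Ideal"
begin

section \<open>Polynomial rings and rainbow ideals\<close>

text \<open>A polynomial is a finitely supported map from monomials (finitely supported exponent
  vectors) to coefficients.\<close>

type_synonym ('a, 'k) mpoly = "('a \<Rightarrow>\<^sub>0 nat) \<Rightarrow>\<^sub>0 'k"

definition mvar :: "'a \<Rightarrow> ('a, 'k::field) mpoly" where
  "mvar a = Poly_Mapping.single (Poly_Mapping.single a 1) 1"

definition mon_deg :: "('a \<Rightarrow>\<^sub>0 nat) \<Rightarrow> nat" where
  "mon_deg m = (\<Sum>x\<in>Poly_Mapping.keys m. Poly_Mapping.lookup m x)"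

definition poly_ring :: "'a set \<Rightarrow> ('a, 'k::field) mpoly ring" where
  "poly_ring V =
     \<lparr>carrier = {p. \<forall>m\<in>Poly_Mapping.keys p. Poly_Mapping.keys m \<subseteq> V},
      mult = (*), one = 1, zero = 0, add = (+)\<rparr>"

definition rainbow_ideal :: "nat \<Rightarrow> (nat \<Rightarrow> 'a set) \<Rightarrow> (nat \<Rightarrow> 'a) set \<Rightarrow> ('a, 'k::field) mpoly set"
  where
  "rainbow_ideal n A U =
     genideal (poly_ring (\<Union>i\<in>{1..n}. A i)) {\<Prod>i=1..n. mvar (a i) | a. a \<in> U}"


section \<open>Minimal graded free resolutions\<close>

text \<open>For \<open>\<delta> = [\<delta>\<^sub>0, \<dots>, \<delta>\<^sub>r]\<close> and \<open>S = k[V]\<close>, this is the graded free module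
  \<open>S(-\<delta>\<^sub>0) \<oplus> \<dots> \<oplus> S(-\<delta>\<^sub>r)\<close>: the \<open>j\<close>-th basis element has degree \<open>\<delta>\<^sub>j\<close>. Its elements are
  sequences of coordinates, padded with zeros.\<close>

definition free_module :: "'a set \<Rightarrow> int list \<Rightarrow> (nat \<Rightarrow> ('a, 'k::field) mpoly) set" where
  "free_module V \<delta> =
     {v. (\<forall>j<length \<delta>. v j \<in> carrier (poly_ring V)) \<and> (\<forall>j\<ge>length \<delta>. v j = 0)}"

definition graded_part :: "'a set \<Rightarrow> int list \<Rightarrow> int \<Rightarrow> (nat \<Rightarrow> ('a, 'k::field) mpoly) set" where
  "graded_part V \<delta> e =
     {v \<in> free_module V \<delta>. \<forall>j<length \<delta>. \<forall>m\<in>Poly_Mapping.keys (v j). int (mon_deg m) + \<delta> ! j = e}"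

text \<open>Homomorphisms of graded modules (homogeneous of degree 0).\<close>

definition graded_hom ::
  "'a set \<Rightarrow> int list \<Rightarrow> int list \<Rightarrow>
     ((nat \<Rightarrow> ('a, 'k::field) mpoly) \<Rightarrow> (nat \<Rightarrow> ('a, 'k) mpoly)) \<Rightarrow> bool" where
  "graded_hom V \<delta> \<delta>' f \<longleftrightarrow>
     f \<in> free_module V \<delta> \<rightarrow> free_module V \<delta>' \<and>
     (\<forall>v\<in>free_module V \<delta>. \<forall>w\<in>free_module V \<delta>. f (\<lambda>j. v j + w j) = (\<lambda>j. f v j + f w j)) \<and>
     (\<forall>p\<in>carrier (poly_ring V). \<forall>v\<in>free_module V \<delta>. f (\<lambda>j. p * v j) = (\<lambda>j. p * f v j)) \<and>
     (\<forall>e. f \<in> graded_part V \<delta> e \<rightarrow> graded_part V \<delta>' e)"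

text \<open>The complex \<open>\<dots> \<rightarrow> F\<^sub>1 \<rightarrow> F\<^sub>0 \<rightarrow> I \<rightarrow> 0\<close>, where \<open>F\<^sub>i\<close> is the graded free module with basis
  degrees \<open>D i\<close>, the augmentation \<open>\<epsilon>\<close> maps \<open>F\<^sub>0\<close> to \<open>S\<close> (the graded free module with degree
  list \<open>[0]\<close>) with image \<open>I\<close>, and \<open>\<phi> i\<close> maps \<open>F\<^sub>i\<^sub>+\<^sub>1\<close> to \<open>F\<^sub>i\<close>. Minimality says that the image
  of \<open>\<phi> i\<close> lies in \<open>\<mm> F\<^sub>i\<close>, where \<open>\<mm>\<close>, the ideal generated by the variables, consists of the
  polynomials with zero constant term.\<close>

definition minimal_graded_free_resolution ::
  "'a set \<Rightarrow> ('a, 'k::field) mpoly set \<Rightarrow> (nat \<Rightarrow> int list) \<Rightarrow>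
     ((nat \<Rightarrow> ('a, 'k) mpoly) \<Rightarrow> (nat \<Rightarrow> ('a, 'k) mpoly)) \<Rightarrow>
     (nat \<Rightarrow> (nat \<Rightarrow> ('a, 'k) mpoly) \<Rightarrow> (nat \<Rightarrow> ('a, 'k) mpoly)) \<Rightarrow> bool" where
  "minimal_graded_free_resolution V I D \<epsilon> \<phi> \<longleftrightarrow>
     graded_hom V (D 0) [0] \<epsilon> \<and>
     (\<forall>i. graded_hom V (D (Suc i)) (D i) (\<phi> i)) \<and>
     (\<lambda>v. \<epsilon> v 0) ` free_module V (D 0) = I \<and>
     {v \<in> free_module V (D 0). \<epsilon> v = (\<lambda>_. 0)} = \<phi> 0 ` free_module V (D 1) \<and>
     (\<forall>i. {v \<in> free_module V (D (Suc i)). \<phi> i v = (\<lambda>_. 0)} =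
          \<phi> (Suc i) ` free_module V (D (Suc (Suc i)))) \<and>
     (\<forall>i. \<forall>v\<in>free_module V (D (Suc i)). \<forall>j. Poly_Mapping.lookup (\<phi> i v j) 0 = 0)"

text \<open>The minimal graded free resolution is unique up to isomorphism, so that its basis degrees
  are determined by \<open>I\<close>. The zero ideal has the resolution with all \<open>D i\<close> empty.\<close>

definition has_linear_resolution :: "nat \<Rightarrow> 'a set \<Rightarrow> ('a, 'k::field) mpoly set \<Rightarrow> bool" where
  "has_linear_resolution n V I \<longleftrightarrow>
     (\<exists>D \<epsilon> \<phi>. minimal_graded_free_resolution V I D \<epsilon> \<phi> \<and>
        (\<forall>i. \<forall>d\<in>set (D i). d = int n + int i))"


section \<open>Complexes of products of simplices\<close>

text \<open>\<open>\<real>\<^sup>V\<close> is embedded in the space of all real functions on the ambient type by extending with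
  zero.\<close>

definition geometric_simplex :: "'a set \<Rightarrow> ('a \<Rightarrow> real) set" where
  "geometric_simplex V = {x. (\<forall>a. 0 \<le> x a) \<and> (\<forall>a. a \<notin> V \<longrightarrow> x a = 0) \<and> (\<Sum>a\<in>V. x a) = 1}"

definition prod_cell :: "nat \<Rightarrow> (nat \<Rightarrow> 'a set) \<Rightarrow> (nat \<Rightarrow> 'a \<Rightarrow> real) set" where
  "prod_cell n R = (\<Pi>\<^sub>E i\<in>{1..n}. geometric_simplex (R i))"

definition cell_complex ::
  "nat \<Rightarrow> (nat \<Rightarrow> 'a set) \<Rightarrow> (nat \<Rightarrow> 'a) set \<Rightarrow> (nat \<Rightarrow> 'a \<Rightarrow> real) set set" where
  "cell_complex n A U =
     {prod_cell n R | R. (\<forall>i\<in>{1..n}. R i \<noteq> {} \<and> R i \<subseteq> A i) \<and> (\<Pi>\<^sub>E i\<in>{1..n}. R i) \<subseteq> U}"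

text \<open>\<open>verts \<sigma> i\<close> recovers the vertex set of the \<open>i\<close>-th factor of a cell.\<close>

definition verts :: "(nat \<Rightarrow> 'a \<Rightarrow> real) set \<Rightarrow> nat \<Rightarrow> 'a set" where
  "verts \<sigma> i = {a. \<exists>x\<in>\<sigma>. x i a \<noteq> 0}"

definition cell_dim :: "nat \<Rightarrow> (nat \<Rightarrow> 'a \<Rightarrow> real) set \<Rightarrow> nat" where
  "cell_dim n \<sigma> = (\<Sum>i=1..n. card (verts \<sigma> i) - 1)"

text \<open>Each simplex is oriented by the enumeration \<open>to_nat_on (A i)\<close> of its ambient vertex set
  \<open>A i\<close>, and a product of simplices carries the product orientation. The incidence number of a
  cell \<open>\<sigma> = \<Delta>(R\<^sub>1) \<times> \<dots> \<times> \<Delta>(R\<^sub>n)\<close> and its facet obtained by deleting \<open>a\<close> from \<open>R\<^sub>i\<close> is then,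
  by the Leibniz rule for \<open>\<partial>\<close> on products, the sign of \<open>\<Delta>(R\<^sub>i - {a})\<close> in \<open>\<partial>\<Delta>(R\<^sub>i)\<close>, which is
  \<open>-1\<close> to the position of \<open>a\<close> in \<open>R\<^sub>i\<close> (counted from 0), times \<open>-1\<close> to the dimension of
  \<open>\<Delta>(R\<^sub>1) \<times> \<dots> \<times> \<Delta>(R\<^sub>i\<^sub>-\<^sub>1)\<close>. At most one summand below is nonzero if \<open>\<tau>\<close> is a cell.\<close>

definition incidence ::
  "nat \<Rightarrow> (nat \<Rightarrow> 'a set) \<Rightarrow> (nat \<Rightarrow> 'a \<Rightarrow> real) set \<Rightarrow> (nat \<Rightarrow> 'a \<Rightarrow> real) set \<Rightarrow> 'k::field" where
  "incidence n A \<sigma> \<tau> =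
     (\<Sum>i=1..n. \<Sum>a\<in>verts \<sigma> i.
        if \<tau> = prod_cell n ((verts \<sigma>)(i := verts \<sigma> i - {a}))
        then (- 1) ^ (\<Sum>j=1..<i. card (verts \<sigma> j) - 1) *
             (- 1) ^ card {b \<in> verts \<sigma> i. to_nat_on (A i) b < to_nat_on (A i) a}
        else 0)"

text \<open>The cellular chain complex over \<open>k\<close> of a finite complex \<open>K\<close> of such cells.\<close>

definition chains ::
  "nat \<Rightarrow> (nat \<Rightarrow> 'a \<Rightarrow> real) set set \<Rightarrow> nat \<Rightarrow> ((nat \<Rightarrow> 'a \<Rightarrow> real) set \<Rightarrow> 'k::field) set" where
  "chains n K d = {c. \<forall>\<sigma>. c \<sigma> \<noteq> 0 \<longrightarrow> \<sigma> \<in> K \<and> cell_dim n \<sigma> = d}"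

definition boundary ::
  "nat \<Rightarrow> (nat \<Rightarrow> 'a set) \<Rightarrow> (nat \<Rightarrow> 'a \<Rightarrow> real) set set \<Rightarrow>
     ((nat \<Rightarrow> 'a \<Rightarrow> real) set \<Rightarrow> 'k::field) \<Rightarrow> (nat \<Rightarrow> 'a \<Rightarrow> real) set \<Rightarrow> 'k" where
  "boundary n A K c = (\<lambda>\<tau>. if \<tau> \<in> K then \<Sum>\<sigma>\<in>K. incidence n A \<sigma> \<tau> * c \<sigma> else 0)"

text \<open>In degree 0 the reduced cycles are the kernel of the augmentation.\<close>

definition reduced_cycles ::
  "nat \<Rightarrow> (nat \<Rightarrow> 'a set) \<Rightarrow> (nat \<Rightarrow> 'a \<Rightarrow> real) set set \<Rightarrow> nat \<Rightarrow>
     ((nat \<Rightarrow> 'a \<Rightarrow> real) set \<Rightarrow> 'k::field) set" where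
  "reduced_cycles n A K d =
     (if d = 0 then {c \<in> chains n K 0. (\<Sum>\<sigma>\<in>K. c \<sigma>) = 0}
      else {c \<in> chains n K d. boundary n A K c = (\<lambda>_. 0)})"

text \<open>\<open>k\<close> enters through its type only. Vanishing of the quotient of cycles by boundaries: every
  reduced \<open>d\<close>-cycle is a boundary.\<close>

definition reduced_homology_vanishes ::
  "'k::field itself \<Rightarrow> nat \<Rightarrow> (nat \<Rightarrow> 'a set) \<Rightarrow> (nat \<Rightarrow> 'a \<Rightarrow> real) set set \<Rightarrow> nat \<Rightarrow> bool" where
  "reduced_homology_vanishes _ n A K d \<longleftrightarrow>
     (reduced_cycles n A K d :: ((nat \<Rightarrow> 'a \<Rightarrow> real) set \<Rightarrow> 'k) set) \<subseteq>
       boundary n A K ` chains n K (Suc d)"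

definition acyclic_over ::
  "'k::field itself \<Rightarrow> nat \<Rightarrow> (nat \<Rightarrow> 'a set) \<Rightarrow> (nat \<Rightarrow> 'a) set \<Rightarrow> bool" where
  "acyclic_over k n A U \<longleftrightarrow>
     (\<forall>R. (\<forall>i\<in>{1..n}. R i \<noteq> {} \<and> R i \<subseteq> A i) \<longrightarrow>
        (\<forall>d. reduced_homology_vanishes k n A (cell_complex n A (U \<inter> (\<Pi>\<^sub>E i\<in>{1..n}. R i))) d))"


text \<open>The two lemmas below are not used by the definitions. They confirm that \<open>poly_ring V\<close> is a
  ring, so that \<open>genideal\<close> is meaningful in it, and that a cell determines its factors.\<close>

lemma cring_poly_ring: "cring (poly_ring V :: ('a, 'k::field) mpoly ring)"
proof -
  have add: "p + q \<in> carrier (poly_ring V)"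
    if "p \<in> carrier (poly_ring V)" "q \<in> carrier (poly_ring V)" for p q :: "('a, 'k) mpoly"
    using that keys_add[of p q] by (auto simp: poly_ring_def)
  have uminus: "- p \<in> carrier (poly_ring V)"
    if "p \<in> carrier (poly_ring V)" for p :: "('a, 'k) mpoly"
    using that by (simp add: poly_ring_def)
  have mult: "p * q \<in> carrier (poly_ring V)"
    if pq: "p \<in> carrier (poly_ring V)" "q \<in> carrier (poly_ring V)" for p q :: "('a, 'k) mpoly"
  proof -
    have "Poly_Mapping.keys m \<subseteq> V" if m: "m \<in> Poly_Mapping.keys (p * q)" for m
    proof -
      obtain a b where ab: "m = a + b" "a \<in> Poly_Mapping.keys p" "b \<in> Poly_Mapping.keys q"
        using keys_mult[of p q] m by blast
      have "Poly_Mapping.keys m \<subseteq> Poly_Mapping.keys a \<union> Poly_Mapping.keys b"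
        unfolding ab(1) by (rule keys_add)
      also have "\<dots> \<subseteq> V"
        using ab(2,3) pq by (simp add: poly_ring_def)
      finally show ?thesis .
    qed
    then show ?thesis by (simp add: poly_ring_def)
  qed
  have "abelian_group (poly_ring V :: ('a, 'k) mpoly ring)"
  proof (rule abelian_groupI)
    show "\<exists>y\<in>carrier (poly_ring V). y \<oplus>\<^bsub>poly_ring V\<^esub> p = \<zero>\<^bsub>poly_ring V\<^esub>"
      if "p \<in> carrier (poly_ring V)" for p :: "('a, 'k) mpoly"
      using uminus[OF that] by (intro bexI[of _ "- p"]) (simp_all add: poly_ring_def)
    show "p \<oplus>\<^bsub>poly_ring V\<^esub> q \<in> carrier (poly_ring V)"
      if "p \<in> carrier (poly_ring V)" "q \<in> carrier (poly_ring V)" for p q :: "('a, 'k) mpoly"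
      using add[OF that] by (simp add: poly_ring_def)
  qed (simp_all add: poly_ring_def add_ac)
  moreover have "comm_monoid (poly_ring V :: ('a, 'k) mpoly ring)"
  proof (rule comm_monoidI)
    show "p \<otimes>\<^bsub>poly_ring V\<^esub> q \<in> carrier (poly_ring V)"
      if "p \<in> carrier (poly_ring V)" "q \<in> carrier (poly_ring V)" for p q :: "('a, 'k) mpoly"
      using mult[OF that] by (simp add: poly_ring_def)
  qed (simp_all add: poly_ring_def mult_ac)
  ultimately show ?thesis
    by (rule cringI) (simp add: poly_ring_def distrib_right)
qed

lemma verts_prod_cell:
  assumes "\<And>i. i \<in> {1..n} \<Longrightarrow> finite (R i) \<and> R i \<noteq> {}" and "i \<in> {1..n}"
  shows "verts (prod_cell n R) i = R i"
proof
  show "verts (prod_cell n R) i \<subseteq> R i"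
    using assms(2) by (fastforce simp: verts_def prod_cell_def geometric_simplex_def PiE_iff)
  show "R i \<subseteq> verts (prod_cell n R) i"
  proof
    fix a assume a: "a \<in> R i"
    have "\<forall>j\<in>{1..n}. \<exists>b. b \<in> R j \<and> (j = i \<longrightarrow> b = a)"
      using assms a by blast
    then obtain b where b: "\<And>j. j \<in> {1..n} \<Longrightarrow> b j \<in> R j" "b i = a"
      using assms(2) by metis
    define x :: "nat \<Rightarrow> 'a \<Rightarrow> real" where
      "x = restrict (\<lambda>j c. if c = b j then 1 else 0) {1..n}"
    have "x \<in> prod_cell n R"
      unfolding prod_cell_def x_def
      using b assms(1) by (intro restrict_PiE_iff[THEN iffD2]) (auto simp: geometric_simplex_def)
    moreover have "x i a \<noteq> 0"
      using assms(2) b(2) by (simp add: x_def)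
    ultimately show "a \<in> verts (prod_cell n R) i"
      by (auto simp: verts_def)
  qed
qed

end

theory Submission
  imports Defs
begin

text \<open>
  Encode a family \<open>R i \<subseteq> A i\<close> by its union \<open>S\<close>, the support of a squarefree monomial. Both halves of
  the statement follow from two implications, applied to \<open>T\<close> and to \<open>T\<^sup>c\<close>.

  If \<open>T\<close> is acyclic, then \<open>C(T)\<close>, with the vertex monomials as labels, supports a free resolution
  of \<open>I(T)\<close>: its part of multidegree \<open>m\<close> is the augmented chain complex of the restriction of \<open>C(T)\<close>
  to the support of \<open>m\<close>. All entries of its matrices are variables up to sign, so that it is
  minimal and linear.

  If \<open>I(T)\<close> has a linear resolution, then \<open>T\<^sup>c\<close> is acyclic. Computing \<open>Tor\<^sub>i(I(T), k)\<close> with the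
  Koszul complex, linearity says that the cochain complex on \<open>{S \<subseteq> R. \<Prod>S \<in> I(T)}\<close> has cohomology
  in the lowest degree \<open>|S| = n\<close> only. The sets \<open>S\<close> in it are exactly the cells of the product of
  simplices on \<open>R\<close> that are not cells of \<open>C(T\<^sup>c)\<close>. Since the product of simplices is contractible,
  the long exact sequence shows that the cohomology of \<open>C(T\<^sup>c)\<close> on \<open>R\<close> vanishes, and by the Fredholm
  alternative so does its reduced homology.
\<close>

section \<open>Linear algebra\<close>

text \<open>The given resolution is graded by total degree only and is otherwise arbitrary.
  Linearity therefore enters through degrees alone: Koszul cycles are pushed along the syzygies by
  dimension shifting, and the multigrading comes back at the end, when a single coefficient is read
  off in the squarefree multidegree of \<open>R\<close>. This is legitimate because membership in a
  monomial ideal is tested term by term.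

  A Koszul chain of that multidegree has a set \<open>W\<close> in the exterior factor and the
  complement \<open>R - W\<close> in the monomial, so that its differential is a coboundary on the
  complements. It speaks of cohomology whereas acyclicity speaks of homology; this is why a duality
  over the field is required.

  Chains, cochains and Koszul chains all live on subsets of one finite set, and the squares of their
  differentials vanish by the same two identities for signs. The product orientation of cells is
  compared with these signs only once.\<close>

lemma fredholm_alternative:
  fixes r :: "'i \<Rightarrow> 'j \<Rightarrow> 'k::field"
  assumes "finite J" "finite I"
  shows "(\<exists>z. \<forall>j\<in>J. y j = (\<Sum>i\<in>I. z i * r i j)) \<or>
    (\<exists>x. (\<forall>i\<in>I. (\<Sum>j\<in>J. r i j * x j) = 0) \<and> (\<Sum>j\<in>J. y j * x j) \<noteq> 0)"
  using assms(2)
proof (induction I arbitrary: y rule: finite_induct)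
  case empty
  show ?case
  proof (cases "\<forall>j\<in>J. y j = 0")
    case False
    then obtain l where l: "l \<in> J" "y l \<noteq> 0" by blast
    have "(\<Sum>j\<in>J. y j * (if j = l then 1 else 0)) = y l"
      using assms(1) l(1) by (subst sum.mono_neutral_right[of J "{l}"]) auto
    then show ?thesis using l(2) by (intro disjI2 exI[of _ "\<lambda>j. if j = l then 1 else 0"]) simp
  qed simp
next
  case (insert q F)
  show ?case
  proof (cases "\<exists>z. \<forall>j\<in>J. r q j = (\<Sum>i\<in>F. z i * r i j)")
    case True
    then obtain u where u: "\<forall>j\<in>J. r q j = (\<Sum>i\<in>F. u i * r i j)" by blast
    consider (span) z where "\<forall>j\<in>J. y j = (\<Sum>i\<in>F. z i * r i j)"
      | (sep) x where "\<forall>i\<in>F. (\<Sum>j\<in>J. r i j * x j) = 0" "(\<Sum>j\<in>J. y j * x j) \<noteq> 0"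
      using insert.IH[of y] by blast
    then show ?thesis
    proof cases
      case span
      have "(\<Sum>i\<in>insert q F. (z(q := 0)) i * r i j) = (\<Sum>i\<in>F. z i * r i j)" for j
        using insert.hyps by (auto intro!: sum.cong)
      then show ?thesis using span by (intro disjI1 exI[of _ "z(q := 0)"]) (simp del: fun_upd_apply)
    next
      case sep
      have "(\<Sum>j\<in>J. r q j * x j) = (\<Sum>j\<in>J. \<Sum>i\<in>F. u i * (r i j * x j))"
        using u by (intro sum.cong) (auto simp: sum_distrib_right mult.assoc)
      also have "\<dots> = (\<Sum>i\<in>F. u i * (\<Sum>j\<in>J. r i j * x j))"
        by (subst sum.swap) (simp add: sum_distrib_left)
      finally have "(\<Sum>j\<in>J. r q j * x j) = 0" using sep(1) by simp
      then show ?thesis using sep by (intro disjI2 exI[of _ x]) auto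
    qed
  next
    case False
    then obtain x0 where x0: "\<forall>i\<in>F. (\<Sum>j\<in>J. r i j * x0 j) = 0"
      "(\<Sum>j\<in>J. r q j * x0 j) \<noteq> 0"
      using insert.IH[of "r q"] by blast
    \<comment> \<open>\<open>x0\<close> kills the rows in \<open>F\<close> but not row
      \<open>q\<close>. Subtracting \<open>c\<close> times row \<open>q\<close> makes the remainder
      \<open>y'\<close> orthogonal to \<open>x0\<close>.\<close>
    define c where "c = (\<Sum>j\<in>J. y j * x0 j) / (\<Sum>j\<in>J. r q j * x0 j)"
    define y' where "y' j = y j - c * r q j" for j
    consider (span) z where "\<forall>j\<in>J. y' j = (\<Sum>i\<in>F. z i * r i j)"
      | (sep) x where "\<forall>i\<in>F. (\<Sum>j\<in>J. r i j * x j) = 0" "(\<Sum>j\<in>J. y' j * x j) \<noteq> 0"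
      using insert.IH[of y'] by blast
    then show ?thesis
    proof cases
      case span
      have "(\<Sum>i\<in>insert q F. (z(q := c)) i * r i j) = c * r q j + (\<Sum>i\<in>F. z i * r i j)" for j
      proof -
        have "(\<Sum>i\<in>F. (z(q := c)) i * r i j) = (\<Sum>i\<in>F. z i * r i j)"
          using insert.hyps by (intro sum.cong) auto
        then show ?thesis using insert.hyps by simp
      qed
      moreover have "y j = c * r q j + (\<Sum>i\<in>F. z i * r i j)" if "j \<in> J" for j
        using span that by (simp add: y'_def algebra_simps)
      ultimately show ?thesis by (intro disjI1 exI[of _ "z(q := c)"]) (simp del: fun_upd_apply)
    next
      case sep
      \<comment> \<open>Moving the separating vector by a multiple of \<open>x0\<close> kills row
        \<open>q\<close> too and leaves the rows in \<open>F\<close> at zero. The new value on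
        \<open>y\<close> equals the old value on \<open>y'\<close>, so it is nonzero.\<close>
      define t where "t = (\<Sum>j\<in>J. r q j * x j) / (\<Sum>j\<in>J. r q j * x0 j)"
      have lin: "(\<Sum>j\<in>J. f j * (x j - t * x0 j)) = (\<Sum>j\<in>J. f j * x j) - t * (\<Sum>j\<in>J. f j * x0 j)"
        for f :: "'j \<Rightarrow> 'k"
        by (simp add: algebra_simps sum_subtractf sum_distrib_left)
      have "(\<Sum>j\<in>J. y' j * x j) = (\<Sum>j\<in>J. y j * x j) - c * (\<Sum>j\<in>J. r q j * x j)"
        by (simp add: y'_def algebra_simps sum_subtractf sum_distrib_left)
      also have "\<dots> = (\<Sum>j\<in>J. y j * x j) - t * (\<Sum>j\<in>J. y j * x0 j)"
        by (simp add: c_def t_def)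
      finally have "(\<Sum>j\<in>J. y j * (x j - t * x0 j)) \<noteq> 0" using sep(2) by (simp add: lin)
      moreover have "(\<Sum>j\<in>J. r i j * (x j - t * x0 j)) = 0" if "i \<in> insert q F" for i
      proof (cases "i = q")
        case True
        then show ?thesis using x0(2) unfolding lin by (simp add: t_def)
      next
        case False
        then have "i \<in> F" using that by simp
        then show ?thesis using sep(1) x0(1) unfolding lin by simp
      qed
      ultimately show ?thesis by (intro disjI2 exI[of _ "\<lambda>j. x j - t * x0 j"]) simp
    qed
  qed
qed


section \<open>Signs, boundaries and coboundaries\<close>

text \<open>\<open>e a S\<close> is the sign of removing \<open>a\<close> from \<open>S\<close>,
  attached to an edge of the cube of subsets of \<open>V\<close>. The conditions say that every edge
  carries a sign and that the signs around each two-dimensional face multiply to -1.\<close>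

definition anticommuting :: "'a set \<Rightarrow> ('a \<Rightarrow> 'a set \<Rightarrow> 'k::field) \<Rightarrow> bool" where
  "anticommuting V e \<longleftrightarrow>
     (\<forall>S a. S \<subseteq> V \<longrightarrow> a \<in> S \<longrightarrow> e a S * e a S = 1) \<and>
     (\<forall>S a b. S \<subseteq> V \<longrightarrow> a \<in> S \<longrightarrow> b \<in> S \<longrightarrow> a \<noteq> b \<longrightarrow>
        e a S * e b (S - {a}) = - (e b S * e a (S - {b})))"

definition bd :: "('a \<Rightarrow> 'a set \<Rightarrow> 'k::field) \<Rightarrow> 'a set \<Rightarrow> ('a set \<Rightarrow> 'k) \<Rightarrow> 'a set \<Rightarrow> 'k" where
  "bd e V c S = (\<Sum>a\<in>V - S. e a (insert a S) * c (insert a S))"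

definition cobd :: "('a \<Rightarrow> 'a set \<Rightarrow> 'k::field) \<Rightarrow> ('a set \<Rightarrow> 'k) \<Rightarrow> 'a set \<Rightarrow> 'k" where
  "cobd e x S = (\<Sum>a\<in>S. e a S * x (S - {a}))"

lemma anticommuting_sq: "anticommuting V e \<Longrightarrow> S \<subseteq> V \<Longrightarrow> a \<in> S \<Longrightarrow> e a S * e a S = 1"
  unfolding anticommuting_def by blast

lemma anticommuting_swap:
  "anticommuting V e \<Longrightarrow> S \<subseteq> V \<Longrightarrow> a \<in> S \<Longrightarrow> b \<in> S \<Longrightarrow> a \<noteq> b \<Longrightarrow>
     e a S * e b (S - {a}) = - (e b S * e a (S - {b}))"
  unfolding anticommuting_def by blast

text \<open>The four signs around the square between \<open>S - {a, b}\<close> and \<open>S\<close>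
  multiply to -1. \<open>anticommuting_swap\<close> compares the two paths; here the two edges at
  the top are compared with the two at the bottom, which is the form that contracting homotopies
  need.\<close>

lemma anticommuting_exchange:
  assumes "anticommuting V e" "S \<subseteq> V" "a \<in> S" "b \<in> S" "a \<noteq> b"
  shows "e a S * e b S = - (e b (S - {a}) * e a (S - {b}))"
proof -
  have "e a S * e b S = (e a S * e b (S - {a})) * (e b S * e b (S - {a}))"
  proof -
    have "S - {a} \<subseteq> V" "b \<in> S - {a}" using assms by blast+
    then have "e b (S - {a}) * e b (S - {a}) = 1" by (rule anticommuting_sq[OF assms(1)])
    moreover have "e a S * e b (S - {a}) * (e b S * e b (S - {a})) =
        e a S * e b S * (e b (S - {a}) * e b (S - {a}))" by (simp only: mult_ac)
    ultimately show ?thesis by simp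
  qed
  also have "\<dots> = - (e b S * e b S) * (e a (S - {b}) * e b (S - {a}))"
    unfolding anticommuting_swap[OF assms] by (simp add: mult_ac)
  also have "e b S * e b S = 1"
    using anticommuting_sq[OF assms(1,2,4)] .
  finally show ?thesis by (simp add: mult.commute)
qed

text \<open>Symmetric difference with \<open>R\<close> is an automorphism of the cube, so it transports signs.\<close>

lemma anticommuting_twist:
  assumes "anticommuting V e" "R \<subseteq> V"
  shows "anticommuting V (\<lambda>a W. e a (insert a ((R - W) \<union> (W - R))))"
  unfolding anticommuting_def
proof (intro conjI allI impI)
  fix S a assume "S \<subseteq> V" "a \<in> S"
  then have "insert a (R - S \<union> (S - R)) \<subseteq> V" using assms(2) by blast
  then show "e a (insert a (R - S \<union> (S - R))) * e a (insert a (R - S \<union> (S - R))) = 1"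
    by (rule anticommuting_sq[OF assms(1)]) blast
next
  fix S a b assume S: "S \<subseteq> V" "a \<in> S" "b \<in> S" "a \<noteq> b"
  \<comment> \<open>\<open>Q\<close> and \<open>P\<close> are the bottom and the top of the image of
    the square under symmetric difference with \<open>R\<close>. Membership of \<open>a\<close> and
    \<open>b\<close> in \<open>R\<close> decides which corner is the image of \<open>S\<close>, so
    that each case is one of the two comparisons \<open>s\<close>.\<close>
  define Q where "Q = ((R - S) \<union> (S - R)) - {a,b}"
  define P where "P = insert a (insert b Q)"
  have P: "P \<subseteq> V" "a \<in> P" "b \<in> P" using S assms(2) by (auto simp: P_def Q_def)
  note s = anticommuting_swap[OF assms(1) P S(4)] anticommuting_exchange[OF assms(1) P S(4)]
  have PQ: "P - {a} = insert b Q" "P - {b} = insert a Q" using S by (auto simp: P_def Q_def)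
  have sets: "insert a (R - S \<union> (S - R)) = (if b \<in> R then insert a Q else P)"
    "insert b (R - S \<union> (S - R)) = (if a \<in> R then insert b Q else P)"
    "insert b (R - (S - {a}) \<union> (S - {a} - R)) = (if a \<in> R then P else insert b Q)"
    "insert a (R - (S - {b}) \<union> (S - {b} - R)) = (if b \<in> R then P else insert a Q)"
    using S by (auto simp: P_def Q_def)
  show "e a (insert a (R - S \<union> (S - R))) * e b (insert b (R - (S - {a}) \<union> (S - {a} - R))) =
        - (e b (insert b (R - S \<union> (S - R))) * e a (insert a (R - (S - {b}) \<union> (S - {b} - R))))"
    unfolding sets using s unfolding PQ by (cases "a \<in> R"; cases "b \<in> R") (simp_all add: mult.commute)
qed

text \<open>The terms cancel in pairs. The diagonal has to be left out: in characteristic 2,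
  antisymmetry says nothing about \<open>f a a\<close>.\<close>

lemma sum_offdiag_antisym:
  fixes f :: "'a \<Rightarrow> 'a \<Rightarrow> 'k::field"
  assumes "finite S" and "\<And>a b. a \<in> S \<Longrightarrow> b \<in> S \<Longrightarrow> a \<noteq> b \<Longrightarrow> f a b = - f b a"
  shows "(\<Sum>a\<in>S. \<Sum>b\<in>S - {a}. f a b) = 0"
  using assms
proof (induction S rule: finite_induct)
  case (insert x F)
  have "(\<Sum>a\<in>insert x F. \<Sum>b\<in>insert x F - {a}. f a b) =
     (\<Sum>b\<in>F. f x b) + (\<Sum>a\<in>F. f a x + (\<Sum>b\<in>F - {a}. f a b))"
  proof -
    have 1: "insert x F - {x} = F" using insert.hyps by auto
    have 2: "(\<Sum>b\<in>insert x F - {a}. f a b) = f a x + (\<Sum>b\<in>F - {a}. f a b)" if "a \<in> F" for a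
    proof -
      have "insert x F - {a} = insert x (F - {a})" using that insert.hyps by auto
      then show ?thesis using insert.hyps by simp
    qed
    show ?thesis
      unfolding sum.insert[OF insert.hyps] 1
      by (intro arg_cong2[of _ _ _ _ "(+)"] sum.cong refl 2)
  qed
  also have "\<dots> = (\<Sum>b\<in>F. f x b + f b x) + (\<Sum>a\<in>F. \<Sum>b\<in>F - {a}. f a b)"
    by (simp add: sum.distrib)
  also have "(\<Sum>b\<in>F. f x b + f b x) = 0"
  proof (rule sum.neutral, rule ballI)
    fix b assume "b \<in> F"
    moreover from this have "x \<noteq> b" using insert.hyps by blast
    ultimately have "f x b = - f b x" by (intro insert.prems) auto
    then show "f x b + f b x = 0" by simp
  qed
  also have "(\<Sum>a\<in>F. \<Sum>b\<in>F - {a}. f a b) = 0"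
    by (rule insert.IH) (rule insert.prems, auto)
  finally show ?case by simp
qed simp

lemma cobd_cobd:
  assumes "anticommuting V e" "S \<subseteq> V" "finite V"
  shows "cobd e (cobd e x) S = 0"
proof -
  have fin: "finite S" using assms finite_subset by blast
  have "cobd e (cobd e x) S = (\<Sum>a\<in>S. \<Sum>b\<in>S - {a}. e a S * e b (S - {a}) * x (S - {a} - {b}))"
    by (simp add: cobd_def sum_distrib_left mult.assoc)
  also have "\<dots> = 0"
  proof (rule sum_offdiag_antisym[OF fin])
    fix a b assume "a \<in> S" "b \<in> S" "a \<noteq> b"
    moreover have "S - {a} - {b} = S - {b} - {a}" by auto
    ultimately show "e a S * e b (S - {a}) * x (S - {a} - {b}) =
       - (e b S * e a (S - {b}) * x (S - {b} - {a}))"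
      using anticommuting_swap[OF assms(1,2), of a b] by simp
  qed
  finally show ?thesis .
qed

lemma bd_bd:
  assumes "anticommuting V e" "S \<subseteq> V" "finite V"
  shows "bd e V (bd e V c) S = 0"
proof -
  have "bd e V (bd e V c) S = (\<Sum>a\<in>V - S. \<Sum>b\<in>V - S - {a}.
     e a (insert a S) * e b (insert b (insert a S)) * c (insert b (insert a S)))"
  proof -
    have "V - insert a S = V - S - {a}" for a by auto
    then show ?thesis by (simp add: bd_def sum_distrib_left mult.assoc)
  qed
  also have "\<dots> = 0"
  proof (rule sum_offdiag_antisym)
    show "finite (V - S)" using assms by blast
    fix a b assume ab: "a \<in> V - S" "b \<in> V - S" "a \<noteq> b"
    define P where "P = insert a (insert b S)"
    have P: "P \<subseteq> V" "a \<in> P" "b \<in> P" "P - {b} = insert a S" "P - {a} = insert b S"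
      "insert b (insert a S) = P" "insert a (insert b S) = P"
      using ab assms(2) by (auto simp: P_def)
    show "e a (insert a S) * e b (insert b (insert a S)) * c (insert b (insert a S)) =
       - (e b (insert b S) * e a (insert a (insert b S)) * c (insert a (insert b S)))"
      using anticommuting_swap[OF assms(1) P(1,2,3) ab(3)] by (simp add: P algebra_simps)
  qed
  finally show ?thesis .
qed

text \<open>Both sides sum over the edges of the cube of subsets of \<open>R\<close>, indexed on the
  left by the upper end and on the right by the lower end of the edge.\<close>

lemma sum_cobd_mult:
  fixes x c :: "'a set \<Rightarrow> 'k::field"
  assumes "finite R"
  shows "(\<Sum>S\<in>Pow R. cobd e x S * c S) = (\<Sum>S\<in>Pow R. x S * bd e R c S)"
proof -
  have "(\<Sum>S\<in>Pow R. cobd e x S * c S) = (\<Sum>(S,a)\<in>Sigma (Pow R) (\<lambda>S. S). e a S * x (S - {a}) * c S)"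
    using assms by (subst sum.Sigma[symmetric]) (auto simp: cobd_def sum_distrib_right finite_subset)
  also have "\<dots> = (\<Sum>(S,a)\<in>Sigma (Pow R) (\<lambda>S. R - S). x S * (e a (insert a S) * c (insert a S)))"
    by (rule sum.reindex_bij_witness[of _ "\<lambda>(S,a). (insert a S, a)" "\<lambda>(S,a). (S - {a}, a)"])
       (auto simp: insert_absorb)
  also have "\<dots> = (\<Sum>S\<in>Pow R. x S * bd e R c S)"
    using assms by (subst sum.Sigma[symmetric]) (auto simp: bd_def sum_distrib_left finite_subset)
  finally show ?thesis .
qed

lemma cobd_diff: "cobd e (\<lambda>S. x S - y S) S = cobd e x S - cobd e y S"
  by (simp add: cobd_def right_diff_distrib sum_subtractf)


section \<open>The cells as sets of vertices\<close>

text \<open>Since the \<open>A i\<close> are disjoint, a family of subsets \<open>R i \<subseteq> A i\<close> is encoded by its union, and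
  \<open>R i\<close> is recovered as the intersection with \<open>A i\<close>. A set \<open>S\<close> is also the support of a monomial;
  it lies in \<open>I(U)\<close> iff \<open>hit U S\<close>, whereas the cells of \<open>C(U)\<close> are the \<open>S\<close> with \<open>cell U S\<close>.\<close>

locale colour_classes =
  fixes n :: nat and A :: "nat \<Rightarrow> 'a set"
  assumes finA: "i \<in> {1..n} \<Longrightarrow> finite (A i)"
    and disjA: "disjoint_family_on A {1..n}"
begin

definition V :: "'a set" where "V = (\<Union>i\<in>{1..n}. A i)"

definition idx :: "'a \<Rightarrow> nat" where "idx a = (THE i. i \<in> {1..n} \<and> a \<in> A i)"

definition lt :: "'a \<Rightarrow> 'a \<Rightarrow> bool" where
  "lt b a \<longleftrightarrow> idx b < idx a \<or> idx b = idx a \<and> to_nat_on (A (idx a)) b < to_nat_on (A (idx a)) a"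

text \<open>The sign of deleting \<open>a\<close> from the simplex \<open>S\<close> ordered by \<open>lt\<close>, times \<open>(-1)\<^bsup>idx a - 1\<^esup>\<close>. The
  second factor accounts for the product orientation, in which \<open>card (S \<inter> A j)\<close> is replaced by the
  dimension \<open>card (S \<inter> A j) - 1\<close> for each \<open>j < idx a\<close>.\<close>

definition eps :: "'a \<Rightarrow> 'a set \<Rightarrow> 'k::field" where
  "eps a S = (- 1) ^ (idx a - 1 + card {b \<in> S. lt b a})"

definition full :: "'a set \<Rightarrow> bool" where
  "full S \<longleftrightarrow> S \<subseteq> V \<and> (\<forall>i\<in>{1..n}. S \<inter> A i \<noteq> {})"

definition trans :: "'a set \<Rightarrow> (nat \<Rightarrow> 'a) set" where
  "trans S = (\<Pi>\<^sub>E i\<in>{1..n}. S \<inter> A i)"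

definition cell :: "(nat \<Rightarrow> 'a) set \<Rightarrow> 'a set \<Rightarrow> bool" where
  "cell U S \<longleftrightarrow> full S \<and> trans S \<subseteq> U"

definition hit :: "(nat \<Rightarrow> 'a) set \<Rightarrow> 'a set \<Rightarrow> bool" where
  "hit U S \<longleftrightarrow> S \<subseteq> V \<and> trans S \<inter> U \<noteq> {}"

text \<open>A product of \<open>n\<close> simplices of total dimension \<open>d\<close> has
  \<open>n + d\<close> vertices, so \<open>d\<close> is the cellular degree.\<close>

definition supp_in :: "('a set \<Rightarrow> bool) \<Rightarrow> 'a set \<Rightarrow> nat \<Rightarrow> ('a set \<Rightarrow> 'k::field) \<Rightarrow> bool" where
  "supp_in P R d c \<longleftrightarrow> (\<forall>S. c S \<noteq> 0 \<longrightarrow> P S \<and> S \<subseteq> R \<and> card S = n + d)"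

text \<open>Boundaries are tested on full sets only, because a face with an empty factor is not a
  cell. \<open>R\<close> may be any subset of \<open>V\<close>; without a vertex of every colour it
  contains no cell and the condition is trivial.\<close>

definition acyc :: "'k::field itself \<Rightarrow> (nat \<Rightarrow> 'a) set \<Rightarrow> bool" where
  "acyc _ U \<longleftrightarrow> (\<forall>R d. \<forall>c::'a set \<Rightarrow> 'k. R \<subseteq> V \<longrightarrow> supp_in (cell U) R d c \<longrightarrow>
     (if d = 0 then (\<Sum>S\<in>Pow R. c S) = 0 else (\<forall>S. full S \<longrightarrow> bd eps V c S = 0)) \<longrightarrow>
     (\<exists>b. supp_in (cell U) R (Suc d) b \<and> (\<forall>S. full S \<longrightarrow> bd eps V b S = c S)))"

text \<open>The sets with \<open>hit U\<close> are closed upwards, so they carry a cochain complex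
  under the unrestricted \<open>cobd\<close>. Exactness is demanded at sizes above \<open>n\<close>
  only; the size \<open>n\<close> corresponds to the generators of the ideal.\<close>

definition coacyc :: "'k::field itself \<Rightarrow> (nat \<Rightarrow> 'a) set \<Rightarrow> bool" where
  "coacyc _ U \<longleftrightarrow> (\<forall>R d. \<forall>x::'a set \<Rightarrow> 'k. R \<subseteq> V \<longrightarrow> supp_in (hit U) R (Suc d) x \<longrightarrow>
     (\<forall>S\<subseteq>R. cobd eps x S = 0) \<longrightarrow>
     (\<exists>y. supp_in (hit U) R d y \<and> (\<forall>S\<subseteq>R. cobd eps y S = x S)))"

lemma supp_inD:
  assumes "supp_in P R d c" "c S \<noteq> 0"
  shows "P S" "S \<subseteq> R" "card S = n + d"
  using assms by (auto simp: supp_in_def)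

lemma supp_inI:
  assumes "\<And>S. c S \<noteq> 0 \<Longrightarrow> P S" "\<And>S. c S \<noteq> 0 \<Longrightarrow> S \<subseteq> R" "\<And>S. c S \<noteq> 0 \<Longrightarrow> card S = n + d"
  shows "supp_in P R d c"
  using assms by (auto simp: supp_in_def)

lemma finV: "finite V"
  using finA by (simp add: V_def)

lemma idx_eq: "i \<in> {1..n} \<Longrightarrow> a \<in> A i \<Longrightarrow> idx a = i"
  using disjA unfolding idx_def disjoint_family_on_def by (intro the_equality) blast+

lemma idx_in: "a \<in> V \<Longrightarrow> idx a \<in> {1..n}" "a \<in> V \<Longrightarrow> a \<in> A (idx a)"
  using idx_eq by (auto simp: V_def)

lemma lt_linear:
  assumes "a \<in> V" "b \<in> V" "a \<noteq> b"
  shows "lt a b \<longleftrightarrow> \<not> lt b a"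
proof (cases "idx a = idx b")
  case True
  have "countable (A (idx a))" using finA idx_in assms(1) by (meson countable_finite)
  moreover have "a \<in> A (idx a)" "b \<in> A (idx a)"
    using idx_in(2)[OF assms(1)] idx_in(2)[OF assms(2)] True by simp_all
  ultimately have "to_nat_on (A (idx a)) a \<noteq> to_nat_on (A (idx a)) b"
    using assms(3) inj_on_to_nat_on unfolding inj_on_def by blast
  moreover have "lt a b \<longleftrightarrow> to_nat_on (A (idx a)) a < to_nat_on (A (idx a)) b"
    "lt b a \<longleftrightarrow> to_nat_on (A (idx a)) b < to_nat_on (A (idx a)) a"
    using True by (simp_all add: lt_def)
  ultimately show ?thesis by linarith
qed (auto simp: lt_def)

lemma lt_irrefl: "\<not> lt a a"
  by (simp add: lt_def)

text \<open>The exponent \<open>idx a - 1\<close> depends on \<open>a\<close> alone and so occurs on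
  both sides. Of two vertices, removing the smaller lowers the position of the larger by one, while
  removing the larger does not move the smaller.\<close>

lemma anticommuting_eps: "anticommuting V (eps :: 'a \<Rightarrow> 'a set \<Rightarrow> 'k::field)"
  unfolding anticommuting_def
proof (intro conjI allI impI)
  fix S a
  show "eps a S * eps a S = (1::'k)"
    by (simp add: eps_def power_add[symmetric] mult_2[symmetric] del: mult_2)
next
  have asym: "eps a S * eps b (S - {a}) = - (eps b S * eps a (S - {b}) :: 'k)"
    if S: "S \<subseteq> V" "a \<in> S" "b \<in> S" "a \<noteq> b" and lt: "lt a b" for S a b
  proof -
    have fin: "finite S" using S(1) finV finite_subset by blast
    have "\<not> lt b a" using lt_linear[of a b] S lt by blast
    then have "{c \<in> S - {b}. lt c a} = {c \<in> S. lt c a}" by blast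
    moreover have "{c \<in> S. lt c b} = insert a {c \<in> S - {a}. lt c b}" using lt S(2) by blast
    then have "card {c \<in> S. lt c b} = Suc (card {c \<in> S - {a}. lt c b})" using fin by simp
    ultimately show ?thesis by (simp add: eps_def power_add mult_ac)
  qed
  fix S a b assume S: "S \<subseteq> V" "a \<in> S" "b \<in> S" "a \<noteq> b"
  show "eps a S * eps b (S - {a}) = - (eps b S * eps a (S - {b}) :: 'k)"
  proof (cases "lt a b")
    case True
    then show ?thesis using asym S by blast
  next
    case False
    then have "lt b a" using lt_linear[of a b] S by blast
    then have "eps b S * eps a (S - {b}) = - (eps a S * eps b (S - {a}) :: 'k)"
      using asym[of S b a] S by blast
    then show ?thesis by simp
  qed
qed

lemma eps_sq: "S \<subseteq> V \<Longrightarrow> a \<in> S \<Longrightarrow> eps a S * eps a S = (1::'k::field)"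
  by (rule anticommuting_sq[OF anticommuting_eps])

text \<open>As the only vertices of \<open>S\<close> in their colour class, \<open>a\<close> and
  \<open>b\<close> are consecutive in the order \<open>lt\<close>, so that their positions differ by
  one and their other exponents agree.\<close>

lemma eps_edge:
  assumes "S \<subseteq> V" "i \<in> {1..n}" "S \<inter> A i = {a, b}" "a \<noteq> b"
  shows "eps a S * eps b S = (- 1 :: 'k::field)"
proof -
  have fin: "finite S" using assms(1) finV finite_subset by blast
  have *: "eps a S * eps b S = (- 1 :: 'k)"
    if ab: "S \<inter> A i = {a, b}" "a \<noteq> b" "lt a b" for a b
  proof -
    have i: "idx a = i" "idx b = i" using ab idx_eq[OF assms(2)] by blast+
    have "lt c b \<longleftrightarrow> lt c a" if "c \<in> S" "c \<noteq> a" for c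
    proof (cases "idx c = i")
      case True
      then have "c \<in> S \<inter> A i" using that idx_in assms(1) by blast
      then have "c = b" using that ab by blast
      then show ?thesis using lt_irrefl lt_linear[of a b] ab assms(1) by blast
    qed (simp add: lt_def i)
    then have "{c \<in> S. lt c b} = insert a {c \<in> S. lt c a}" using ab lt_irrefl by blast
    then have "card {c \<in> S. lt c b} = Suc (card {c \<in> S. lt c a})"
      using fin lt_irrefl by simp
    then show ?thesis by (simp add: eps_def i power_add[symmetric] mult_2[symmetric] del: mult_2)
  qed
  show ?thesis
  proof (cases "lt a b")
    case True
    then show ?thesis using * assms by blast
  next
    case False
    then have "lt b a" using lt_linear[of a b] assms by blast
    moreover have "S \<inter> A i = {b, a}" using assms by blast
    ultimately have "eps b S * eps a S = (- 1 :: 'k)" using * assms by blast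
    then show ?thesis by (simp add: mult.commute)
  qed
qed

lemma card_eq_sum:
  assumes "S \<subseteq> V"
  shows "card S = (\<Sum>i\<in>{1..n}. card (S \<inter> A i))"
proof -
  have "S = (\<Union>i\<in>{1..n}. S \<inter> A i)" using assms by (auto simp: V_def)
  then have "card S = card (\<Union>i\<in>{1..n}. S \<inter> A i)" by simp
  also have "\<dots> = (\<Sum>i\<in>{1..n}. card (S \<inter> A i))"
    using finA disjA by (intro card_UN_disjoint) (auto simp: disjoint_family_on_def)
  finally show ?thesis .
qed

lemma full_card_ge:
  assumes "full S"
  shows "n \<le> card S"
proof -
  have "card (S \<inter> A i) \<ge> 1" if "i \<in> {1..n}" for i
    using assms that finA[OF that] by (auto simp: full_def Suc_le_eq card_gt_0_iff)
  then have "(\<Sum>i\<in>{1..n}. 1) \<le> (\<Sum>i\<in>{1..n}. card (S \<inter> A i))" by (intro sum_mono)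
  then show ?thesis using assms by (simp add: card_eq_sum full_def)
qed

lemma full_iff_trans: "S \<subseteq> V \<Longrightarrow> full S \<longleftrightarrow> trans S \<noteq> {}"
  by (auto simp: full_def trans_def PiE_eq_empty_iff)

lemma trans_mono: "S \<subseteq> S' \<Longrightarrow> trans S \<subseteq> trans S'"
  unfolding trans_def by (intro PiE_mono) blast

lemma full_mono: "full S \<Longrightarrow> S \<subseteq> S' \<Longrightarrow> S' \<subseteq> V \<Longrightarrow> full S'"
  unfolding full_def by blast

lemma hit_full: "hit U S \<Longrightarrow> full S"
  using full_iff_trans by (auto simp: hit_def)

lemma cell_full: "cell U S \<Longrightarrow> full S"
  by (simp add: cell_def)

lemma cell_mono: "cell U S \<Longrightarrow> full S' \<Longrightarrow> S' \<subseteq> S \<Longrightarrow> cell U S'"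
  using trans_mono unfolding cell_def by blast

lemma hit_or_cell:
  assumes "full S" "T \<subseteq> (\<Pi>\<^sub>E i\<in>{1..n}. A i)"
  shows "hit T S \<longleftrightarrow> \<not> cell ((\<Pi>\<^sub>E i\<in>{1..n}. A i) - T) S"
proof -
  have "trans S \<subseteq> (\<Pi>\<^sub>E i\<in>{1..n}. A i)" unfolding trans_def by (intro PiE_mono) blast
  then show ?thesis using assms by (auto simp: hit_def cell_def full_def)
qed

section \<open>Contractibility of a product of simplices\<close>

text \<open>The cochain form of coning with apex \<open>p\<close> inside the factor of
  \<open>p\<close>; the other factors are left alone. Sets that are not full are not cells and get
  the value 0.\<close>

definition prism :: "'a \<Rightarrow> ('a set \<Rightarrow> 'k::field) \<Rightarrow> 'a set \<Rightarrow> 'k" where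
  "prism p x S = (if p \<notin> S \<and> full S then eps p (insert p S) * x (insert p S) else 0)"

text \<open>Pullback along the map that collapses the whole factor of \<open>p\<close> to the vertex
  \<open>p\<close>. A cell of positive dimension in this factor becomes degenerate, hence the
  default 0.\<close>

definition proj :: "'a \<Rightarrow> ('a set \<Rightarrow> 'k::field) \<Rightarrow> 'a set \<Rightarrow> 'k" where
  "proj p x S = (if \<exists>b. S \<inter> A (idx p) = {b} then x (insert p (S - A (idx p))) else 0)"

text \<open>The usual homotopy formula between the identity and the collapse; the term
  \<open>prism p (cobd eps x)\<close> is absent because \<open>x\<close> is a cocycle.\<close>

lemma prism_homotopy:
  fixes x :: "'a set \<Rightarrow> 'k::field"
  assumes R: "R \<subseteq> V" and x: "supp_in full R d x" "\<forall>S\<subseteq>R. cobd eps x S = 0"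
    and p: "p \<in> R" and S: "S \<subseteq> R"
  shows "x S = proj p x S + cobd eps (prism p x) S"
proof -
  define i where "i = idx p"
  have i: "i \<in> {1..n}" "p \<in> A i" using p R idx_in by (auto simp: i_def)
  have SV: "S \<subseteq> V" using R S by blast
  have finS: "finite S" using SV finV finite_subset by blast
  have other: "A j \<inter> A i = {}" if "j \<in> {1..n}" "j \<noteq> i" for j
    using disjA that i(1) by (auto simp: disjoint_family_on_def)
  have disj: "b \<notin> A j" if "b \<in> A i" "j \<in> {1..n}" "j \<noteq> i" for j b
    using other that by blast
  show ?thesis
  proof (cases "full S")
    case False
    have "x S = 0" using supp_inD[OF x(1)] False by blast
    moreover have "full S" if "full (insert p (S - A i))" "S \<inter> A i \<noteq> {}"
      unfolding full_def
    proof (intro conjI ballI SV)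
      fix j assume j: "j \<in> {1..n}"
      show "S \<inter> A j \<noteq> {}"
      proof (cases "j = i")
        case False
        then have "insert p (S - A i) \<inter> A j \<noteq> {}" "p \<notin> A j"
          using that(1) j disj[OF i(2)] unfolding full_def by blast+
        then show ?thesis by blast
      qed (use that in simp)
    qed
    then have "proj p x S = 0"
      using False supp_inD(1)[OF x(1)] by (fastforce simp: proj_def i_def)
    moreover have "\<not> full (S - {a})" for a using False SV full_mono by blast
    then have "cobd eps (prism p x) S = 0" by (simp add: cobd_def prism_def)
    ultimately show ?thesis by simp
  next
    case fullS: True
    show ?thesis
    proof (cases "p \<in> S")
      case True
      \<comment> \<open>Only \<open>a = p\<close> contributes: every other \<open>S - {a}\<close>
        still contains \<open>p\<close>, where \<open>prism p x\<close> is zero.\<close>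
      have "cobd eps (prism p x) S = (\<Sum>a\<in>{p}. eps a S * prism p x (S - {a}))"
        unfolding cobd_def using finS True
        by (intro sum.mono_neutral_right) (auto simp: prism_def)
      also have "\<dots> = (if full (S - {p}) then x S else 0)"
        using True eps_sq[OF SV True, where 'k = 'k]
        by (simp add: prism_def insert_absorb mult.assoc[symmetric])
      finally have 1: "cobd eps (prism p x) S = (if full (S - {p}) then x S else 0)" .
      \<comment> \<open>Exactly one of the two terms gives \<open>x S\<close>: the homotopy if
        another vertex of colour \<open>i\<close> remains, the projection if \<open>p\<close> was
        the only one.\<close>
      have 2: "full (S - {p}) \<longleftrightarrow> S \<inter> A i \<noteq> {p}"
      proof
        assume "full (S - {p})"
        then show "S \<inter> A i \<noteq> {p}" using i by (auto simp: full_def)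
      next
        assume ne: "S \<inter> A i \<noteq> {p}"
        have "(S - {p}) \<inter> A j \<noteq> {}" if "j \<in> {1..n}" for j
        proof (cases "j = i")
          case True
          then show ?thesis using ne \<open>p \<in> S\<close> i(2) by blast
        next
          case False
          then have "p \<notin> A j" using disj i that by blast
          then show ?thesis using fullS that unfolding full_def by blast
        qed
        then show "full (S - {p})" using SV by (auto simp: full_def)
      qed
      have 3: "(\<exists>b. S \<inter> A i = {b}) \<longleftrightarrow> S \<inter> A i = {p}"
        using IntI[OF True i(2)] by (metis singletonD)
      show ?thesis
      proof (cases "S \<inter> A i = {p}")
        case True
        then have "insert p (S - A i) = S" by blast
        then show ?thesis using 1 2 3 True by (simp add: proj_def i_def[symmetric])
      next
        case False
        then show ?thesis using 1 2 3 by (simp add: proj_def i_def[symmetric])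
      qed
    next
      case pS: False
      define P where "P = insert p S"
      have P: "P \<subseteq> V" "p \<in> P" "P \<subseteq> R" using p S R by (auto simp: P_def)
      have PS: "P - {p} = S" using pS by (auto simp: P_def)
      \<comment> \<open>The cocycle condition on the coface \<open>P\<close> of \<open>S\<close>
        expresses \<open>x S\<close> through the other facets of \<open>P\<close>, all of which
        contain \<open>p\<close>.\<close>
      have "0 = eps p P * cobd eps x P" using x(2) P(3) by simp
      also have "cobd eps x P = eps p P * x S + (\<Sum>a\<in>S. eps a P * x (P - {a}))"
        unfolding cobd_def using finS pS PS by (simp add: P_def)
      also have "eps p P * \<dots> = x S + (\<Sum>a\<in>S. eps p P * eps a P * x (P - {a}))"
        using eps_sq[OF P(1,2), where 'k = 'k]
        by (simp add: distrib_left sum_distrib_left mult.assoc[symmetric])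
      finally have "x S = - (\<Sum>a\<in>S. eps p P * eps a P * x (P - {a}))"
        by (simp add: eq_neg_iff_add_eq_0)
      then have xS: "x S = (\<Sum>a\<in>S. - (eps p P * eps a P) * x (P - {a}))"
        by (simp add: sum_negf)
      \<comment> \<open>If \<open>S - {a}\<close> is full, the exchange of signs gives a term of the
        homotopy. If \<open>a\<close> is the only vertex of colour \<open>i\<close>, then
        \<open>p\<close> and \<open>a\<close> span an edge in that factor of \<open>P\<close> and
        the term belongs to the projection. Otherwise \<open>P - {a}\<close> has lost a colour and
        \<open>x\<close> vanishes there.\<close>
      have trm: "- (eps p P * eps a P) * x (P - {a}) =
          eps a S * prism p x (S - {a}) + (if S \<inter> A i = {a} then x (P - {a}) else 0)"
        if a: "a \<in> S" for a
      proof -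
        have ap: "a \<noteq> p" "a \<in> P" using a pS by (auto simp: P_def)
        have ins: "insert p (S - {a}) = P - {a}" using ap by (auto simp: P_def)
        have ex: "eps p P * eps a P = - (eps a S * eps p (P - {a}) :: 'k)"
          using anticommuting_exchange[OF anticommuting_eps P(1) P(2) ap(2)] ap(1) PS
          by simp
        show ?thesis
        proof (cases "full (S - {a})")
          case True
          then have "S \<inter> A i \<noteq> {a}" using i(1) by (auto simp: full_def)
          then show ?thesis using True pS by (simp add: ex prism_def ins)
        next
          case False
          show ?thesis
          proof (cases "S \<inter> A i = {a}")
            case True
            then have "P \<inter> A i = {p, a}" using i by (auto simp: P_def)
            then have "eps p P * eps a P = (- 1 :: 'k)"
              using eps_edge[OF P(1) i(1)] ap by blast
            then show ?thesis using True False by (simp add: prism_def)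
          next
            case ne: False
            have "\<not> full (P - {a})"
            proof
              assume f: "full (P - {a})"
              have "(S - {a}) \<inter> A j \<noteq> {}" if "j \<in> {1..n}" for j
              proof (cases "j = i")
                case True
                then show ?thesis using ne fullS i(1) unfolding full_def by blast
              next
                case False
                then have "p \<notin> A j" using disj i that by blast
                then show ?thesis using f that unfolding full_def P_def by blast
              qed
              then show False using \<open>\<not> full (S - {a})\<close> SV unfolding full_def by blast
            qed
            then have "x (P - {a}) = 0" using supp_inD(1)[OF x(1)] by blast
            then show ?thesis using False ne by (simp add: prism_def)
          qed
        qed
      qed
      have "(\<Sum>a\<in>S. if S \<inter> A i = {a} then x (P - {a}) else 0) = proj p x S"
      proof (cases "\<exists>b. S \<inter> A i = {b}")
        case True
        then obtain b where b: "S \<inter> A i = {b}" by blast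
        have "(\<Sum>a\<in>S. if S \<inter> A i = {a} then x (P - {a}) else 0) = (\<Sum>a\<in>S. if b = a then x (P - {a}) else 0)"
          using b by (intro sum.cong) auto
        also have "\<dots> = x (P - {b})" using finS b by (subst sum.delta') auto
        also have "P - {b} = insert p (S - A i)" using b pS by (auto simp: P_def)
        finally show ?thesis using True by (simp add: proj_def i_def[symmetric])
      next
        case False
        then show ?thesis by (auto simp: proj_def i_def[symmetric])
      qed
      then show ?thesis unfolding xS
        by (simp add: trm cobd_def sum.distrib del: mult_minus_left cong: sum.cong)
    qed
  qed
qed

lemma supp_in_prism:
  assumes R: "R \<subseteq> V" and x: "supp_in full R (Suc d) x" and p: "p \<in> R"
  shows "supp_in full R d (prism p x)"
proof (rule supp_inI)
  fix S assume "prism p x S \<noteq> 0"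
  then have *: "p \<notin> S" "full S" "x (insert p S) \<noteq> 0" by (auto simp: prism_def split: if_splits)
  then show "full S" by simp
  have "finite S" using *(2) finV finite_subset unfolding full_def by blast
  then show "S \<subseteq> R" "card S = n + d" using supp_inD[OF x *(3)] *(1) by auto
qed

lemma trans_replace:
  assumes "p \<in> V" "S \<subseteq> V" "S \<inter> A (idx p) = {b}"
  shows "card (insert p (S - A (idx p))) = card S"
    and "insert p (S - A (idx p)) \<inter> A (idx p) = {p}"
    and "j \<in> {1..n} \<Longrightarrow> j \<noteq> idx p \<Longrightarrow> insert p (S - A (idx p)) \<inter> A j = S \<inter> A j"
proof -
  have fin: "finite S" using assms(2) finV finite_subset by blast
  have b: "b \<in> S" using assms(3) by blast
  moreover have "S - A (idx p) = S - {b}" using assms(3) by blast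
  moreover have "p \<notin> S - A (idx p)" using idx_in assms(1) by blast
  ultimately show "card (insert p (S - A (idx p))) = card S"
    using card_Suc_Diff1[OF fin b] fin by simp
  show "insert p (S - A (idx p)) \<inter> A (idx p) = {p}" using idx_in assms(1) by blast
  assume j: "j \<in> {1..n}" "j \<noteq> idx p"
  then have "A j \<inter> A (idx p) = {}"
    using disjA idx_in assms(1) by (auto simp: disjoint_family_on_def)
  then show "insert p (S - A (idx p)) \<inter> A j = S \<inter> A j"
    using idx_in assms(1) by blast
qed

text \<open>Collapsing the factors one after the other to the points \<open>p i\<close> changes the
  cocycle by a coboundary each time. In the end only sets with one vertex of each colour are left,
  and these have \<open>n\<close> elements, fewer than \<open>n + Suc d\<close>.\<close>

lemma full_cocycle_exact:
  fixes x :: "'a set \<Rightarrow> 'k::field"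
  assumes R: "R \<subseteq> V" and x: "supp_in full R (Suc d) x" "\<forall>S\<subseteq>R. cobd eps x S = 0"
  shows "\<exists>y. supp_in full R d y \<and> (\<forall>S\<subseteq>R. cobd eps y S = x S)"
proof (cases "full R")
  case False
  have "x S = 0" if "S \<subseteq> R" for S
    using supp_inD[OF x(1), of S] full_mono[of S R] R False that by blast
  then show ?thesis by (intro exI[of _ "\<lambda>_. 0"]) (auto simp: supp_in_def cobd_def)
next
  case True
  then have "\<forall>i\<in>{1..n}. \<exists>p. p \<in> R \<inter> A i" by (auto simp: full_def)
  then obtain p where p: "\<And>i. i \<in> {1..n} \<Longrightarrow> p i \<in> R" "\<And>i. i \<in> {1..n} \<Longrightarrow> p i \<in> A i"
    by (metis IntD1 IntD2)
  have "\<exists>y z. supp_in full R d y \<and> supp_in full R (Suc d) z \<and> (\<forall>S\<subseteq>R. cobd eps z S = 0) \<and>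
      (\<forall>S\<subseteq>R. x S = z S + cobd eps y S) \<and> (\<forall>S. z S \<noteq> 0 \<longrightarrow> (\<forall>j\<in>{1..i}. card (S \<inter> A j) = 1))"
    if "i \<le> n" for i
    using that
  proof (induction i)
    case 0
    then show ?case using x
      by (intro exI[of _ "\<lambda>_. 0"] exI[of _ x]) (auto simp: supp_in_def cobd_def)
  next
    case (Suc i)
    then obtain y z where y: "supp_in full R d y" and z: "supp_in full R (Suc d) z"
      "\<forall>S\<subseteq>R. cobd eps z S = 0" and xz: "\<forall>S\<subseteq>R. x S = z S + cobd eps y S"
      and zi: "\<forall>S. z S \<noteq> 0 \<longrightarrow> (\<forall>j\<in>{1..i}. card (S \<inter> A j) = 1)"
      by fastforce
    define q where "q = p (Suc i)"
    have q: "q \<in> R" "q \<in> V" "idx q = Suc i"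
      using p[of "Suc i"] idx_eq Suc.prems R by (auto simp: q_def)
    \<comment> \<open>\<open>proj q z\<close> can be nonzero on sets outside \<open>R\<close>, since
      it forgets which vertex of colour \<open>Suc i\<close> the set has; hence the
      restriction.\<close>
    define z' where "z' S = (if S \<subseteq> R then proj q z S else 0)" for S
    define y' where "y' S = y S + prism q z S" for S
    have hz: "z S = z' S + cobd eps (prism q z) S" if "S \<subseteq> R" for S
      using prism_homotopy[OF R z q(1) that] that by (simp add: z'_def)
    have pr: "supp_in full R d (prism q z)" by (rule supp_in_prism[OF R z(1) q(1)])
    have "supp_in full R d y'" using y pr unfolding supp_in_def y'_def by force
    moreover have z'S: "full S \<and> S \<subseteq> R \<and> card S = n + Suc d \<and> (\<forall>j\<in>{1..Suc i}. card (S \<inter> A j) = 1)"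
      if nz: "z' S \<noteq> 0" for S
    proof -
      from nz obtain b where S: "S \<subseteq> R" "S \<inter> A (idx q) = {b}" "z (insert q (S - A (idx q))) \<noteq> 0"
        by (auto simp: z'_def proj_def split: if_splits)
      have SV: "S \<subseteq> V" using S R by blast
      note tr = trans_replace[OF q(2) SV S(2)] and zz = supp_inD[OF z(1) S(3)]
      have j: "S \<inter> A j \<noteq> {} \<and> (j \<le> Suc i \<longrightarrow> card (S \<inter> A j) = 1)" if "j \<in> {1..n}" for j
      proof (cases "j = idx q")
        case False
        have "insert q (S - A (idx q)) \<inter> A j \<noteq> {}" using zz(1) that by (simp add: full_def)
        moreover have "card (insert q (S - A (idx q)) \<inter> A j) = 1" if "j \<le> Suc i"
          using zi S(3) that \<open>j \<in> {1..n}\<close> False q(3) by (simp add: le_Suc_eq)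
        ultimately show ?thesis unfolding tr(3)[OF that False] by blast
      qed (simp add: S)
      show ?thesis using SV S(1) tr(1) zz(3) j Suc.prems by (auto simp: full_def)
    qed
    then have "supp_in full R (Suc d) z'" by (intro supp_inI) blast+
    moreover have "cobd eps z' S = 0" if "S \<subseteq> R" for S
    proof -
      have "cobd eps z' S = cobd eps (\<lambda>S. z S - cobd eps (prism q z) S) S"
        unfolding cobd_def[of eps z'] cobd_def[of eps "\<lambda>S. z S - cobd eps (prism q z) S"]
        using that hz by (intro sum.cong) (auto simp: subset_iff)
      then show ?thesis using z(2) that cobd_cobd[OF anticommuting_eps subset_trans[OF that R] finV]
        by (simp add: cobd_diff)
    qed
    moreover have "x S = z' S + cobd eps y' S" if "S \<subseteq> R" for S
      using xz hz that by (auto simp: y'_def cobd_def distrib_left sum.distrib)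
    ultimately have "supp_in full R d y' \<and> supp_in full R (Suc d) z' \<and>
        (\<forall>S\<subseteq>R. cobd eps z' S = 0) \<and> (\<forall>S\<subseteq>R. x S = z' S + cobd eps y' S)"
      by (intro conjI allI impI)
    then show ?case using z'S by blast
  qed
  from this[of n] obtain y z where y: "supp_in full R d y" and z: "supp_in full R (Suc d) z"
    and xz: "\<forall>S\<subseteq>R. x S = z S + cobd eps y S"
    and zi: "\<forall>S. z S \<noteq> 0 \<longrightarrow> (\<forall>j\<in>{1..n}. card (S \<inter> A j) = 1)"
    by blast
  have "z S = 0" for S
  proof (rule ccontr)
    assume nz: "z S \<noteq> 0"
    then have "S \<subseteq> V" "card S = n + Suc d" using supp_inD[OF z] by (auto simp: full_def)
    moreover have "(\<Sum>i\<in>{1..n}. card (S \<inter> A i)) = (\<Sum>i\<in>{1..n}. 1)"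
      using zi nz by (intro sum.cong) auto
    ultimately show False using card_eq_sum[of S] by simp
  qed
  then show ?thesis using y xz by auto
qed

text \<open>In degree 0 the homotopy vanishes: it would live on full sets with fewer than
  \<open>n\<close> elements. So \<open>x\<close> does not change when one vertex is replaced by
  another of its colour, and \<open>S\<close> reaches \<open>S'\<close> by finitely many such
  moves.\<close>

lemma full_cocycle_constant:
  fixes x :: "'a set \<Rightarrow> 'k::field"
  assumes R: "R \<subseteq> V" and x: "supp_in full R 0 x" "\<forall>S\<subseteq>R. cobd eps x S = 0"
    and S: "full S" "S \<subseteq> R" "card S = n" and S': "full S'" "S' \<subseteq> R" "card S' = n"
  shows "x S = x S'"
  using S
proof (induction "card (S' - S)" arbitrary: S rule: less_induct)
  case less
  have fin: "finite V" "finite S" "finite S'"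
    using finV less.prems S' R by (meson finite_subset subset_trans)+
  have SV: "S \<subseteq> V" using less.prems by (simp add: full_def)
  show ?case
  proof (cases "S' \<subseteq> S")
    case True
    then show ?thesis using fin less.prems S' by (metis card_subset_eq)
  next
    case False
    then obtain p where p: "p \<in> S'" "p \<notin> S" by blast
    have pV: "p \<in> V" "p \<in> R" using p S' R by blast+
    note ip = idx_in[OF pV(1)]
    have one: "card (S'' \<inter> A j) = 1" if "full S''" "card S'' = n" "j \<in> {1..n}" for S'' j
    proof (rule ccontr)
      have f: "finite (S'' \<inter> A j)" if "j \<in> {1..n}" for j using finA that by blast
      have ge: "card (S'' \<inter> A j) \<ge> 1" if "j \<in> {1..n}" for j
        using \<open>full S''\<close> that f[OF that] by (auto simp: full_def Suc_le_eq card_gt_0_iff)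
      assume "card (S'' \<inter> A j) \<noteq> 1"
      then have "card (S'' \<inter> A j) > 1" using ge[OF that(3)] by simp
      then have "(\<Sum>j\<in>{1..n}. 1) < (\<Sum>j\<in>{1..n}. card (S'' \<inter> A j))"
        using ge that(3) by (intro sum_strict_mono_ex1) (auto)
      then show False using card_eq_sum[of S''] that(1,2) by (simp add: full_def)
    qed
    obtain b where b: "S \<inter> A (idx p) = {b}"
      using one[OF less.prems(1,3) ip(1)] by (metis card_1_singletonE)
    have S'p: "S' \<inter> A (idx p) = {p}"
      using one[OF S'(1,3) ip(1)] p ip(2) by (metis IntI card_1_singletonE singletonD)
    define S1 where "S1 = insert p (S - A (idx p))"
    note tr = trans_replace[OF pV(1) SV b, folded S1_def]
    have S1: "S1 \<subseteq> R" "S1 \<subseteq> V" using less.prems pV SV by (auto simp: S1_def)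
    have "S1 \<inter> A j \<noteq> {}" if "j \<in> {1..n}" for j
      using tr(2) tr(3)[OF that] less.prems(1) that by (cases "j = idx p") (auto simp: full_def)
    then have fS1: "full S1" using S1 by (auto simp: full_def)
    have "S' - S1 \<subset> S' - S" using p S'p unfolding S1_def by blast
    then have lt: "card (S' - S1) < card (S' - S)" using fin by (intro psubset_card_mono) auto
    have "prism p x W = 0" for W
    proof (rule ccontr)
      assume "prism p x W \<noteq> 0"
      then have *: "p \<notin> W" "full W" "x (insert p W) \<noteq> 0" by (auto simp: prism_def split: if_splits)
      have "finite W" using *(2) finV finite_subset unfolding full_def by blast
      then show False using supp_inD[OF x(1) *(3)] *(1) full_card_ge[OF *(2)] by simp
    qed
    then have "x S = proj p x S"
      using prism_homotopy[OF R x pV(2) less.prems(2)] by (simp add: cobd_def)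
    also have "\<dots> = x S1" using b by (auto simp: proj_def S1_def)
    finally show ?thesis using less.hyps[OF lt fS1 S1(1)] tr(1) less.prems(3) by simp
  qed
qed

section \<open>Passage from \<open>T\<close> to its complement\<close>

lemma bd_restrict:
  assumes "R \<subseteq> V" "S \<subseteq> R" "\<And>S. c S \<noteq> 0 \<Longrightarrow> S \<subseteq> R"
  shows "bd e R c S = bd e V c S"
  unfolding bd_def using assms finV
  by (intro sum.mono_neutral_left) (auto intro: ccontr)

text \<open>A cochain of \<open>C(T\<^sup>c)\<close> extends by zero to the full product of simplices, where its coboundary
  lives on the complement of \<open>C(T\<^sup>c)\<close>, i.e. on the \<open>S\<close> with \<open>hit T S\<close>. This is the connecting map
  of the long exact sequence, and the full product has no cohomology.\<close>

lemma coacyc_imp_acyc_compl: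
  assumes T: "T \<subseteq> (\<Pi>\<^sub>E i\<in>{1..n}. A i)" and co: "coacyc TYPE('k::field) T"
  shows "acyc TYPE('k) ((\<Pi>\<^sub>E i\<in>{1..n}. A i) - T)"
  unfolding acyc_def
proof (intro allI impI)
  define Q where "Q = (\<Pi>\<^sub>E i\<in>{1..n}. A i) - T"
  fix R d and c :: "'a set \<Rightarrow> 'k"
  assume R: "R \<subseteq> V" and c: "supp_in (cell ((\<Pi>\<^sub>E i\<in>{1..n}. A i) - T)) R d c"
    and cyc: "if d = 0 then (\<Sum>S\<in>Pow R. c S) = 0 else (\<forall>S. full S \<longrightarrow> bd eps V c S = 0)"
  have c: "supp_in (cell Q) R d c" using c by (simp add: Q_def)
  have hc: "hit T S \<longleftrightarrow> \<not> cell Q S" if "full S" for S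
    using hit_or_cell[OF that T] by (simp add: Q_def)
  have finR: "finite R" using R finV finite_subset by blast
  define J where "J = {S. S \<subseteq> R \<and> cell Q S \<and> card S = n + d}"
  define I where "I = {S. S \<subseteq> R \<and> cell Q S \<and> card S = n + Suc d}"
  have "finite (Pow R)" using finR by simp
  then have finJ: "finite J" and finI: "finite I"
    by (rule rev_finite_subset, auto simp: J_def I_def)+
  \<comment> \<open>The incidence matrix between the cells of dimension \<open>d + 1\<close> and
    \<open>d\<close> of the complex of \<open>Q\<close> over \<open>R\<close>: applied to vectors
    indexed by \<open>J\<close> it is the coboundary (\<open>row\<close>), to vectors indexed by
    \<open>I\<close> the boundary (\<open>col\<close>).\<close>
  define r :: "'a set \<Rightarrow> 'a set \<Rightarrow> 'k" where
    "r S S' = (\<Sum>a\<in>S. if S - {a} = S' then eps a S else 0)" for S S'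
  have row: "(\<Sum>S'\<in>J. r S S' * x S') = (\<Sum>a\<in>S. if S - {a} \<in> J then eps a S * x (S - {a}) else 0)" for S x
  proof -
    have "(\<Sum>S'\<in>J. r S S' * x S') = (\<Sum>a\<in>S. \<Sum>S'\<in>J. if S - {a} = S' then eps a S * x S' else 0)"
      unfolding r_def sum_distrib_right by (subst sum.swap) (intro sum.cong refl, simp)
    also have "\<dots> = (\<Sum>a\<in>S. if S - {a} \<in> J then eps a S * x (S - {a}) else 0)"
      using finJ by (intro sum.cong refl) (simp add: sum.delta')
    finally show ?thesis .
  qed
  have col: "(\<Sum>S\<in>I. z S * r S S') = bd eps V (\<lambda>S. if S \<in> I then z S else 0) S'" if "S' \<in> J" for z S'
  proof -
    have S'V: "S' \<subseteq> V" "S' \<subseteq> R" using that R by (auto simp: J_def)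
    have "(\<Sum>S\<in>I. z S * r S S') = (\<Sum>(S, a)\<in>Sigma I (\<lambda>S. S). if S - {a} = S' then eps a S * z S else 0)"
    proof -
      have "finite S" if "S \<in> I" for S using that finR finite_subset by (auto simp: I_def)
      then show ?thesis using finI
        by (subst sum.Sigma[symmetric]) (auto simp: r_def sum_distrib_left intro!: sum.cong)
    qed
    also have "\<dots> = (\<Sum>a\<in>{a \<in> V - S'. insert a S' \<in> I}. eps a (insert a S') * z (insert a S'))"
    proof -
      have "(\<Sum>(S, a)\<in>Sigma I (\<lambda>S. S). if S - {a} = S' then eps a S * z S else 0) =
          (\<Sum>(S, a)\<in>{(S, a). S \<in> I \<and> a \<in> S \<and> S - {a} = S'}. eps a S * z S)"
      proof (rule sum.mono_neutral_cong_right)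
        have "finite S" if "S \<in> I" for S using that finR finite_subset by (auto simp: I_def)
        then show "finite (Sigma I (\<lambda>S. S))" using finI by blast
      qed (auto split: if_splits)
      also have "\<dots> = (\<Sum>a\<in>{a \<in> V - S'. insert a S' \<in> I}. eps a (insert a S') * z (insert a S'))"
      proof -
        have "{(S, a). S \<in> I \<and> a \<in> S \<and> S - {a} = S'} =
            (\<lambda>a. (insert a S', a)) ` {a \<in> V - S'. insert a S' \<in> I}" (is "?L = ?R")
        proof (intro subset_antisym subsetI)
          fix p assume "p \<in> ?L"
          then obtain S a where p: "p = (S, a)" "S \<in> I" "a \<in> S" "S - {a} = S'" by auto
          then have "insert a S' = S" "a \<in> V - S'" using R by (auto simp: I_def)
          then show "p \<in> ?R" using p by (intro image_eqI[of _ _ a]) simp_all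
        next
          fix p assume "p \<in> ?R"
          then show "p \<in> ?L" by auto
        qed
        moreover have "inj_on (\<lambda>a. (insert a S', a)) X" for X by (auto simp: inj_on_def)
        ultimately show ?thesis by (simp add: sum.reindex)
      qed
      finally show ?thesis .
    qed
    also have "\<dots> = bd eps V (\<lambda>S. if S \<in> I then z S else 0) S'"
      unfolding bd_def using finV by (intro sum.mono_neutral_cong_left) auto
    finally show ?thesis .
  qed
  \<comment> \<open>Either \<open>c\<close> bounds, or some cocycle \<open>x\<close> of the complex
    of \<open>Q\<close> has nonzero pairing with the cycle \<open>c\<close>; the second case has to
    be refuted.\<close>
  consider (span) z where "\<forall>S\<in>J. c S = (\<Sum>i\<in>I. z i * r i S)"
    | (sep) x where "\<forall>i\<in>I. (\<Sum>S\<in>J. r i S * x S) = 0" "(\<Sum>S\<in>J. c S * x S) \<noteq> 0"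
    using fredholm_alternative[OF finJ finI, of c r] by blast
  then have "\<exists>b. supp_in (cell Q) R (Suc d) b \<and> (\<forall>S. full S \<longrightarrow> bd eps V b S = c S)"
  proof cases
    case span
    define b where "b S = (if S \<in> I then z S else 0)" for S
    have "bd eps V b S = c S" if "full S" for S
    proof (cases "S \<in> J")
      case True
      then show ?thesis using span col by (simp add: b_def[abs_def])
    next
      case False
      have "b (insert a S) = 0" if a: "a \<in> V - S" for a
      proof (rule ccontr)
        assume "b (insert a S) \<noteq> 0"
        then have *: "insert a S \<in> I" by (auto simp: b_def split: if_splits)
        then have "cell Q S" "S \<subseteq> R" "finite S"
          using cell_mono[OF _ \<open>full S\<close>] finR finite_subset by (auto simp: I_def)
        then show False using * a False by (auto simp: I_def J_def)
      qed
      then have "bd eps V b S = 0" by (simp add: bd_def)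
      moreover have "c S = 0" using False supp_inD[OF c] by (auto simp: J_def)
      ultimately show ?thesis by simp
    qed
    then show ?thesis by (intro exI[of _ b]) (auto simp: supp_in_def b_def I_def split: if_splits)
  next
    case sep
    define x' where "x' S = (if S \<in> J then x S else 0)" for S
    define w where "w S = (if S \<subseteq> R then cobd eps x' S else 0)" for S
    have wI: "cobd eps x' S = 0" if "S \<in> I" for S
    proof -
      have "cobd eps x' S = (\<Sum>S'\<in>J. r S S' * x S')"
        unfolding row cobd_def x'_def by (intro sum.cong) auto
      then show ?thesis using sep(1) that by simp
    qed
    have "supp_in (hit T) R (Suc d) w"
      unfolding supp_in_def
    proof (intro allI impI)
      fix S assume nz: "w S \<noteq> 0"
      then have S: "S \<subseteq> R" "cobd eps x' S \<noteq> 0" by (auto simp: w_def split: if_splits)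
      then obtain a where a: "a \<in> S" "x' (S - {a}) \<noteq> 0"
        unfolding cobd_def by (metis (no_types, lifting) mult_zero_right sum.neutral)
      then have SJ: "S - {a} \<in> J" by (auto simp: x'_def split: if_splits)
      have "finite S" using S(1) finR finite_subset by blast
      then have "card S = n + Suc d" using SJ card_Suc_Diff1[OF _ a(1)] by (simp add: J_def)
      moreover have "full S" using SJ full_mono[of "S - {a}" S] S(1) R by (auto simp: J_def cell_def)
      moreover have "S \<notin> I" using wI S(2) by blast
      ultimately show "hit T S \<and> S \<subseteq> R \<and> card S = n + Suc d"
        using S(1) hc by (auto simp: I_def)
    qed
    moreover have "cobd eps w S = 0" if "S \<subseteq> R" for S
    proof -
      have "cobd eps w S = cobd eps (cobd eps x') S"
        unfolding cobd_def[of eps w] cobd_def[of eps "cobd eps x'"]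
        using that by (intro sum.cong) (auto simp: w_def)
      then show ?thesis using cobd_cobd[OF anticommuting_eps subset_trans[OF that R] finV] by simp
    qed
    ultimately obtain y where y: "supp_in (hit T) R d y" and wy: "\<forall>S\<subseteq>R. cobd eps y S = w S"
      using co[unfolded coacyc_def, rule_format, OF R, of d w] by blast
    \<comment> \<open>\<open>y\<close> has the same coboundary as \<open>x'\<close> on subsets of
      \<open>R\<close>, so \<open>z\<close> is a cocycle of the full product. It pairs with
      \<open>c\<close> as \<open>x'\<close> does, because \<open>y\<close> vanishes on the cells of
      \<open>Q\<close>.\<close>
    define z where "z S = x' S - y S" for S
    have z: "supp_in full R d z"
      using hit_full cell_full supp_inD[OF y] unfolding z_def x'_def J_def
      by (intro supp_inI) (force split: if_splits)+
    have zc: "\<forall>S\<subseteq>R. cobd eps z S = 0"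
      using wy unfolding z_def[abs_def] cobd_diff w_def by simp
    have yc: "y S * c S = 0" for S
      using supp_inD(1)[OF y, of S] supp_inD(1)[OF c, of S] hc hit_full by auto
    have "(\<Sum>S\<in>Pow R. z S * c S) = (\<Sum>S\<in>Pow R. x' S * c S)"
      by (simp only: z_def left_diff_distrib yc diff_0_right)
    also have "\<dots> = (\<Sum>S\<in>J. c S * x S)"
      using finR by (intro sum.mono_neutral_cong_right) (auto simp: J_def x'_def)
    finally have ne: "(\<Sum>S\<in>Pow R. z S * c S) \<noteq> 0" using sep(2) by simp
    have "(\<Sum>S\<in>Pow R. z S * c S) = 0"
    proof (cases d)
      case 0
      \<comment> \<open>In degree 0, \<open>z\<close> is a constant \<open>t\<close> on vertices and
        the pairing is \<open>t\<close> times the augmentation of \<open>c\<close>, which is 0 for a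
        reduced cycle.\<close>
      have "\<exists>t. \<forall>S. full S \<longrightarrow> S \<subseteq> R \<longrightarrow> card S = n \<longrightarrow> z S = t"
      proof (cases "\<exists>S0. full S0 \<and> S0 \<subseteq> R \<and> card S0 = n")
        case True
        then obtain S0 where "full S0" "S0 \<subseteq> R" "card S0 = n" by blast
        then show ?thesis using full_cocycle_constant[OF R z[unfolded 0] zc] by blast
      qed auto
      then obtain t where t: "\<And>S. full S \<Longrightarrow> S \<subseteq> R \<Longrightarrow> card S = n \<Longrightarrow> z S = t" by blast
      have "z S * c S = t * c S" for S
        using t[of S] supp_inD[OF c, of S] cell_full 0 by (cases "c S = 0") auto
      then have "(\<Sum>S\<in>Pow R. z S * c S) = t * (\<Sum>S\<in>Pow R. c S)"
        by (simp only: sum_distrib_left)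
      then show ?thesis using cyc 0 by simp
    next
      case (Suc d')
      then obtain u where u: "supp_in full R d' u" "\<forall>S\<subseteq>R. cobd eps u S = z S"
        using full_cocycle_exact[OF R z[unfolded Suc] zc] by blast
      \<comment> \<open>In higher degree, \<open>z\<close> is the coboundary of \<open>u\<close>,
        and adjointness moves the operator to \<open>c\<close>. The boundary of \<open>c\<close> is
        known to vanish on full sets only, which suffices since \<open>u\<close> lives
        there.\<close>
      have "(\<Sum>S\<in>Pow R. z S * c S) = (\<Sum>S\<in>Pow R. cobd eps u S * c S)"
        using u(2) by (intro sum.cong) auto
      also have "\<dots> = (\<Sum>S\<in>Pow R. u S * bd eps R c S)" by (rule sum_cobd_mult[OF finR])
      also have "\<dots> = 0"
      proof (rule sum.neutral, rule ballI)
        fix S assume "S \<in> Pow R"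
        then have "bd eps R c S = bd eps V c S"
          using supp_inD(2)[OF c] by (intro bd_restrict R) auto
        then show "u S * bd eps R c S = 0" using cyc Suc supp_inD(1)[OF u(1), of S] by (cases "u S = 0") auto
      qed
      finally show ?thesis .
    qed
    then show ?thesis using ne by blast
  qed
  then show "\<exists>b. supp_in (cell ((\<Pi>\<^sub>E i\<in>{1..n}. A i) - T)) R (Suc d) b \<and> (\<forall>S. full S \<longrightarrow> bd eps V b S = c S)"
    by (simp add: Q_def)
qed

end


section \<open>Cellular homology in terms of vertex sets\<close>

context colour_classes
begin

definition pc :: "'a set \<Rightarrow> (nat \<Rightarrow> 'a \<Rightarrow> real) set" where
  "pc S = prod_cell n (\<lambda>i. S \<inter> A i)"

definition vset :: "(nat \<Rightarrow> 'a \<Rightarrow> real) set \<Rightarrow> 'a set" where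
  "vset \<sigma> = (\<Union>i\<in>{1..n}. verts \<sigma> i)"

lemma A_unique: "i \<in> {1..n} \<Longrightarrow> j \<in> {1..n} \<Longrightarrow> a \<in> A i \<Longrightarrow> a \<in> A j \<Longrightarrow> i = j"
  using idx_eq by metis

lemma prod_cell_cong: "(\<And>i. i \<in> {1..n} \<Longrightarrow> Q i = Q' i) \<Longrightarrow> prod_cell n Q = prod_cell n Q'"
  unfolding prod_cell_def by (rule PiE_cong) simp

lemma verts_pc: "full S \<Longrightarrow> i \<in> {1..n} \<Longrightarrow> verts (pc S) i = S \<inter> A i"
  unfolding pc_def by (rule verts_prod_cell) (auto simp: full_def finA)

lemma vset_pc: "full S \<Longrightarrow> vset (pc S) = S"
  by (auto simp: vset_def verts_pc full_def V_def)

lemma pc_inj: "full S \<Longrightarrow> full S' \<Longrightarrow> pc S = pc S' \<longleftrightarrow> S = S'"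
  by (metis vset_pc)

lemma pc_empty:
  assumes "S \<subseteq> V" "\<not> full S"
  shows "pc S = {}"
proof -
  obtain i where "i \<in> {1..n}" "S \<inter> A i = {}" using assms by (auto simp: full_def)
  then show ?thesis
    by (auto simp: pc_def prod_cell_def PiE_eq_empty_iff geometric_simplex_def)
qed

text \<open>If \<open>a\<close> was the last vertex of its colour, \<open>pc (S' - {a})\<close> is a
  product with an empty factor, hence empty and no cell. The summands of \<open>incidence\<close>
  for such \<open>a\<close> therefore vanish.\<close>

lemma pc_Diff_eq:
  assumes S: "full S" and S': "full S'" and a: "a \<in> S'"
  shows "pc S = pc (S' - {a}) \<longleftrightarrow> S = S' - {a}"
proof (cases "full (S' - {a})")
  case True
  then show ?thesis using pc_inj S by blast
next
  case False
  have "S' - {a} \<subseteq> V" "a \<in> V" using S' a by (auto simp: full_def)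
  moreover have "pc S \<noteq> {}"
  proof
    assume "pc S = {}"
    then have "verts (pc S) (idx a) = {}" by (simp add: verts_def)
    then show False using verts_pc[OF S] idx_in[OF \<open>a \<in> V\<close>] S unfolding full_def by blast
  qed
  ultimately show ?thesis using pc_empty False S by blast
qed

text \<open>The vertices before \<open>a\<close> in \<open>lt\<close> are all those of the
  \<open>i - 1\<close> earlier colours and those before \<open>a\<close> in its own. Each earlier
  factor has one vertex more than its dimension; the resulting excess \<open>i - 1\<close> and the
  exponent \<open>idx a - 1\<close> in \<open>eps\<close> add up to an even number.\<close>

lemma eps_prefix:
  assumes S: "full S" and i: "i \<in> {1..n}" and a: "a \<in> S \<inter> A i"
  shows "(- 1) ^ (\<Sum>j=1..<i. card (S \<inter> A j) - 1) *
      (- 1) ^ card {b \<in> S \<inter> A i. to_nat_on (A i) b < to_nat_on (A i) a} = (eps a S :: 'k::field)"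
proof -
  have ia: "idx a = i" using idx_eq i a by blast
  have SV: "S \<subseteq> V" using S by (simp add: full_def)
  have fin: "finite S" using SV finV finite_subset by blast
  define L where "L = {b \<in> S \<inter> A i. to_nat_on (A i) b < to_nat_on (A i) a}"
  have "{b \<in> S. lt b a} = (\<Union>j\<in>{1..<i}. S \<inter> A j) \<union> L"
  proof (intro subset_antisym subsetI)
    fix b assume b: "b \<in> {b \<in> S. lt b a}"
    then have "b \<in> A (idx b)" "idx b \<in> {1..n}" using SV idx_in by blast+
    then show "b \<in> (\<Union>j\<in>{1..<i}. S \<inter> A j) \<union> L" using b by (auto simp: lt_def ia L_def)
  next
    fix b assume b: "b \<in> (\<Union>j\<in>{1..<i}. S \<inter> A j) \<union> L"
    then show "b \<in> {b \<in> S. lt b a}"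
    proof
      assume "b \<in> (\<Union>j\<in>{1..<i}. S \<inter> A j)"
      then obtain j where j: "j \<in> {1..<i}" "b \<in> S" "b \<in> A j" by blast
      then have "idx b = j" using i by (intro idx_eq) auto
      then show ?thesis using j by (simp add: lt_def ia)
    next
      assume "b \<in> L"
      then show ?thesis using idx_eq[OF i] by (auto simp: lt_def ia L_def)
    qed
  qed
  moreover have "(\<Union>j\<in>{1..<i}. S \<inter> A j) \<inter> L = {}"
  proof -
    have "A j \<inter> A i = {}" if "j \<in> {1..<i}" for j
      using disjA that i by (auto simp: disjoint_family_on_def)
    then show ?thesis unfolding L_def by blast
  qed
  ultimately have "card {b \<in> S. lt b a} = card (\<Union>j\<in>{1..<i}. S \<inter> A j) + card L"
    using fin by (simp add: card_Un_disjoint L_def)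
  also have "card (\<Union>j\<in>{1..<i}. S \<inter> A j) = (\<Sum>j\<in>{1..<i}. card (S \<inter> A j))"
  proof (rule card_UN_disjoint)
    show "\<forall>j\<in>{1..<i}. \<forall>k\<in>{1..<i}. j \<noteq> k \<longrightarrow> (S \<inter> A j) \<inter> (S \<inter> A k) = {}"
    proof (intro ballI impI)
      fix j k assume jk: "j \<in> {1..<i}" "k \<in> {1..<i}" "j \<noteq> k"
      then have "j \<in> {1..n}" "k \<in> {1..n}" using i by auto
      then show "(S \<inter> A j) \<inter> (S \<inter> A k) = {}" using A_unique jk(3) by blast
    qed
  qed (use fin in auto)
  also have "\<dots> = (\<Sum>j\<in>{1..<i}. (card (S \<inter> A j) - 1) + 1)"
  proof (rule sum.cong)
    fix j assume "j \<in> {1..<i}"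
    then have "S \<inter> A j \<noteq> {}" "finite (S \<inter> A j)" using S i fin by (auto simp: full_def)
    then have "card (S \<inter> A j) > 0" by (simp add: card_gt_0_iff)
    then show "card (S \<inter> A j) = (card (S \<inter> A j) - 1) + 1" by simp
  qed simp
  also have "\<dots> = (\<Sum>j\<in>{1..<i}. card (S \<inter> A j) - 1) + (i - 1)"
    by (simp only: sum.distrib) simp
  finally have "i - 1 + card {b \<in> S. lt b a} =
      (\<Sum>j\<in>{1..<i}. card (S \<inter> A j) - 1) + card L + 2 * (i - 1)" by simp
  then have "(eps a S :: 'k) = (- 1) ^ ((\<Sum>j\<in>{1..<i}. card (S \<inter> A j) - 1) + card L + 2 * (i - 1))"
    by (simp only: eps_def ia)
  also have "\<dots> = (- 1) ^ (\<Sum>j\<in>{1..<i}. card (S \<inter> A j) - 1) * (- 1) ^ card L"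
    by (simp only: power_add power_mult) simp
  finally show ?thesis by (simp add: L_def)
qed

lemma incidence_pc:
  assumes S: "full S" and S': "full S'"
  shows "incidence n A (pc S') (pc S) = (\<Sum>a\<in>S'. if S' - {a} = S then eps a S' else (0::'k::field))"
proof -
  have SV: "S' \<subseteq> V" using S' by (simp add: full_def)
  have "incidence n A (pc S') (pc S) =
      (\<Sum>i\<in>{1..n}. \<Sum>a\<in>S' \<inter> A i. if S' - {a} = S then eps a S' else (0::'k))"
    unfolding incidence_def
  proof (intro sum.cong refl)
    fix i assume i: "i \<in> {1..n}"
    then show "verts (pc S') i = S' \<inter> A i" by (rule verts_pc[OF S'])
    fix a assume a: "a \<in> S' \<inter> A i"
    have "prod_cell n ((verts (pc S'))(i := verts (pc S') i - {a})) = pc (S' - {a})"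
      unfolding pc_def[of "S' - {a}"]
    proof (rule prod_cell_cong)
      fix j assume j: "j \<in> {1..n}"
      have "a \<notin> A j" if "j \<noteq> i"
        using A_unique[OF i j] a that by blast
      then show "((verts (pc S'))(i := verts (pc S') i - {a})) j = (S' - {a}) \<inter> A j"
        using verts_pc[OF S'] i j by auto
    qed
    moreover have "(\<Sum>j = 1..<i. card (verts (pc S') j) - 1) = (\<Sum>j = 1..<i. card (S' \<inter> A j) - 1)"
      using i by (intro sum.cong refl) (simp add: verts_pc[OF S'])
    ultimately show "(if pc S = prod_cell n ((verts (pc S'))(i := verts (pc S') i - {a}))
          then (- 1) ^ (\<Sum>j = 1..<i. card (verts (pc S') j) - 1) *
            (- 1) ^ card {b \<in> verts (pc S') i. to_nat_on (A i) b < to_nat_on (A i) a} else 0) =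
        (if S' - {a} = S then eps a S' else (0::'k))"
      using eps_prefix[OF S' i a, where 'k = 'k] pc_Diff_eq[OF S S', of a] a i verts_pc[OF S'] by auto
  qed
  also have "\<dots> = (\<Sum>a\<in>(\<Union>i\<in>{1..n}. S' \<inter> A i). if S' - {a} = S then eps a S' else 0)"
    using finA disjA by (intro sum.UNION_disjoint[symmetric]) (auto simp: disjoint_family_on_def)
  also have "(\<Union>i\<in>{1..n}. S' \<inter> A i) = S'" using SV by (auto simp: V_def)
  finally show ?thesis .
qed

lemma cell_dim_pc:
  assumes "full S"
  shows "card S = n + cell_dim n (pc S)"
proof -
  have "card S = (\<Sum>i\<in>{1..n}. (card (S \<inter> A i) - 1) + 1)"
    unfolding card_eq_sum[OF assms[unfolded full_def, THEN conjunct1]]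
  proof (rule sum.cong)
    fix j assume "j \<in> {1..n}"
    then have "S \<inter> A j \<noteq> {}" "finite (S \<inter> A j)" using assms finA by (auto simp: full_def)
    then have "card (S \<inter> A j) > 0" by (simp add: card_gt_0_iff)
    then show "card (S \<inter> A j) = (card (S \<inter> A j) - 1) + 1" by simp
  qed simp
  also have "\<dots> = (\<Sum>i\<in>{1..n}. card (S \<inter> A i) - 1) + n"
    by (simp only: sum.distrib) simp
  also have "(\<Sum>i\<in>{1..n}. card (S \<inter> A i) - 1) = cell_dim n (pc S)"
    unfolding cell_dim_def by (intro sum.cong refl) (simp add: verts_pc[OF assms])
  finally show ?thesis by simp
qed

text \<open>A product of non-empty factors is contained in \<open>trans R\<close> only if each
  factor is contained in \<open>R\<close>, so intersecting \<open>U\<close> with a box amounts to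
  restricting to subsets of \<open>R\<close>.\<close>

lemma cell_complex_eq:
  assumes R: "R \<subseteq> V"
  shows "cell_complex n A (U \<inter> trans R) = pc ` {S. cell U S \<and> S \<subseteq> R}"
proof (intro subset_antisym subsetI)
  fix \<sigma> assume "\<sigma> \<in> cell_complex n A (U \<inter> trans R)"
  then obtain Q where Q: "\<sigma> = prod_cell n Q" "\<forall>i\<in>{1..n}. Q i \<noteq> {} \<and> Q i \<subseteq> A i"
      "(\<Pi>\<^sub>E i\<in>{1..n}. Q i) \<subseteq> U \<inter> trans R"
    unfolding cell_complex_def by blast
  define S where "S = (\<Union>i\<in>{1..n}. Q i)"
  have SA: "S \<inter> A i = Q i" if i: "i \<in> {1..n}" for i
  proof (intro subset_antisym subsetI)
    fix x assume "x \<in> S \<inter> A i"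
    then obtain j where "j \<in> {1..n}" "x \<in> Q j" "x \<in> A i" by (auto simp: S_def)
    moreover from this have "j = i" using A_unique[OF _ i] Q(2) by blast
    ultimately show "x \<in> Q i" by simp
  qed (use Q(2) i in \<open>auto simp: S_def\<close>)
  have trS: "trans S = (\<Pi>\<^sub>E i\<in>{1..n}. Q i)" unfolding trans_def by (rule PiE_cong) (rule SA)
  have "S \<subseteq> V" using Q(2) by (auto simp: S_def V_def)
  then have "full S" using Q(2) SA by (auto simp: full_def)
  moreover have "Q i \<subseteq> R" if "i \<in> {1..n}" for i
  proof -
    have "(\<Pi>\<^sub>E i\<in>{1..n}. Q i) \<subseteq> (\<Pi>\<^sub>E i\<in>{1..n}. R \<inter> A i)" using Q(3) by (simp add: trans_def)
    then show ?thesis using that Q(2) by (auto simp: subset_PiE PiE_eq_empty_iff)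
  qed
  moreover have "\<sigma> = pc S" unfolding Q(1) pc_def by (rule prod_cell_cong) (simp add: SA)
  ultimately show "\<sigma> \<in> pc ` {S. cell U S \<and> S \<subseteq> R}"
  proof (intro image_eqI[of _ _ S])
    assume S: "full S" "\<And>i. i \<in> {1..n} \<Longrightarrow> Q i \<subseteq> R"
    have "S \<subseteq> R" using S(2) unfolding S_def by blast
    then show "S \<in> {S. cell U S \<and> S \<subseteq> R}" using S(1) trS Q(3) by (simp add: cell_def)
  qed
next
  fix \<sigma> assume "\<sigma> \<in> pc ` {S. cell U S \<and> S \<subseteq> R}"
  then obtain S where S: "\<sigma> = pc S" "cell U S" "S \<subseteq> R" by blast
  then have "trans S \<subseteq> U \<inter> trans R" using trans_mono by (auto simp: cell_def)
  then show "\<sigma> \<in> cell_complex n A (U \<inter> trans R)"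
    unfolding cell_complex_def S(1) pc_def
    using S(2) by (intro CollectI exI[of _ "\<lambda>i. S \<inter> A i"]) (simp add: cell_def full_def trans_def)
qed

definition of_chain ::
  "(nat \<Rightarrow> 'a) set \<Rightarrow> 'a set \<Rightarrow> ((nat \<Rightarrow> 'a \<Rightarrow> real) set \<Rightarrow> 'k::field) \<Rightarrow> 'a set \<Rightarrow> 'k" where
  "of_chain U R C S = (if cell U S \<and> S \<subseteq> R then C (pc S) else 0)"

lemma finite_cells: "R \<subseteq> V \<Longrightarrow> finite {S. cell U S \<and> S \<subseteq> R}"
  using finV by (auto intro: rev_finite_subset[of "Pow V"])

lemma boundary_pc:
  fixes C :: "(nat \<Rightarrow> 'a \<Rightarrow> real) set \<Rightarrow> 'k::field"
  assumes R: "R \<subseteq> V" and S: "cell U S" "S \<subseteq> R"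
  shows "boundary n A (cell_complex n A (U \<inter> trans R)) C (pc S) = bd eps V (of_chain U R C) S"
proof -
  define K where "K = {S. cell U S \<and> S \<subseteq> R}"
  have finK: "finite K" using finite_cells[OF R] by (simp add: K_def)
  have inj: "inj_on pc K" using pc_inj by (auto simp: inj_on_def K_def cell_def)
  have SV: "S \<subseteq> V" using S R by blast
  have "boundary n A (cell_complex n A (U \<inter> trans R)) C (pc S) =
      (\<Sum>\<sigma>\<in>pc ` K. incidence n A \<sigma> (pc S) * C \<sigma>)"
    unfolding boundary_def cell_complex_eq[OF R] using S by (auto simp: K_def)
  also have "\<dots> = (\<Sum>S'\<in>K. (\<Sum>a\<in>S'. if S' - {a} = S then eps a S' else 0) * C (pc S'))"
    unfolding sum.reindex[OF inj] using S by (intro sum.cong refl) (simp add: incidence_pc K_def cell_def)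
  also have "\<dots> = (\<Sum>S'\<in>K. \<Sum>a\<in>V. if a \<in> S' \<and> S' - {a} = S then eps a S' * C (pc S') else 0)"
  proof (intro sum.cong refl)
    fix S' assume "S' \<in> K"
    then have "S' \<subseteq> V" using R by (auto simp: K_def)
    then show "(\<Sum>a\<in>S'. if S' - {a} = S then eps a S' else 0) * C (pc S') =
       (\<Sum>a\<in>V. if a \<in> S' \<and> S' - {a} = S then eps a S' * C (pc S') else 0)"
      unfolding sum_distrib_right using finV by (intro sum.mono_neutral_cong_left) auto
  qed
  also have "\<dots> = (\<Sum>a\<in>V. \<Sum>S'\<in>K. if a \<in> S' \<and> S' - {a} = S then eps a S' * C (pc S') else 0)"
    by (rule sum.swap)
  \<comment> \<open>For fixed \<open>a\<close> outside \<open>S\<close>, the only set containing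
    \<open>a\<close> that gives \<open>S\<close> on removing it is \<open>insert a S\<close>; for
    \<open>a\<close> in \<open>S\<close> there is none.\<close>
  also have "\<dots> = (\<Sum>a\<in>V - S. eps a (insert a S) * of_chain U R C (insert a S))"
  proof (rule sum.mono_neutral_cong_right[OF finV])
    show "\<forall>a\<in>V - (V - S). (\<Sum>S'\<in>K. if a \<in> S' \<and> S' - {a} = S then eps a S' * C (pc S') else 0) = 0"
      by (intro ballI sum.neutral) (simp, blast)
    fix a assume a: "a \<in> V - S"
    have "(\<Sum>S'\<in>K. if a \<in> S' \<and> S' - {a} = S then eps a S' * C (pc S') else 0) =
        (\<Sum>S'\<in>K. if S' = insert a S then eps a S' * C (pc S') else 0)"
      using a by (intro sum.cong refl if_cong) auto
    then show "(\<Sum>S'\<in>K. if a \<in> S' \<and> S' - {a} = S then eps a S' * C (pc S') else 0) =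
        eps a (insert a S) * of_chain U R C (insert a S)"
      using finK by (simp add: of_chain_def K_def)
  qed auto
  finally show ?thesis by (simp add: bd_def)
qed

text \<open>Full faces of cells are cells, so the boundary of a chain stays in the
  subcomplex.\<close>

lemma bd_outside:
  assumes c: "supp_in (cell U) R d c" and S: "full S" "\<not> (cell U S \<and> S \<subseteq> R)"
  shows "bd eps V c S = 0"
  unfolding bd_def
proof (rule sum.neutral, rule ballI)
  fix a
  have "c (insert a S) = 0"
  proof (rule ccontr)
    assume "c (insert a S) \<noteq> 0"
    then have "cell U (insert a S)" "insert a S \<subseteq> R" using supp_inD[OF c] by blast+
    then show False using S cell_mono[OF _ S(1)] by blast
  qed
  then show "eps a (insert a S) * c (insert a S) = 0" by simp
qed

lemma supp_of_chain:
  assumes R: "R \<subseteq> V" and C: "C \<in> chains n (cell_complex n A (U \<inter> trans R)) d"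
  shows "supp_in (cell U) R d (of_chain U R C)"
proof (rule supp_inI)
  fix S assume "of_chain U R C S \<noteq> 0"
  then have *: "cell U S" "S \<subseteq> R" "C (pc S) \<noteq> 0" by (auto simp: of_chain_def split: if_splits)
  then show "cell U S" "S \<subseteq> R" by blast+
  show "card S = n + d" using *(1,3) C cell_dim_pc[of S] by (auto simp: chains_def cell_def)
qed

lemma chain_of_supp:
  fixes c :: "'a set \<Rightarrow> 'k::field"
  assumes R: "R \<subseteq> V" and c: "supp_in (cell U) R d c"
  obtains C where "C \<in> chains n (cell_complex n A (U \<inter> trans R)) d" "of_chain U R C = c"
proof
  define C where "C \<sigma> = (if \<sigma> \<in> cell_complex n A (U \<inter> trans R) then c (vset \<sigma>) else 0)" for \<sigma>
  show "of_chain U R C = c"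
  proof
    fix S show "of_chain U R C S = c S"
    proof (cases "cell U S \<and> S \<subseteq> R")
      case True
      then have "pc S \<in> cell_complex n A (U \<inter> trans R)" unfolding cell_complex_eq[OF R] by blast
      then show ?thesis using True vset_pc[of S] by (simp add: of_chain_def C_def cell_def)
    next
      case False
      then show ?thesis using supp_inD(1,2)[OF c, of S] by (auto simp: of_chain_def)
    qed
  qed
  show "C \<in> chains n (cell_complex n A (U \<inter> trans R)) d"
    unfolding chains_def
  proof (intro CollectI allI impI)
    fix \<sigma> assume nz: "C \<sigma> \<noteq> 0"
    then have \<sigma>: "\<sigma> \<in> cell_complex n A (U \<inter> trans R)" "c (vset \<sigma>) \<noteq> 0"
      by (auto simp: C_def split: if_splits)
    then obtain S where S: "\<sigma> = pc S" "full S"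
      unfolding cell_complex_eq[OF R] by (auto simp: cell_def)
    then have "card S = n + d" using supp_inD(3)[OF c \<sigma>(2)] vset_pc by simp
    then show "\<sigma> \<in> cell_complex n A (U \<inter> trans R) \<and> cell_dim n \<sigma> = d"
      using \<sigma>(1) cell_dim_pc[OF S(2)] S(1) by simp
  qed
qed

lemma reduced_cycles_iff:
  fixes C :: "(nat \<Rightarrow> 'a \<Rightarrow> real) set \<Rightarrow> 'k::field"
  assumes R: "R \<subseteq> V" and C: "C \<in> chains n (cell_complex n A (U \<inter> trans R)) d"
  shows "C \<in> reduced_cycles n A (cell_complex n A (U \<inter> trans R)) d \<longleftrightarrow>
    (if d = 0 then (\<Sum>S\<in>Pow R. of_chain U R C S) = 0
     else (\<forall>S. full S \<longrightarrow> bd eps V (of_chain U R C) S = 0))"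
proof (cases "d = 0")
  case True
  define K where "K = {S. cell U S \<and> S \<subseteq> R}"
  have inj: "inj_on pc K" using pc_inj by (auto simp: inj_on_def K_def cell_def)
  have "(\<Sum>\<sigma>\<in>cell_complex n A (U \<inter> trans R). C \<sigma>) = (\<Sum>S\<in>K. C (pc S))"
    unfolding cell_complex_eq[OF R] K_def[symmetric] by (simp add: sum.reindex[OF inj])
  also have "\<dots> = (\<Sum>S\<in>Pow R. of_chain U R C S)"
    using R finV finite_subset[of R V]
    by (intro sum.mono_neutral_cong_left) (auto simp: K_def of_chain_def)
  finally show ?thesis using True C by (simp add: reduced_cycles_def)
next
  case False
  have "boundary n A (cell_complex n A (U \<inter> trans R)) C = (\<lambda>_. 0) \<longleftrightarrow>
      (\<forall>S. cell U S \<and> S \<subseteq> R \<longrightarrow> bd eps V (of_chain U R C) S = 0)"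
  proof
    assume "boundary n A (cell_complex n A (U \<inter> trans R)) C = (\<lambda>_. 0)"
    then show "\<forall>S. cell U S \<and> S \<subseteq> R \<longrightarrow> bd eps V (of_chain U R C) S = 0"
      using boundary_pc[OF R, of U _ C] by simp
  next
    assume *: "\<forall>S. cell U S \<and> S \<subseteq> R \<longrightarrow> bd eps V (of_chain U R C) S = 0"
    show "boundary n A (cell_complex n A (U \<inter> trans R)) C = (\<lambda>_. 0)"
    proof
      fix \<sigma> show "boundary n A (cell_complex n A (U \<inter> trans R)) C \<sigma> = 0"
      proof (cases "\<sigma> \<in> cell_complex n A (U \<inter> trans R)")
        case True
        then obtain S where "\<sigma> = pc S" "cell U S" "S \<subseteq> R" unfolding cell_complex_eq[OF R] by blast
        then show ?thesis using * boundary_pc[OF R, of U S C] by simp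
      qed (simp add: boundary_def)
    qed
  qed
  also have "\<dots> \<longleftrightarrow> (\<forall>S. full S \<longrightarrow> bd eps V (of_chain U R C) S = 0)"
    using bd_outside[OF supp_of_chain[OF R C]] cell_full by metis
  finally show ?thesis using False C by (simp add: reduced_cycles_def)
qed

lemma boundary_eq_iff:
  fixes B C :: "(nat \<Rightarrow> 'a \<Rightarrow> real) set \<Rightarrow> 'k::field"
  assumes R: "R \<subseteq> V" and C: "C \<in> chains n (cell_complex n A (U \<inter> trans R)) d"
    and B: "B \<in> chains n (cell_complex n A (U \<inter> trans R)) (Suc d)"
  shows "boundary n A (cell_complex n A (U \<inter> trans R)) B = C \<longleftrightarrow>
    (\<forall>S. full S \<longrightarrow> bd eps V (of_chain U R B) S = of_chain U R C S)"
proof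
  assume BC: "boundary n A (cell_complex n A (U \<inter> trans R)) B = C"
  show "\<forall>S. full S \<longrightarrow> bd eps V (of_chain U R B) S = of_chain U R C S"
  proof (intro allI impI)
    fix S assume S: "full S"
    show "bd eps V (of_chain U R B) S = of_chain U R C S"
    proof (cases "cell U S \<and> S \<subseteq> R")
      case True
      then show ?thesis using boundary_pc[OF R, of U S B] BC by (simp add: of_chain_def)
    next
      case False
      then show ?thesis using bd_outside[OF supp_of_chain[OF R B] S] by (auto simp: of_chain_def)
    qed
  qed
next
  assume *: "\<forall>S. full S \<longrightarrow> bd eps V (of_chain U R B) S = of_chain U R C S"
  show "boundary n A (cell_complex n A (U \<inter> trans R)) B = C"
  proof
    fix \<sigma> show "boundary n A (cell_complex n A (U \<inter> trans R)) B \<sigma> = C \<sigma>"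
    proof (cases "\<sigma> \<in> cell_complex n A (U \<inter> trans R)")
      case True
      then obtain S where S: "\<sigma> = pc S" "cell U S" "S \<subseteq> R" unfolding cell_complex_eq[OF R] by blast
      then show ?thesis using * boundary_pc[OF R S(2,3), of B] by (simp add: of_chain_def cell_def)
    next
      case False
      then have "C \<sigma> = 0" using C by (auto simp: chains_def)
      then show ?thesis using False by (simp add: boundary_def)
    qed
  qed
qed

lemma vanishing_iff:
  assumes R: "R \<subseteq> V"
  shows "reduced_homology_vanishes TYPE('k::field) n A (cell_complex n A (U \<inter> trans R)) d \<longleftrightarrow>
    (\<forall>c::'a set \<Rightarrow> 'k. supp_in (cell U) R d c \<longrightarrow>
      (if d = 0 then (\<Sum>S\<in>Pow R. c S) = 0 else (\<forall>S. full S \<longrightarrow> bd eps V c S = 0)) \<longrightarrow>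
      (\<exists>b. supp_in (cell U) R (Suc d) b \<and> (\<forall>S. full S \<longrightarrow> bd eps V b S = c S)))"
    (is "?vanish \<longleftrightarrow> (\<forall>c. ?supp c \<longrightarrow> ?cycle c \<longrightarrow> ?bounds c)")
proof
  assume v: ?vanish
  show "\<forall>c. ?supp c \<longrightarrow> ?cycle c \<longrightarrow> ?bounds c"
  proof (intro allI impI)
    fix c assume c: "?supp c" "?cycle c"
    obtain C where C: "C \<in> chains n (cell_complex n A (U \<inter> trans R)) d" "of_chain U R C = c"
      by (rule chain_of_supp[OF R c(1)])
    then have "C \<in> reduced_cycles n A (cell_complex n A (U \<inter> trans R)) d"
      using reduced_cycles_iff[OF R C(1)] c(2) by simp
    then have "C \<in> boundary n A (cell_complex n A (U \<inter> trans R)) `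
        chains n (cell_complex n A (U \<inter> trans R)) (Suc d)"
      by (rule subsetD[OF v[unfolded reduced_homology_vanishes_def]])
    then obtain B where B: "B \<in> chains n (cell_complex n A (U \<inter> trans R)) (Suc d)"
      "C = boundary n A (cell_complex n A (U \<inter> trans R)) B" by (elim imageE)
    then show "?bounds c"
      using boundary_eq_iff[OF R C(1) B(1)] supp_of_chain[OF R B(1)] C(2) by auto
  qed
next
  assume h: "\<forall>c. ?supp c \<longrightarrow> ?cycle c \<longrightarrow> ?bounds c"
  show ?vanish unfolding reduced_homology_vanishes_def
  proof
    fix C :: "(nat \<Rightarrow> 'a \<Rightarrow> real) set \<Rightarrow> 'k"
    assume Cz: "C \<in> reduced_cycles n A (cell_complex n A (U \<inter> trans R)) d"
    then have C: "C \<in> chains n (cell_complex n A (U \<inter> trans R)) d"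
      by (auto simp: reduced_cycles_def split: if_splits)
    have "?cycle (of_chain U R C)" using Cz by (simp only: reduced_cycles_iff[OF R C])
    then obtain b where b: "supp_in (cell U) R (Suc d) b"
        "\<forall>S. full S \<longrightarrow> bd eps V b S = of_chain U R C S"
      using h supp_of_chain[OF R C] by blast
    obtain B where B: "B \<in> chains n (cell_complex n A (U \<inter> trans R)) (Suc d)" "of_chain U R B = b"
      by (rule chain_of_supp[OF R b(1)])
    then have "boundary n A (cell_complex n A (U \<inter> trans R)) B = C"
      using boundary_eq_iff[OF R C B(1)] b(2) by simp
    then show "C \<in> boundary n A (cell_complex n A (U \<inter> trans R)) `
        chains n (cell_complex n A (U \<inter> trans R)) (Suc d)"
      using B(1) by blast
  qed
qed

lemma acyclic_over_iff: "acyclic_over TYPE('k::field) n A U \<longleftrightarrow> acyc TYPE('k) U"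
proof
  assume a: "acyclic_over TYPE('k) n A U"
  show "acyc TYPE('k) U"
    unfolding acyc_def
  proof (intro allI impI)
    fix R d and c :: "'a set \<Rightarrow> 'k"
    assume R: "R \<subseteq> V" and c: "supp_in (cell U) R d c"
      "if d = 0 then (\<Sum>S\<in>Pow R. c S) = 0 else (\<forall>S. full S \<longrightarrow> bd eps V c S = 0)"
    show "\<exists>b. supp_in (cell U) R (Suc d) b \<and> (\<forall>S. full S \<longrightarrow> bd eps V b S = c S)"
    proof (cases "full R")
      case True
      have "reduced_homology_vanishes TYPE('k) n A (cell_complex n A (U \<inter> trans R)) d"
        using a[unfolded acyclic_over_def, rule_format, of "\<lambda>i. R \<inter> A i" d] True
        by (auto simp: full_def trans_def)
      then show ?thesis using c unfolding vanishing_iff[OF R] by blast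
    next
      case False
      \<comment> \<open>Such an \<open>R\<close> does not come from a family of non-empty subsets,
        but it contains no cell either.\<close>
      have "c S = 0" for S
        using False supp_inD[OF c(1), of S] cell_full[of U S] full_mono[of S R] R by blast
      then show ?thesis by (intro exI[of _ "\<lambda>_. 0"]) (auto simp: supp_in_def bd_def)
    qed
  qed
next
  assume a: "acyc TYPE('k) U"
  show "acyclic_over TYPE('k) n A U"
    unfolding acyclic_over_def
  proof (intro allI impI)
    fix Q d assume Q: "\<forall>i\<in>{1..n}. Q i \<noteq> {} \<and> Q i \<subseteq> A i"
    define R where "R = (\<Union>i\<in>{1..n}. Q i)"
    have R: "R \<subseteq> V" using Q by (auto simp: R_def V_def)
    have "R \<inter> A i = Q i" if i: "i \<in> {1..n}" for i
    proof (intro subset_antisym subsetI)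
      fix x assume "x \<in> R \<inter> A i"
      then obtain j where j: "j \<in> {1..n}" "x \<in> Q j" "x \<in> A i" by (auto simp: R_def)
      then have "j = i" using A_unique[OF _ i] Q by blast
      then show "x \<in> Q i" using j by simp
    qed (use Q i in \<open>auto simp: R_def\<close>)
    then have "trans R = (\<Pi>\<^sub>E i\<in>{1..n}. Q i)" unfolding trans_def by (intro PiE_cong)
    moreover have "reduced_homology_vanishes TYPE('k) n A (cell_complex n A (U \<inter> trans R)) d"
      using a R unfolding vanishing_iff[OF R] acyc_def by blast
    ultimately show "reduced_homology_vanishes TYPE('k) n A
        (cell_complex n A (U \<inter> (\<Pi>\<^sub>E i\<in>{1..n}. Q i))) d" by simp
  qed
qed

end


section \<open>Polynomials\<close>

abbreviation cf :: "('a, 'k::field) mpoly \<Rightarrow> ('a \<Rightarrow>\<^sub>0 nat) \<Rightarrow> 'k" where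
  "cf \<equiv> Poly_Mapping.lookup"

abbreviation ex :: "('a \<Rightarrow>\<^sub>0 nat) \<Rightarrow> 'a \<Rightarrow> nat" where
  "ex \<equiv> Poly_Mapping.lookup"

definition var :: "'a \<Rightarrow> 'a \<Rightarrow>\<^sub>0 nat" where
  "var a = Poly_Mapping.single a 1"

text \<open>For finite \<open>W\<close>, the exponent vector of the squarefree monomial with support
  \<open>W\<close>.\<close>

definition ind :: "'a set \<Rightarrow> 'a \<Rightarrow>\<^sub>0 nat" where
  "ind W = (\<Sum>a\<in>W. var a)"

lemma ex_var: "ex (var a) b = (if a = b then 1 else 0)"
  by (simp add: var_def lookup_single when_def)

lemma keys_var: "Poly_Mapping.keys (var a) = {a}"
  by (simp add: var_def)

lemma ex_ind: "finite W \<Longrightarrow> ex (ind W) b = (if b \<in> W then 1 else 0)"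
  by (simp add: ind_def lookup_sum ex_var)

lemma keys_ind: "finite W \<Longrightarrow> Poly_Mapping.keys (ind W) = W"
  by (auto simp: in_keys_iff ex_ind split: if_splits)

lemma ind_insert: "finite W \<Longrightarrow> a \<notin> W \<Longrightarrow> ind (insert a W) = var a + ind W"
  by (simp add: ind_def)

lemma ind_remove: "finite W \<Longrightarrow> a \<in> W \<Longrightarrow> ind W = var a + ind (W - {a})"
  by (simp add: ind_def sum.remove)

lemma keys_add_nat: "Poly_Mapping.keys (m + m' :: 'a \<Rightarrow>\<^sub>0 nat) = Poly_Mapping.keys m \<union> Poly_Mapping.keys m'"
  by (auto simp: in_keys_iff lookup_add)

lemma mon_deg_superset:
  assumes "finite X" "Poly_Mapping.keys m \<subseteq> X"
  shows "mon_deg m = (\<Sum>x\<in>X. ex m x)"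
  unfolding mon_deg_def using assms by (intro sum.mono_neutral_left) (auto simp: in_keys_iff)

lemma mon_deg_add: "mon_deg (m + m') = mon_deg m + mon_deg m'"
proof -
  define X where "X = Poly_Mapping.keys m \<union> Poly_Mapping.keys m'"
  have X: "finite X" by (simp add: X_def)
  have "mon_deg (m + m') = (\<Sum>x\<in>X. ex (m + m') x)" "mon_deg m = (\<Sum>x\<in>X. ex m x)"
    "mon_deg m' = (\<Sum>x\<in>X. ex m' x)"
    by (intro mon_deg_superset[OF X]; simp add: keys_add_nat X_def)+
  then show ?thesis by (simp add: lookup_add sum.distrib)
qed

lemma mon_deg_var: "mon_deg (var a) = 1"
  by (simp add: mon_deg_def keys_var ex_var)

lemma mon_deg_ind: "finite W \<Longrightarrow> mon_deg (ind W) = card W"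
  by (simp add: mon_deg_def keys_ind ex_ind)

lemma cf_single_mult_add:
  fixes t :: "'a \<Rightarrow>\<^sub>0 nat" and p :: "('a, 'k::field) mpoly"
  shows "cf (Poly_Mapping.single t c * p) (t + u) = c * cf p u"
  by (simp add: lookup_mult lookup_single when_mult)

lemma cf_single_mult_not_add:
  fixes t :: "'a \<Rightarrow>\<^sub>0 nat" and p :: "('a, 'k::field) mpoly"
  assumes "\<And>u. s \<noteq> t + u"
  shows "cf (Poly_Mapping.single t c * p) s = 0"
  by (simp add: lookup_mult lookup_single when_mult assms)

lemma monomial_split: "(\<And>x. ex t x \<le> ex s x) \<Longrightarrow> s = t + (s - t)" for s t :: "'a \<Rightarrow>\<^sub>0 nat"
  by (intro poly_mapping_eqI) (simp add: lookup_add lookup_minus)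

lemma cf_var_mult:
  "cf (Poly_Mapping.single (var a) c * p) s = (if ex s a > 0 then c * cf p (s - var a) else 0)"
proof (cases "ex s a > 0")
  case True
  then have "s = var a + (s - var a)" by (intro monomial_split) (auto simp: ex_var)
  then show ?thesis using True cf_single_mult_add[of "var a" c p "s - var a"] by simp
next
  case False
  then have "s \<noteq> var a + u" for u by (auto simp: lookup_add ex_var)
  then show ?thesis using False by (simp add: cf_single_mult_not_add)
qed

lemma cf_ind_mult:
  assumes "finite W"
  shows "cf (Poly_Mapping.single (ind W) c * p) s =
    (if W \<subseteq> Poly_Mapping.keys s then c * cf p (s - ind W) else 0)"
proof (cases "W \<subseteq> Poly_Mapping.keys s")
  case True
  have "ex (ind W) x \<le> ex s x" for x
    using True assms by (auto simp: ex_ind in_keys_iff Suc_le_eq subset_iff)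
  then have "s = ind W + (s - ind W)" by (rule monomial_split)
  then show ?thesis using True cf_single_mult_add[of "ind W" c p "s - ind W"] by simp
next
  case False
  then have "s \<noteq> ind W + u" for u using assms by (auto simp: keys_add_nat keys_ind)
  then show ?thesis using False by (simp add: cf_single_mult_not_add)
qed

lemma minus_ind_add: "finite W \<Longrightarrow> W \<subseteq> Poly_Mapping.keys m \<Longrightarrow> (m - ind W) + ind W = m"
  by (intro poly_mapping_eqI) (auto simp: lookup_add lookup_minus ex_ind in_keys_iff subset_iff Suc_le_eq)

definition polys :: "'a set \<Rightarrow> ('a, 'k::field) mpoly set" where
  "polys V = carrier (poly_ring V)"

lemma polys_iff: "p \<in> polys V \<longleftrightarrow> (\<forall>m\<in>Poly_Mapping.keys p. Poly_Mapping.keys m \<subseteq> V)"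
  by (simp add: polys_def poly_ring_def)

lemma polysI: "(\<And>m. cf p m \<noteq> 0 \<Longrightarrow> Poly_Mapping.keys m \<subseteq> V) \<Longrightarrow> p \<in> polys V"
  by (auto simp: polys_iff in_keys_iff)

lemma polysD: "p \<in> polys V \<Longrightarrow> cf p m \<noteq> 0 \<Longrightarrow> Poly_Mapping.keys m \<subseteq> V"
  by (auto simp: polys_iff in_keys_iff)

lemma polys_0: "0 \<in> polys V"
  by (simp add: polys_iff)

lemma polys_add: "p \<in> polys V \<Longrightarrow> q \<in> polys V \<Longrightarrow> p + q \<in> polys V"
  using abelian_monoid.a_closed[OF abelian_group.axioms(1)[OF ring.is_abelian_group[OF
    cring.axioms(1)[OF cring_poly_ring]]], of p V q]
  by (simp add: polys_def poly_ring_def)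

lemma polys_mult: "p \<in> polys V \<Longrightarrow> q \<in> polys V \<Longrightarrow> p * q \<in> polys V"
  using monoid.m_closed[OF ring.is_monoid[OF cring.axioms(1)[OF cring_poly_ring]], of p V q]
  by (simp add: polys_def poly_ring_def)

lemma polys_sum: "(\<And>x. x \<in> X \<Longrightarrow> f x \<in> polys V) \<Longrightarrow> (\<Sum>x\<in>X. f x) \<in> polys V"
  by (induction X rule: infinite_finite_induct) (auto simp: polys_0 polys_add)

lemma polys_single: "Poly_Mapping.keys m \<subseteq> V \<Longrightarrow> Poly_Mapping.single m c \<in> polys V"
  by (simp add: polys_iff)

lemma poly_sum_monomials: "p = (\<Sum>m\<in>Poly_Mapping.keys p. Poly_Mapping.single m (cf p m))"
  by (intro poly_mapping_eqI) (simp add: lookup_sum lookup_single when_def in_keys_iff)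

lemma prod_mvar:
  "finite X \<Longrightarrow> (\<Prod>i\<in>X. mvar (a i)) = Poly_Mapping.single (\<Sum>i\<in>X. var (a i)) (1::'k::field)"
proof (induction X rule: finite_induct)
  case (insert x F)
  then show ?case by (simp add: mvar_def var_def mult_single)
qed simp


section \<open>Rainbow ideals\<close>

context colour_classes
begin

lemma ind_transversal:
  assumes "f \<in> (\<Pi>\<^sub>E i\<in>{1..n}. A i)"
  shows "(\<Sum>i=1..n. var (f i)) = ind (f ` {1..n})"
proof -
  have "inj_on f {1..n}"
    using assms A_unique by (intro inj_onI) (metis PiE_mem)
  then show ?thesis by (simp add: ind_def sum.reindex)
qed

lemma transversal_full:
  assumes f: "f \<in> (\<Pi>\<^sub>E i\<in>{1..n}. A i)"
  shows "full (f ` {1..n})" "trans (f ` {1..n}) = {f}" "card (f ` {1..n}) = n"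
proof -
  have fA: "f i \<in> A i" if "i \<in> {1..n}" for i using f that by blast
  have inj: "inj_on f {1..n}"
    using assms A_unique by (intro inj_onI) (metis PiE_mem)
  then show "card (f ` {1..n}) = n" by (simp add: card_image)
  have eq: "f ` {1..n} \<inter> A i = {f i}" if "i \<in> {1..n}" for i
    using fA A_unique that by (auto, metis)
  then show "full (f ` {1..n})" using fA by (auto simp: full_def V_def)
  have "trans (f ` {1..n}) = (\<Pi>\<^sub>E i\<in>{1..n}. {f i})"
    unfolding trans_def by (rule PiE_cong) (rule eq)
  also have "\<dots> = {f}" using f using f PiE_singleton[of f "{1..n}"] by (simp add: PiE_def)
  finally show "trans (f ` {1..n}) = {f}" .
qed

lemma hit_mono: "hit U S \<Longrightarrow> S \<subseteq> S' \<Longrightarrow> S' \<subseteq> V \<Longrightarrow> hit U S'"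
  using trans_mono[of S S'] by (auto simp: hit_def)

lemma hit_transversal:
  assumes "hit U S" "U \<subseteq> (\<Pi>\<^sub>E i\<in>{1..n}. A i)"
  obtains f where "f \<in> U" "f \<in> (\<Pi>\<^sub>E i\<in>{1..n}. A i)" "f ` {1..n} \<subseteq> S"
  using assms by (fastforce simp: hit_def trans_def PiE_iff)

text \<open>A monomial ideal contains a polynomial iff it contains all its terms, and divisibility
  by a squarefree generator depends only on the support of the term.\<close>

lemma rainbow_ideal_eq:
  assumes U: "U \<subseteq> (\<Pi>\<^sub>E i\<in>{1..n}. A i)"
  shows "(rainbow_ideal n A U :: ('a, 'k::field) mpoly set) =
      {p \<in> polys V. \<forall>m\<in>Poly_Mapping.keys p. hit U (Poly_Mapping.keys m)}"
    (is "_ = ?M")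
proof -
  let ?R = "poly_ring V :: ('a, 'k) mpoly ring"
  let ?G = "{\<Prod>i=1..n. mvar (a i) | a. a \<in> U} :: ('a, 'k) mpoly set"
  have ring: "ring ?R" using cring_poly_ring cring.axioms(1) by blast
  interpret ring ?R by (rule ring)
  have gen: "(\<Prod>i=1..n. mvar (a i)) = Poly_Mapping.single (ind (a ` {1..n})) (1::'k)"
    if "a \<in> U" for a
    using that U ind_transversal by (subst prod_mvar) auto
  have genV: "a ` {1..n} \<subseteq> V" if "a \<in> U" for a
    using transversal_full(1)[OF subsetD[OF U that]] by (simp add: full_def)
  have GM: "?G \<subseteq> ?M"
  proof
    fix p assume "p \<in> ?G"
    then obtain a where a: "a \<in> U" "p = (\<Prod>i=1..n. mvar (a i))" by blast
    have p: "p = Poly_Mapping.single (ind (a ` {1..n})) 1" unfolding a(2) by (rule gen[OF a(1)])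
    have "trans (a ` {1..n}) = {a}" using transversal_full(2) a(1) U by blast
    then have "hit U (a ` {1..n})" using a(1) genV[OF a(1)] by (simp add: hit_def)
    then show "p \<in> ?M" using genV[OF a(1)] by (simp add: p polys_iff keys_ind)
  qed
  have carr: "carrier ?R = polys V" by (simp add: polys_def)
  have mulM: "q * p \<in> ?M" if q: "q \<in> polys V" and p: "p \<in> ?M" for p q :: "('a, 'k) mpoly"
  proof -
    have pol: "q * p \<in> polys V" using q p polys_mult by blast
    moreover have "hit U (Poly_Mapping.keys m)" if m: "m \<in> Poly_Mapping.keys (q * p)" for m
    proof -
      obtain s t where "m = s + t" "t \<in> Poly_Mapping.keys p" using keys_mult[of q p] m by blast
      moreover have "Poly_Mapping.keys m \<subseteq> V" using pol m by (auto simp: polys_iff)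
      ultimately show ?thesis using p hit_mono[of U "Poly_Mapping.keys t"] by (auto simp: keys_add_nat)
    qed
    ultimately show ?thesis by blast
  qed
  have "ideal ?M ?R"
  proof (rule idealI[OF ring])
    show "subgroup ?M (add_monoid ?R)"
    proof
      show "?M \<subseteq> carrier (add_monoid ?R)" using carr by auto
      show "\<one>\<^bsub>add_monoid ?R\<^esub> \<in> ?M" by (simp add: poly_ring_def polys_0)
      fix p q :: "('a, 'k) mpoly" assume p: "p \<in> ?M" and q: "q \<in> ?M"
      show "p \<otimes>\<^bsub>add_monoid ?R\<^esub> q \<in> ?M"
        using p q polys_add keys_add[of p q] by (auto simp: poly_ring_def)
    next
      fix p :: "('a, 'k) mpoly" assume p: "p \<in> ?M"
      have m: "- p \<in> ?M" using mulM[of "- 1" p] p by (simp add: polys_iff)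
      have "- p \<oplus>\<^bsub>?R\<^esub> p = \<zero>\<^bsub>?R\<^esub>" by (simp add: poly_ring_def)
      then have "inv\<^bsub>add_monoid ?R\<^esub> p = - p"
        using minus_equality[of "- p" p] m p carr unfolding a_inv_def by auto
      then show "inv\<^bsub>add_monoid ?R\<^esub> p \<in> ?M" using m by simp
    qed
    fix p q :: "('a, 'k) mpoly" assume p: "p \<in> ?M" and q: "q \<in> carrier ?R"
    have "q * p \<in> ?M" using mulM p q unfolding carr by blast
    then show "q \<otimes>\<^bsub>?R\<^esub> p \<in> ?M" "p \<otimes>\<^bsub>?R\<^esub> q \<in> ?M"
      by (simp_all add: poly_ring_def mult.commute)
  qed
  then have "genideal ?R ?G \<subseteq> ?M" using GM by (rule genideal_minimal)
  moreover have "?M \<subseteq> genideal ?R ?G"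
  proof
    fix p :: "('a, 'k) mpoly" assume p: "p \<in> ?M"
    have Gc: "?G \<subseteq> carrier ?R" using GM carr by blast
    have id: "ideal (genideal ?R ?G) ?R" by (rule genideal_ideal[OF Gc])
    have sub: "additive_subgroup (genideal ?R ?G) ?R" using id ideal.axioms(1) by blast
    have term_in: "Poly_Mapping.single m c \<in> genideal ?R ?G"
      if m: "m \<in> Poly_Mapping.keys p" for m c
    proof -
      have "hit U (Poly_Mapping.keys m)" "Poly_Mapping.keys m \<subseteq> V" using p m by (auto simp: polys_iff)
      then obtain f where f: "f \<in> U" "f ` {1..n} \<subseteq> Poly_Mapping.keys m"
        using hit_transversal[OF _ U] by metis
      define g where "g = ind (f ` {1..n})"
      have m': "m = (m - g) + g" using minus_ind_add[OF _ f(2)] by (simp add: g_def)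
      have "Poly_Mapping.keys (m - g) \<subseteq> Poly_Mapping.keys m" by (auto simp: in_keys_iff lookup_minus)
      then have "Poly_Mapping.single (m - g) c \<in> carrier ?R"
        using \<open>Poly_Mapping.keys m \<subseteq> V\<close> by (simp add: carr polys_single)
      moreover have "Poly_Mapping.single g 1 \<in> genideal ?R ?G"
      proof (rule subsetD[OF genideal_self[OF Gc]])
        show "Poly_Mapping.single g 1 \<in> ?G"
          unfolding g_def gen[OF f(1), symmetric] using f(1) by (intro CollectI exI[of _ f]) simp
      qed
      ultimately have "Poly_Mapping.single (m - g) c \<otimes>\<^bsub>?R\<^esub> Poly_Mapping.single g 1 \<in> genideal ?R ?G"
        by (rule ideal.I_l_closed[OF id, rotated])
      then show ?thesis using m' by (simp add: poly_ring_def mult_single)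
    qed
    have "(\<Sum>m\<in>X. Poly_Mapping.single m (cf p m)) \<in> genideal ?R ?G"
      if "finite X" "X \<subseteq> Poly_Mapping.keys p" for X
      using that
    proof (induction X rule: finite_induct)
      case empty
      then show ?case using additive_subgroup.zero_closed[OF sub] by (simp add: poly_ring_def)
    next
      case (insert x F)
      then have "Poly_Mapping.single x (cf p x) \<oplus>\<^bsub>?R\<^esub> (\<Sum>m\<in>F. Poly_Mapping.single m (cf p m)) \<in> genideal ?R ?G"
        using term_in by (intro additive_subgroup.a_closed[OF sub]) auto
      then show ?case using insert.hyps by (simp add: poly_ring_def)
    qed
    from this[OF finite_keys subset_refl] show "p \<in> genideal ?R ?G"
      by (simp only: poly_sum_monomials[symmetric])
  qed
  ultimately show ?thesis unfolding rainbow_ideal_def V_def by blast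
qed

end


section \<open>Graded free modules\<close>

lemma free_module_iff:
  "v \<in> free_module V \<delta> \<longleftrightarrow> (\<forall>j. v j \<in> polys V) \<and> (\<forall>j\<ge>length \<delta>. v j = 0)"
  by (auto simp: free_module_def polys_def[symmetric] polys_0) (metis not_le_imp_less polys_0)

lemma graded_part_iff:
  "v \<in> graded_part V \<delta> e \<longleftrightarrow> v \<in> free_module V \<delta> \<and>
     (\<forall>j m. cf (v j) m \<noteq> 0 \<longrightarrow> int (mon_deg m) + \<delta> ! j = e)"
proof
  assume v: "v \<in> graded_part V \<delta> e"
  then have f: "v \<in> free_module V \<delta>" by (simp add: graded_part_def)
  have "int (mon_deg m) + \<delta> ! j = e" if nz: "cf (v j) m \<noteq> 0" for j m
  proof -
    have "j < length \<delta>" using f nz by (auto simp: free_module_iff not_le[symmetric])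
    then show ?thesis using v nz by (auto simp: graded_part_def in_keys_iff)
  qed
  then show "v \<in> free_module V \<delta> \<and> (\<forall>j m. cf (v j) m \<noteq> 0 \<longrightarrow> int (mon_deg m) + \<delta> ! j = e)"
    using f by blast
qed (auto simp: graded_part_def in_keys_iff)

lemma graded_part_free: "v \<in> graded_part V \<delta> e \<Longrightarrow> v \<in> free_module V \<delta>"
  by (simp add: graded_part_def)

lemma free_module_0: "(\<lambda>_. 0) \<in> free_module V \<delta>"
  by (simp add: free_module_iff polys_0)

lemma graded_part_0: "(\<lambda>_. 0) \<in> graded_part V \<delta> e"
  by (simp add: graded_part_iff free_module_0)

lemma free_module_add:
  "v \<in> free_module V \<delta> \<Longrightarrow> w \<in> free_module V \<delta> \<Longrightarrow> (\<lambda>j. v j + w j) \<in> free_module V \<delta>"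
  by (simp add: free_module_iff polys_add)

lemma free_module_smult:
  "p \<in> polys V \<Longrightarrow> v \<in> free_module V \<delta> \<Longrightarrow> (\<lambda>j. p * v j) \<in> free_module V \<delta>"
  by (simp add: free_module_iff polys_mult)

lemma free_module_sum:
  "(\<And>b. b \<in> B \<Longrightarrow> v b \<in> free_module V \<delta>) \<Longrightarrow> (\<lambda>j. \<Sum>b\<in>B. v b j) \<in> free_module V \<delta>"
  by (simp add: free_module_iff polys_sum)

lemma minus_one_polys: "- 1 \<in> polys V"
  by (simp add: polys_iff)

lemma free_module_diff:
  "v \<in> free_module V \<delta> \<Longrightarrow> w \<in> free_module V \<delta> \<Longrightarrow> (\<lambda>j. v j - w j) \<in> free_module V \<delta>"
  using free_module_add[of v V \<delta> "\<lambda>j. - 1 * w j"] free_module_smult[OF minus_one_polys, of w V \<delta>]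
  by simp

lemma graded_part_diff:
  "v \<in> graded_part V \<delta> e \<Longrightarrow> w \<in> graded_part V \<delta> e \<Longrightarrow> (\<lambda>j. v j - w j) \<in> graded_part V \<delta> e"
  unfolding graded_part_iff using free_module_diff[of v V \<delta> w]
  by (auto simp: lookup_minus) (metis diff_self)

lemma graded_part_sum:
  assumes "\<And>b. b \<in> B \<Longrightarrow> v b \<in> graded_part V \<delta> e"
  shows "(\<lambda>j. \<Sum>b\<in>B. v b j) \<in> graded_part V \<delta> e"
  unfolding graded_part_iff
proof (intro conjI allI impI)
  show "(\<lambda>j. \<Sum>b\<in>B. v b j) \<in> free_module V \<delta>"
    using assms graded_part_free by (intro free_module_sum) blast
  fix j m assume "cf (\<Sum>b\<in>B. v b j) m \<noteq> 0"
  then have "(\<Sum>b\<in>B. cf (v b j) m) \<noteq> 0" by (simp add: lookup_sum)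
  then obtain b where "b \<in> B" "cf (v b j) m \<noteq> 0" by (meson sum.neutral)
  then show "int (mon_deg m) + \<delta> ! j = e" using assms unfolding graded_part_iff by blast
qed

lemma graded_part_var_mult:
  assumes v: "v \<in> graded_part V \<delta> e" and a: "a \<in> V"
  shows "(\<lambda>j. Poly_Mapping.single (var a) c * v j) \<in> graded_part V \<delta> (e + 1)"
  unfolding graded_part_iff
proof (intro conjI allI impI)
  show "(\<lambda>j. Poly_Mapping.single (var a) c * v j) \<in> free_module V \<delta>"
    using a by (intro free_module_smult graded_part_free[OF v] polys_single) (simp add: keys_var)
  fix j m assume "cf (Poly_Mapping.single (var a) c * v j) m \<noteq> 0"
  then have *: "ex m a > 0" "cf (v j) (m - var a) \<noteq> 0" by (auto simp: cf_var_mult split: if_splits)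
  have "m = var a + (m - var a)" using *(1) by (intro monomial_split) (auto simp: ex_var)
  then have "mon_deg m = Suc (mon_deg (m - var a))"
    by (metis mon_deg_add mon_deg_var plus_1_eq_Suc)
  then show "int (mon_deg m) + \<delta> ! j = e + 1"
    using v *(2) unfolding graded_part_iff by fastforce
qed

lemma graded_homD:
  assumes "graded_hom V \<delta> \<delta>' f"
  shows "v \<in> free_module V \<delta> \<Longrightarrow> f v \<in> free_module V \<delta>'"
    and "v \<in> free_module V \<delta> \<Longrightarrow> w \<in> free_module V \<delta> \<Longrightarrow> f (\<lambda>j. v j + w j) = (\<lambda>j. f v j + f w j)"
    and "p \<in> polys V \<Longrightarrow> v \<in> free_module V \<delta> \<Longrightarrow> f (\<lambda>j. p * v j) = (\<lambda>j. p * f v j)"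
    and "v \<in> graded_part V \<delta> e \<Longrightarrow> f v \<in> graded_part V \<delta>' e"
  using assms unfolding graded_hom_def polys_def by blast+

lemma graded_hom_0:
  assumes "graded_hom V \<delta> \<delta>' f"
  shows "f (\<lambda>_. 0) = (\<lambda>_. 0)"
  using graded_homD(3)[OF assms polys_0 free_module_0] by simp

lemma graded_hom_diff:
  assumes f: "graded_hom V \<delta> \<delta>' f" and v: "v \<in> free_module V \<delta>" and w: "w \<in> free_module V \<delta>"
  shows "f (\<lambda>j. v j - w j) = (\<lambda>j. f v j - f w j)"
proof -
  have "f (\<lambda>j. v j + - 1 * w j) = (\<lambda>j. f v j + f (\<lambda>j. - 1 * w j) j)"
    by (rule graded_homD(2)[OF f v free_module_smult[OF minus_one_polys w]])
  also have "f (\<lambda>j. - 1 * w j) = (\<lambda>j. - 1 * f w j)"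
    by (rule graded_homD(3)[OF f minus_one_polys w])
  finally show ?thesis by simp
qed

lemma graded_hom_sum:
  assumes f: "graded_hom V \<delta> \<delta>' f" and B: "finite B"
    and v: "\<And>b. b \<in> B \<Longrightarrow> v b \<in> free_module V \<delta>"
  shows "f (\<lambda>j. \<Sum>b\<in>B. v b j) = (\<lambda>j. \<Sum>b\<in>B. f (v b) j)"
  using B v
proof (induction B rule: finite_induct)
  case empty
  then show ?case using graded_hom_0[OF f] by simp
next
  case (insert b F)
  have "f (\<lambda>j. v b j + (\<Sum>b\<in>F. v b j)) = (\<lambda>j. f (v b) j + f (\<lambda>j. \<Sum>b\<in>F. v b j) j)"
    using insert.prems by (intro graded_homD(2)[OF f] free_module_sum) auto
  then show ?case using insert by simp
qed

text \<open>The shifts of the basis are ignored: this is a homogeneous component of the free module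
  only when all basis degrees agree, as they do in each step of a linear resolution.\<close>

definition hcomp :: "nat \<Rightarrow> (nat \<Rightarrow> ('a, 'k::field) mpoly) \<Rightarrow> nat \<Rightarrow> ('a, 'k) mpoly" where
  "hcomp t v j = Abs_poly_mapping (\<lambda>m. if mon_deg m = t then cf (v j) m else 0)"

lemma cf_hcomp: "cf (hcomp t v j) m = (if mon_deg m = t then cf (v j) m else 0)"
proof -
  have "{m. (if mon_deg m = t then cf (v j) m else 0) \<noteq> 0} \<subseteq> {m. cf (v j) m \<noteq> 0}"
    by (auto split: if_splits)
  then have "finite {m. (if mon_deg m = t then cf (v j) m else 0) \<noteq> 0}"
    using finite_lookup by (rule finite_subset)
  then show ?thesis by (simp add: hcomp_def)
qed

lemma hcomp_graded:
  assumes v: "v \<in> free_module V \<delta>" and \<delta>: "\<And>d. d \<in> set \<delta> \<Longrightarrow> d = c"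
  shows "hcomp t v \<in> graded_part V \<delta> (int t + c)"
proof -
  have 0: "hcomp t v j = 0" if "j \<ge> length \<delta>" for j
    using v that by (intro poly_mapping_eqI) (simp add: cf_hcomp free_module_iff)
  have "hcomp t v j \<in> polys V" for j
  proof (rule polysI)
    fix m assume "cf (hcomp t v j) m \<noteq> 0"
    then show "Poly_Mapping.keys m \<subseteq> V"
      using v polysD[of "v j" V m] by (auto simp: cf_hcomp free_module_iff split: if_splits)
  qed
  moreover have "int (mon_deg m) + \<delta> ! j = int t + c" if nz: "cf (hcomp t v j) m \<noteq> 0" for j m
  proof -
    have "j < length \<delta>" using 0[of j] nz by (cases "j < length \<delta>") auto
    then have "\<delta> ! j = c" by (intro \<delta>) simp
    moreover have "mon_deg m = t" using nz by (auto simp: cf_hcomp split: if_splits)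
    ultimately show ?thesis by simp
  qed
  ultimately show ?thesis using 0 by (simp add: graded_part_iff free_module_iff)
qed

lemma homogeneous_preimage:
  assumes f: "graded_hom V \<delta> \<delta>' f" and \<delta>: "\<And>d. d \<in> set \<delta> \<Longrightarrow> d = c"
    and v: "v \<in> free_module V \<delta>" and fv: "f v \<in> graded_part V \<delta>' e"
  obtains w where "w \<in> graded_part V \<delta> e" "f w = f v"
proof
  define T where "T = (\<Union>j<length \<delta>. mon_deg ` Poly_Mapping.keys (v j))"
  have finT: "finite T" by (simp add: T_def)
  \<comment> \<open>Zero if \<open>v\<close> has no terms of polynomial degree \<open>e - c\<close>.
    This includes \<open>e < c\<close>, where \<open>nat\<close> would truncate to degree 0.\<close>
  define w where "w = (if e - c \<in> int ` T then hcomp (nat (e - c)) v else (\<lambda>_. 0))"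
  note gr = hcomp_graded[OF v \<delta>]
  show "w \<in> graded_part V \<delta> e"
  proof (cases "e - c \<in> int ` T")
    case True
    then have "int (nat (e - c)) + c = e" by auto
    then show ?thesis using gr[of "nat (e - c)"] True by (simp add: w_def)
  qed (simp add: w_def graded_part_0)
  have vsum: "v = (\<lambda>j. \<Sum>t\<in>T. hcomp t v j)"
  proof (intro ext poly_mapping_eqI)
    fix j m
    have "mon_deg m \<in> T" if "cf (v j) m \<noteq> 0"
    proof -
      have "j < length \<delta>" using v that by (auto simp: free_module_iff not_le[symmetric])
      moreover have "m \<in> Poly_Mapping.keys (v j)" using that by (simp add: in_keys_iff)
      ultimately show ?thesis unfolding T_def by blast
    qed
    then show "cf (v j) m = cf (\<Sum>t\<in>T. hcomp t v j) m"
      using finT by (auto simp: lookup_sum cf_hcomp)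
  qed
  have fsum: "f v = (\<lambda>j. \<Sum>t\<in>T. f (hcomp t v) j)"
    by (subst vsum, rule graded_hom_sum[OF f finT]) (rule graded_part_free[OF gr])
  have fgr: "f (hcomp t v) \<in> graded_part V \<delta>' (int t + c)" for t
    by (rule graded_homD(4)[OF f gr])
  have fw: "f w \<in> graded_part V \<delta>' e" by (rule graded_homD(4)[OF f]) fact
  show "f w = f v"
  proof (intro ext poly_mapping_eqI)
    fix j m
    show "cf (f w j) m = cf (f v j) m"
    proof (cases "int (mon_deg m) + \<delta>' ! j = e")
      case False
      then have "cf (f w j) m = 0" "cf (f v j) m = 0" using fw fv unfolding graded_part_iff by blast+
      then show ?thesis by simp
    next
      case True
      \<comment> \<open>Components of other degrees have images in other degrees, so at most one
        summand reaches the exponent \<open>m\<close>.\<close>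
      have other: "cf (f (hcomp t v) j) m = 0" if "int t \<noteq> e - c" for t
        using fgr[of t] True that unfolding graded_part_iff by force
      have "cf (f v j) m = (\<Sum>t\<in>T. cf (f (hcomp t v) j) m)" by (simp add: fsum lookup_sum)
      also have "\<dots> = cf (f w j) m"
      proof (cases "e - c \<in> int ` T")
        case True
        then obtain t where t: "t \<in> T" "int t = e - c" by auto
        have "(\<Sum>t\<in>T. cf (f (hcomp t v) j) m) = (\<Sum>t\<in>{t}. cf (f (hcomp t v) j) m)"
          using t finT other by (intro sum.mono_neutral_right) auto
        also have "\<dots> = cf (f w j) m" using t True by (simp add: w_def flip: t(2))
        finally show ?thesis .
      next
        case False
        then have "(\<Sum>t\<in>T. cf (f (hcomp t v) j) m) = 0" using other by (intro sum.neutral) force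
        then show ?thesis using False graded_hom_0[OF f] by (simp add: w_def)
      qed
      finally show ?thesis by simp
    qed
  qed
qed


section \<open>The Koszul complex\<close>

text \<open>The Koszul differential with coefficients in a free module: \<open>v W\<close> is the
  coefficient of the exterior monomial on \<open>W\<close>. The signs are a parameter, which makes
  room for the twisted ones.\<close>

definition kz :: "('a \<Rightarrow> 'a set \<Rightarrow> 'k::field) \<Rightarrow> 'a set \<Rightarrow> ('a set \<Rightarrow> nat \<Rightarrow> ('a, 'k) mpoly) \<Rightarrow>
    'a set \<Rightarrow> nat \<Rightarrow> ('a, 'k) mpoly" where
  "kz e V v W j = (\<Sum>a\<in>V - W. Poly_Mapping.single (var a) (e a (insert a W)) * v (insert a W) j)"

lemma kz_graded:
  assumes "finite V" "W \<subseteq> V"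
    and "\<And>a. a \<in> V - W \<Longrightarrow> v (insert a W) \<in> graded_part V \<delta> (d - 1)"
  shows "kz e V v W \<in> graded_part V \<delta> d"
proof -
  have "(\<lambda>j. Poly_Mapping.single (var a) (e a (insert a W)) * v (insert a W) j) \<in> graded_part V \<delta> d"
    if "a \<in> V - W" for a
    using graded_part_var_mult[OF assms(3)[OF that], of a "e a (insert a W)"] that by simp
  then show ?thesis unfolding kz_def[abs_def] by (rule graded_part_sum)
qed

lemma kz_hom:
  assumes f: "graded_hom V \<delta> \<delta>' f" and V: "finite V"
    and v: "\<And>a. a \<in> V - W \<Longrightarrow> v (insert a W) \<in> free_module V \<delta>"
  shows "f (kz e V v W) = kz e V (\<lambda>W. f (v W)) W"
proof -
  have var: "Poly_Mapping.single (var a) c \<in> polys V" if "a \<in> V - W" for a c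
    using that by (intro polys_single) (simp add: keys_var)
  have "f (kz e V v W) = (\<lambda>j. \<Sum>a\<in>V - W. f (\<lambda>j. Poly_Mapping.single (var a) (e a (insert a W)) * v (insert a W) j) j)"
    unfolding kz_def[abs_def] using V v var
    by (intro graded_hom_sum[OF f] free_module_smult) auto
  also have "\<dots> = kz e V (\<lambda>W. f (v W)) W"
    unfolding kz_def[abs_def] by (intro ext sum.cong refl) (simp add: graded_homD(3)[OF f var v])
  finally show ?thesis .
qed

lemma kz_kz:
  assumes e: "anticommuting V e" and V: "finite V" "W \<subseteq> V"
  shows "kz e V (kz e V v) W = (\<lambda>_. 0)"
proof
  fix j
  have D: "V - insert a W = V - W - {a}" for a by auto
  have "kz e V (kz e V v) W j = (\<Sum>a\<in>V - W. \<Sum>b\<in>V - W - {a}.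
     Poly_Mapping.single (var a + var b) (e a (insert a W) * e b (insert b (insert a W))) *
     v (insert b (insert a W)) j)"
    by (simp add: kz_def D sum_distrib_left mult.assoc[symmetric] mult_single)
  also have "\<dots> = 0"
  proof (rule poly_mapping_eqI)
    fix m
    have "(\<Sum>a\<in>V - W. \<Sum>b\<in>V - W - {a}.
       cf (Poly_Mapping.single (var a + var b) (e a (insert a W) * e b (insert b (insert a W))) *
       v (insert b (insert a W)) j) m) = 0"
    proof (rule sum_offdiag_antisym)
      show "finite (V - W)" using V by simp
      fix a b assume ab: "a \<in> V - W" "b \<in> V - W" "a \<noteq> b"
      define P where "P = insert a (insert b W)"
      have P: "P \<subseteq> V" "a \<in> P" "b \<in> P" "P - {b} = insert a W" "P - {a} = insert b W"
        "insert b (insert a W) = P" "insert a (insert b W) = P"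
        using ab V by (auto simp: P_def)
      have "e a (insert a W) * e b P = - (e b (insert b W) * e a P)"
        using anticommuting_swap[OF e P(1,2,3) ab(3)] by (simp add: P mult.commute)
      then show "cf (Poly_Mapping.single (var a + var b) (e a (insert a W) * e b (insert b (insert a W))) *
           v (insert b (insert a W)) j) m =
         - cf (Poly_Mapping.single (var b + var a) (e b (insert b W) * e a (insert a (insert b W))) *
           v (insert a (insert b W)) j) m"
        unfolding P by (simp add: single_uminus add.commute)
    qed
    then show "cf (\<Sum>a\<in>V - W. \<Sum>b\<in>V - W - {a}.
       Poly_Mapping.single (var a + var b) (e a (insert a W) * e b (insert b (insert a W))) *
       v (insert b (insert a W)) j) m = cf 0 m"
      by (simp add: lookup_sum)
  qed
  finally show "kz e V (kz e V v) W j = 0" .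
qed

text \<open>Contracting homotopy: in multidegree \<open>m \<noteq> 0\<close>, pick a variable \<open>a\<close> dividing \<open>m\<close> and move it
  from the polynomial factor to the exterior factor.\<close>

definition pick :: "('a \<Rightarrow>\<^sub>0 nat) \<Rightarrow> 'a" where
  "pick m = (SOME a. a \<in> Poly_Mapping.keys m)"

definition kh :: "('a \<Rightarrow> 'a set \<Rightarrow> 'k::field) \<Rightarrow> ('a set \<Rightarrow> nat \<Rightarrow> ('a, 'k) mpoly) \<Rightarrow>
    'a set \<Rightarrow> nat \<Rightarrow> ('a, 'k) mpoly" where
  "kh e v W j = Abs_poly_mapping (\<lambda>\<mu>.
     if pick (\<mu> + ind W) \<in> W
     then e (pick (\<mu> + ind W)) W * cf (v (W - {pick (\<mu> + ind W)}) j) (\<mu> + var (pick (\<mu> + ind W)))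
     else 0)"

lemma pick_in: "m \<noteq> 0 \<Longrightarrow> pick m \<in> Poly_Mapping.keys m"
  unfolding pick_def by (rule someI_ex) (metis in_keys_iff lookup_zero poly_mapping_eqI)

lemma cf_kh:
  assumes "finite W"
  shows "cf (kh e v W j) \<mu> = (if pick (\<mu> + ind W) \<in> W
     then e (pick (\<mu> + ind W)) W * cf (v (W - {pick (\<mu> + ind W)}) j) (\<mu> + var (pick (\<mu> + ind W)))
     else 0)"
proof -
  let ?f = "\<lambda>\<mu>. if pick (\<mu> + ind W) \<in> W
     then e (pick (\<mu> + ind W)) W * cf (v (W - {pick (\<mu> + ind W)}) j) (\<mu> + var (pick (\<mu> + ind W)))
     else 0"
  \<comment> \<open>\<open>Abs_poly_mapping\<close> is meaningful only for finite support: a nonzero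
    value comes from one of the finitely many \<open>a\<close> in \<open>W\<close> and from a term
    of \<open>v (W - {a}) j\<close>.\<close>
  have "{\<mu>. ?f \<mu> \<noteq> 0} \<subseteq> (\<Union>a\<in>W. (\<lambda>\<nu>. \<nu> - var a) ` Poly_Mapping.keys (v (W - {a}) j))"
  proof
    fix \<mu> assume nz: "\<mu> \<in> {\<mu>. ?f \<mu> \<noteq> 0}"
    define a where "a = pick (\<mu> + ind W)"
    have "a \<in> W" "\<mu> + var a \<in> Poly_Mapping.keys (v (W - {a}) j)"
      using nz by (auto simp: a_def in_keys_iff split: if_splits)
    moreover have "\<mu> = (\<mu> + var a) - var a" by simp
    ultimately show "\<mu> \<in> (\<Union>a\<in>W. (\<lambda>\<nu>. \<nu> - var a) ` Poly_Mapping.keys (v (W - {a}) j))" by blast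
  qed
  then have "finite {\<mu>. ?f \<mu> \<noteq> 0}" by (rule finite_subset) (use assms in simp)
  then show ?thesis unfolding kh_def by (subst lookup_Abs_poly_mapping) auto
qed

lemma kh_graded:
  assumes V: "finite V" "W \<subseteq> V"
    and v: "\<And>a. a \<in> W \<Longrightarrow> v (W - {a}) \<in> graded_part V \<delta> d"
  shows "kh e v W \<in> graded_part V \<delta> (d - 1)"
proof -
  have finW: "finite W" using V finite_subset by blast
  have *: "\<exists>a\<in>W. cf (v (W - {a}) j) (\<mu> + var a) \<noteq> 0" if "cf (kh e v W j) \<mu> \<noteq> 0" for j \<mu>
    using that unfolding cf_kh[OF finW] by (auto split: if_splits)
  have "kh e v W j \<in> polys V" for j
  proof (rule polysI)
    fix \<mu> assume "cf (kh e v W j) \<mu> \<noteq> 0"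
    then obtain a where a: "a \<in> W" "cf (v (W - {a}) j) (\<mu> + var a) \<noteq> 0" using * by blast
    then have "v (W - {a}) j \<in> polys V" using v[OF a(1)] by (simp add: graded_part_iff free_module_iff)
    then show "Poly_Mapping.keys \<mu> \<subseteq> V" using polysD[OF _ a(2)] by (auto simp: keys_add_nat)
  qed
  moreover have "kh e v W j = 0" if "j \<ge> length \<delta>" for j
  proof (rule ccontr)
    assume "kh e v W j \<noteq> 0"
    then obtain \<mu> where "cf (kh e v W j) \<mu> \<noteq> 0" by (metis lookup_zero poly_mapping_eqI)
    then obtain a where a: "a \<in> W" "cf (v (W - {a}) j) (\<mu> + var a) \<noteq> 0" using * by blast
    then show False using v[OF a(1)] that by (auto simp: graded_part_iff free_module_iff)
  qed
  moreover have "int (mon_deg \<mu>) + \<delta> ! j = d - 1" if "cf (kh e v W j) \<mu> \<noteq> 0" for j \<mu>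
  proof -
    obtain a where a: "a \<in> W" "cf (v (W - {a}) j) (\<mu> + var a) \<noteq> 0" using * \<open>cf (kh e v W j) \<mu> \<noteq> 0\<close> by blast
    then have "int (mon_deg (\<mu> + var a)) + \<delta> ! j = d" using v[OF a(1)] unfolding graded_part_iff by blast
    then show ?thesis by (simp add: mon_deg_add mon_deg_var)
  qed
  ultimately show ?thesis by (simp add: graded_part_iff free_module_iff)
qed

lemma cf_kz:
  "cf (kz e V v W j) \<mu> =
    (\<Sum>b\<in>V - W. if ex \<mu> b > 0 then e b (insert b W) * cf (v (insert b W) j) (\<mu> - var b) else 0)"
  by (simp add: kz_def lookup_sum cf_var_mult)

lemma minus_var_add: "ex \<mu> b > 0 \<Longrightarrow> \<mu> - var b + var b = \<mu>"
  by (subst add.commute, rule monomial_split[symmetric]) (auto simp: ex_var)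

text \<open>\<open>pick\<close> depends only on the multidegree \<open>\<mu> + ind W\<close>, which
  \<open>kz\<close> and \<open>kh\<close> preserve, so the same variable \<open>a\<close> is used in
  all terms. The cycle condition replaces the second half of the homotopy formula.\<close>

lemma kz_kh:
  assumes e: "anticommuting V e" and V: "finite V" "W \<subseteq> V"
    and m: "pick (\<mu> + ind W) \<in> V" "\<mu> + ind W \<noteq> 0"
    and cyc: "\<And>a. a \<in> W \<Longrightarrow> kz e V v (W - {a}) j = 0"
  shows "cf (kz e V (kh e v) W j) \<mu> = cf (v W j) \<mu>"
proof -
  have finW: "finite W" using V finite_subset by blast
  define a where "a = pick (\<mu> + ind W)"
  have aV: "a \<in> V" using m by (simp add: a_def)
  have ak: "a \<in> Poly_Mapping.keys \<mu> \<union> W"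
    using pick_in[OF m(2)] finW by (simp add: a_def keys_add_nat keys_ind)
  have step: "cf (kh e v (insert b W) j) (\<mu> - var b) =
      (if a \<in> insert b W then e a (insert b W) * cf (v (insert b W - {a}) j) (\<mu> - var b + var a) else 0)"
    if b: "b \<in> V - W" "ex \<mu> b > 0" for b
  proof -
    have "\<mu> - var b + ind (insert b W) = \<mu> + ind W"
      using b finW minus_var_add[of \<mu> b] by (simp add: ind_insert add.assoc[symmetric])
    then show ?thesis using finW cf_kh[of "insert b W" e v j "\<mu> - var b"] by (simp add: a_def)
  qed
  show ?thesis
  proof (cases "a \<in> W")
    case False
    \<comment> \<open>With \<open>a\<close> outside \<open>W\<close>, only the summand
      \<open>b = a\<close> survives: the other sets \<open>insert b W\<close> do not contain
      \<open>a\<close>.\<close>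
    then have a: "a \<in> V - W" "ex \<mu> a > 0" using aV ak by (auto simp: in_keys_iff)
    have "cf (kz e V (kh e v) W j) \<mu> =
        (\<Sum>b\<in>{a}. if ex \<mu> b > 0 then e b (insert b W) * cf (kh e v (insert b W) j) (\<mu> - var b) else 0)"
      unfolding cf_kz using V a False
      by (intro sum.mono_neutral_right) (auto simp: step)
    also have "\<dots> = e a (insert a W) * (e a (insert a W) * cf (v (insert a W - {a}) j) (\<mu> - var a + var a))"
      using a by (simp add: step)
    also have "\<dots> = cf (v W j) \<mu>"
    proof -
      have "insert a W - {a} = W" using False by auto
      moreover have "insert a W \<subseteq> V" using a V by auto
      ultimately show ?thesis
        using anticommuting_sq[OF e, of "insert a W" a] minus_var_add[OF a(2)]
        by (simp add: mult.assoc[symmetric])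
    qed
    finally show ?thesis .
  next
    case True
    define W' where "W' = W - {a}"
    have W': "W' \<subseteq> V" "insert a W' = W" "a \<notin> W'" "V - W' = insert a (V - W)" "W \<subseteq> V"
      using True V aV by (auto simp: W'_def)
    \<comment> \<open>With \<open>a\<close> in \<open>W\<close>, the cycle condition on
      \<open>W - {a}\<close> in the same multidegree expresses the coefficient of \<open>v W\<close>
      through the sets \<open>insert b W'\<close>, which are the ones that \<open>kh\<close>
      reads.\<close>
    have "0 = cf (kz e V v W' j) (\<mu> + var a)" using cyc[OF True] by (simp add: W'_def)
    also have "\<dots> = e a W * cf (v W j) \<mu> +
        (\<Sum>b\<in>V - W. if ex (\<mu> + var a) b > 0
           then e b (insert b W') * cf (v (insert b W') j) (\<mu> + var a - var b) else 0)"
      unfolding cf_kz W'(4) using V True W'(2)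
      by (simp add: lookup_add ex_var)
    also have "(\<Sum>b\<in>V - W. if ex (\<mu> + var a) b > 0
           then e b (insert b W') * cf (v (insert b W') j) (\<mu> + var a - var b) else 0) =
        (\<Sum>b\<in>V - W. if ex \<mu> b > 0
           then e b (insert b W') * cf (v (insert b W') j) (\<mu> - var b + var a) else 0)"
    proof (intro sum.cong refl)
      fix b assume b: "b \<in> V - W"
      then have "b \<noteq> a" using True by blast
      then have "ex (\<mu> + var a) b = ex \<mu> b" by (simp add: lookup_add ex_var)
      moreover have "\<mu> + var a - var b = \<mu> - var b + var a" if "ex \<mu> b > 0"
        using that \<open>b \<noteq> a\<close> by (intro poly_mapping_eqI) (auto simp: lookup_add lookup_minus ex_var)
      ultimately show "(if ex (\<mu> + var a) b > 0
           then e b (insert b W') * cf (v (insert b W') j) (\<mu> + var a - var b) else 0) =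
        (if ex \<mu> b > 0
           then e b (insert b W') * cf (v (insert b W') j) (\<mu> - var b + var a) else 0)" by simp
    qed
    finally have 0: "e a W * cf (v W j) \<mu> = - (\<Sum>b\<in>V - W. if ex \<mu> b > 0
           then e b (insert b W') * cf (v (insert b W') j) (\<mu> - var b + var a) else 0)"
      by (simp add: eq_neg_iff_add_eq_0)
    have "cf (kz e V (kh e v) W j) \<mu> = (\<Sum>b\<in>V - W. - e a W * (if ex \<mu> b > 0
           then e b (insert b W') * cf (v (insert b W') j) (\<mu> - var b + var a) else 0))"
      unfolding cf_kz
    proof (intro sum.cong refl)
      fix b assume b: "b \<in> V - W"
      define P where "P = insert b W"
      have P: "P \<subseteq> V" "a \<in> P" "b \<in> P" "b \<noteq> a" "P - {b} = W" "P - {a} = insert b W'"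
        using b True V by (auto simp: P_def W'_def)
      have ex: "e b P * e a P = - (e a W * e b (insert b W'))"
        using anticommuting_exchange[OF e P(1,3,2,4)] P by simp
      show "(if ex \<mu> b > 0 then e b (insert b W) * cf (kh e v (insert b W) j) (\<mu> - var b) else 0) =
         - e a W * (if ex \<mu> b > 0
           then e b (insert b W') * cf (v (insert b W') j) (\<mu> - var b + var a) else 0)"
        using step[OF b] P ex by (simp add: P_def[symmetric] mult.assoc[symmetric])
    qed
    also have "\<dots> = e a W * (e a W * cf (v W j) \<mu>)"
      unfolding 0 by (simp add: sum_distrib_left sum_negf)
    also have "\<dots> = cf (v W j) \<mu>"
      using anticommuting_sq[OF e V(2) True] by (simp add: mult.assoc[symmetric])
    finally show ?thesis .
  qed
qed

text \<open>With all basis degrees equal to \<open>c\<close>, the part of total degree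
  \<open>d\<close> lives in multidegrees of degree \<open>d - c\<close>. These are nonzero, so there
  is a variable to pick and the homotopy applies.\<close>

lemma koszul_exact:
  assumes e: "anticommuting V e" and V: "finite V" and \<delta>: "\<And>d. d \<in> set \<delta> \<Longrightarrow> d = c"
    and d: "d \<noteq> c"
    and v: "\<And>W. W \<subseteq> V \<Longrightarrow> card W = i \<Longrightarrow> v W \<in> graded_part V \<delta> (d - int i)"
    and cyc: "\<And>W. W \<subseteq> V \<Longrightarrow> Suc (card W) = i \<Longrightarrow> kz e V v W = (\<lambda>_. 0)"
  shows "\<exists>u. (\<forall>W\<subseteq>V. card W = Suc i \<longrightarrow> u W \<in> graded_part V \<delta> (d - int (Suc i))) \<and>
    (\<forall>W\<subseteq>V. card W = i \<longrightarrow> kz e V u W = v W)"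
proof -
  have rem: "W - {a} \<subseteq> V \<and> Suc (card (W - {a})) = card W" if "W \<subseteq> V" "a \<in> W" for W a
  proof -
    have "finite W" using that(1) V finite_subset by blast
    then show ?thesis using that card_Suc_Diff1[OF _ that(2)] by auto
  qed
  have gr: "kh e v W \<in> graded_part V \<delta> (d - int (Suc i))" if "W \<subseteq> V" "card W = Suc i" for W
  proof -
    have "v (W - {a}) \<in> graded_part V \<delta> (d - int i)" if "a \<in> W" for a
      using rem[OF \<open>W \<subseteq> V\<close> that] v \<open>card W = Suc i\<close> by simp
    then have "kh e v W \<in> graded_part V \<delta> (d - int i - 1)" by (rule kh_graded[OF V that(1)])
    then show ?thesis by (simp add: algebra_simps)
  qed
  have "kz e V (kh e v) W = v W" if W: "W \<subseteq> V" "card W = i" for W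
  proof -
    have finW: "finite W" using W V finite_subset by blast
    have kg: "kz e V (kh e v) W \<in> graded_part V \<delta> (d - int i)"
    proof (rule kz_graded[OF V W(1)])
      fix a assume "a \<in> V - W"
      then have "insert a W \<subseteq> V" "card (insert a W) = Suc i" using W finW by auto
      then show "kh e v (insert a W) \<in> graded_part V \<delta> (d - int i - 1)"
        using gr[of "insert a W"] by (simp add: algebra_simps)
    qed
    show ?thesis
    proof (intro ext poly_mapping_eqI)
      fix j \<mu>
      show "cf (kz e V (kh e v) W j) \<mu> = cf (v W j) \<mu>"
      proof (cases "Poly_Mapping.keys \<mu> \<subseteq> V \<and> int (mon_deg \<mu>) + \<delta> ! j = d - int i \<and> j < length \<delta>")
        case False
        then have "cf (x j) \<mu> = 0" if "x \<in> graded_part V \<delta> (d - int i)" for x :: "nat \<Rightarrow> ('a, 'b) mpoly"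
          using that polysD[of "x j" V \<mu>] unfolding graded_part_iff free_module_iff
          by (metis linorder_not_less lookup_zero)
        then show ?thesis using kg v[OF W] by simp
      next
        case True
        then have "int (mon_deg \<mu>) + int i = d - c" using \<delta>[of "\<delta> ! j"] by simp
        then have "int (mon_deg (\<mu> + ind W)) = d - c" using finW W by (simp add: mon_deg_add mon_deg_ind)
        then have "mon_deg (\<mu> + ind W) \<noteq> 0" using d by auto
        then have nz: "\<mu> + ind W \<noteq> 0" by (auto simp: mon_deg_def)
        have "pick (\<mu> + ind W) \<in> V"
          using pick_in[OF nz] True finW W by (auto simp: keys_add_nat keys_ind)
        moreover have "kz e V v (W - {a}) j = 0" if "a \<in> W" for a
          using rem[OF W(1) that] cyc[of "W - {a}"] W(2) by simp
        ultimately show ?thesis using nz by (intro kz_kh[OF e V W(1)])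
      qed
    qed
  qed
  then show ?thesis using gr by blast
qed


text \<open>Koszul homology of the syzygy modules \<open>Z j\<close> (with \<open>Z 0 = I\<close>): since the Koszul complexes of
  the free modules are exact in total degree \<open>d > n + i + j\<close>, the \<open>i\<close>-th homology of \<open>Z j\<close> embeds
  into the \<open>(i - 1)\<close>-st homology of \<open>Z (Suc j)\<close>, and so on down to \<open>i = 0\<close>.\<close>

lemma koszul_syzygies:
  fixes \<psi> :: "nat \<Rightarrow> (nat \<Rightarrow> ('a, 'k::field) mpoly) \<Rightarrow> nat \<Rightarrow> ('a, 'k) mpoly"
  assumes e: "anticommuting V e" and V: "finite V"
    and hom: "\<And>j. graded_hom V (D j) (E j) (\<psi> j)" and ED: "\<And>j. E (Suc j) = D j"
    and lin: "\<And>j d. d \<in> set (D j) \<Longrightarrow> d = int n + int j"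
    and exact: "\<And>j. {v \<in> free_module V (D j). \<psi> j v = (\<lambda>_. 0)} = \<psi> (Suc j) ` free_module V (D (Suc j))"
    and z: "\<And>W. W \<subseteq> V \<Longrightarrow> card W = i \<Longrightarrow>
      z W \<in> \<psi> j ` free_module V (D j) \<inter> graded_part V (E j) (d - int i)"
    and cyc: "\<And>W. W \<subseteq> V \<Longrightarrow> Suc (card W) = i \<Longrightarrow> kz e V z W = (\<lambda>_. 0)"
    and d: "d > int n + int i + int j"
  shows "\<exists>u. (\<forall>W\<subseteq>V. card W = Suc i \<longrightarrow>
        u W \<in> \<psi> j ` free_module V (D j) \<inter> graded_part V (E j) (d - int (Suc i))) \<and>
      (\<forall>W\<subseteq>V. card W = i \<longrightarrow> kz e V u W = z W)"
  using z cyc d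
proof (induction i arbitrary: j z)
  case i: (0 j z)
  \<comment> \<open>Without an exterior part there is no cycle condition: a lift of \<open>z\<close>
    to the free module is already a Koszul boundary, and the chain that it bounds is mapped
    down.\<close>
  have "\<exists>w\<in>graded_part V (D j) (d - int 0). \<psi> j w = z W" if W: "W \<subseteq> V" "card W = 0" for W
    using i.prems(1)[OF W] homogeneous_preimage[OF hom lin] by (elim IntE imageE) metis
  then obtain w where w: "\<And>W. W \<subseteq> V \<Longrightarrow> card W = 0 \<Longrightarrow> w W \<in> graded_part V (D j) (d - int 0)"
    "\<And>W. W \<subseteq> V \<Longrightarrow> card W = 0 \<Longrightarrow> \<psi> j (w W) = z W"
    by metis
  have dn: "d \<noteq> int n + int j" using i.prems(3) by simp
  have "\<exists>y. (\<forall>W\<subseteq>V. card W = Suc 0 \<longrightarrow> y W \<in> graded_part V (D j) (d - int (Suc 0))) \<and>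
      (\<forall>W\<subseteq>V. card W = 0 \<longrightarrow> kz e V y W = w W)"
    by (rule koszul_exact[OF e V lin dn]) (use w(1) in auto)
  then obtain y where
    y: "\<forall>W\<subseteq>V. card W = Suc 0 \<longrightarrow> y W \<in> graded_part V (D j) (d - int (Suc 0))"
      "\<forall>W\<subseteq>V. card W = 0 \<longrightarrow> kz e V y W = w W" by blast
  show ?case
  proof (intro exI[of _ "\<lambda>W. \<psi> j (y W)"] conjI allI impI)
    fix W assume W: "W \<subseteq> V" "card W = Suc 0"
    then have "y W \<in> graded_part V (D j) (d - int (Suc 0))" using y(1) by blast
    then show "\<psi> j (y W) \<in> \<psi> j ` free_module V (D j) \<inter> graded_part V (E j) (d - int (Suc 0))"
      using graded_homD(4)[OF hom] graded_part_free by blast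
  next
    fix W assume W: "W \<subseteq> V" "card W = 0"
    then have "finite W" using V finite_subset by blast
    then have "insert a W \<subseteq> V \<and> card (insert a W) = Suc 0" if "a \<in> V - W" for a
      using that W by auto
    then have "y (insert a W) \<in> free_module V (D j)" if "a \<in> V - W" for a
      using graded_part_free[OF y(1)[rule_format]] that by blast
    then have "\<psi> j (kz e V y W) = kz e V (\<lambda>W. \<psi> j (y W)) W" by (rule kz_hom[OF hom V])
    then show "kz e V (\<lambda>W. \<psi> j (y W)) W = z W" using y(2) w(2) W by simp
  qed
next
  case i: (Suc i j z)
  have "\<exists>w\<in>graded_part V (D j) (d - int (Suc i)). \<psi> j w = z W" if W: "W \<subseteq> V" "card W = Suc i" for W
    using i.prems(1)[OF W] homogeneous_preimage[OF hom lin] by (elim IntE imageE) metis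
  then obtain w where w: "\<And>W. W \<subseteq> V \<Longrightarrow> card W = Suc i \<Longrightarrow> w W \<in> graded_part V (D j) (d - int (Suc i))"
    "\<And>W. W \<subseteq> V \<Longrightarrow> card W = Suc i \<Longrightarrow> \<psi> j (w W) = z W"
    by metis
  have ins: "insert a W \<subseteq> V \<and> card (insert a W) = Suc k" if "W \<subseteq> V" "card W = k" "a \<in> V - W" for W a k
  proof -
    have "finite W" using that(1) V finite_subset by blast
    then show ?thesis using that by auto
  qed
  have kg: "kz e V w W \<in> graded_part V (D j) (d - int i)" if W: "W \<subseteq> V" "card W = i" for W
  proof (rule kz_graded[OF V W(1)])
    fix a assume "a \<in> V - W"
    then have "w (insert a W) \<in> graded_part V (D j) (d - int (Suc i))" using w(1) ins[OF W] by blast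
    then show "w (insert a W) \<in> graded_part V (D j) (d - int i - 1)" by (simp add: algebra_simps)
  qed
  have kker: "\<psi> j (kz e V w W) = (\<lambda>_. 0)" if W: "W \<subseteq> V" "card W = i" for W
  proof -
    have "w (insert a W) \<in> free_module V (D j)" if "a \<in> V - W" for a
      using graded_part_free[OF w(1)] ins[OF W that] by blast
    then have "\<psi> j (kz e V w W) = kz e V (\<lambda>W. \<psi> j (w W)) W" by (rule kz_hom[OF hom V])
    also have "\<dots> = kz e V z W"
      using w(2) ins[OF W] unfolding kz_def[abs_def] by (intro ext sum.cong refl) simp
    also have "\<dots> = (\<lambda>_. 0)" using i.prems(2) W by simp
    finally show ?thesis .
  qed
  \<comment> \<open>The Koszul boundary of the lift \<open>w\<close> is a cycle with values in the
    next syzygy module. There \<open>i\<close> has dropped and \<open>j\<close> has risen by one, so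
    the bound on \<open>d\<close> is unchanged and the induction hypothesis applies.\<close>
  have "\<exists>u. (\<forall>W\<subseteq>V. card W = Suc i \<longrightarrow>
        u W \<in> \<psi> (Suc j) ` free_module V (D (Suc j)) \<inter> graded_part V (E (Suc j)) (d - int (Suc i))) \<and>
      (\<forall>W\<subseteq>V. card W = i \<longrightarrow> kz e V u W = kz e V w W)"
  proof (rule i.IH)
    fix W assume W: "W \<subseteq> V" "card W = i"
    show "kz e V w W \<in> \<psi> (Suc j) ` free_module V (D (Suc j)) \<inter> graded_part V (E (Suc j)) (d - int i)"
      unfolding exact[symmetric] ED using kker[OF W] kg[OF W] graded_part_free by blast
  next
    fix W assume "W \<subseteq> V"
    then show "kz e V (kz e V w) W = (\<lambda>_. 0)" by (rule kz_kz[OF e V])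
  next
    show "d > int n + int i + int (Suc j)" using i.prems(3) by simp
  qed
  then obtain u' where u': "\<And>W. W \<subseteq> V \<Longrightarrow> card W = Suc i \<Longrightarrow>
        u' W \<in> \<psi> (Suc j) ` free_module V (D (Suc j)) \<inter> graded_part V (E (Suc j)) (d - int (Suc i))"
      "\<And>W. W \<subseteq> V \<Longrightarrow> card W = i \<Longrightarrow> kz e V u' W = kz e V w W" by blast
  have u'g: "u' W \<in> graded_part V (D j) (d - int (Suc i))" "u' W \<in> free_module V (D j)"
      "\<psi> j (u' W) = (\<lambda>_. 0)" if W: "W \<subseteq> V" "card W = Suc i" for W
    using u'(1)[OF W] unfolding exact[symmetric] ED by blast+
  \<comment> \<open>Subtracting \<open>u'\<close> makes the lift a Koszul cycle in the free module.
    Its image is still \<open>z\<close>, since \<open>\<psi> j\<close> kills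
    \<open>u'\<close>.\<close>
  define x where "x W = (\<lambda>l. w W l - u' W l)" for W
  have xg: "x W \<in> graded_part V (D j) (d - int (Suc i))" if W: "W \<subseteq> V" "card W = Suc i" for W
    unfolding x_def by (rule graded_part_diff[OF w(1)[OF W] u'g(1)[OF W]])
  have \<psi>x: "\<psi> j (x W) = z W" if W: "W \<subseteq> V" "card W = Suc i" for W
    unfolding x_def graded_hom_diff[OF hom graded_part_free[OF w(1)[OF W]] u'g(2)[OF W]]
    by (simp add: w(2)[OF W] u'g(3)[OF W])
  have kx: "kz e V x W = (\<lambda>_. 0)" if "W \<subseteq> V" "Suc (card W) = Suc i" for W
  proof
    fix l
    have "kz e V x W l = kz e V w W l - kz e V u' W l"
      by (simp add: kz_def x_def right_diff_distrib sum_subtractf)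
    then show "kz e V x W l = 0" using u'(2)[of W] that by simp
  qed
  have dn: "d \<noteq> int n + int j" using i.prems(3) by simp
  have "\<exists>y. (\<forall>W\<subseteq>V. card W = Suc (Suc i) \<longrightarrow> y W \<in> graded_part V (D j) (d - int (Suc (Suc i)))) \<and>
      (\<forall>W\<subseteq>V. card W = Suc i \<longrightarrow> kz e V y W = x W)"
    by (rule koszul_exact[OF e V lin dn]) (use xg kx in auto)
  then obtain y where
    y: "\<forall>W\<subseteq>V. card W = Suc (Suc i) \<longrightarrow> y W \<in> graded_part V (D j) (d - int (Suc (Suc i)))"
      "\<forall>W\<subseteq>V. card W = Suc i \<longrightarrow> kz e V y W = x W" by blast
  show ?case
  proof (intro exI[of _ "\<lambda>W. \<psi> j (y W)"] conjI allI impI)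
    fix W assume W: "W \<subseteq> V" "card W = Suc (Suc i)"
    then have "y W \<in> graded_part V (D j) (d - int (Suc (Suc i)))" using y(1) by blast
    then show "\<psi> j (y W) \<in> \<psi> j ` free_module V (D j) \<inter> graded_part V (E j) (d - int (Suc (Suc i)))"
      using graded_homD(4)[OF hom] graded_part_free by blast
  next
    fix W assume W: "W \<subseteq> V" "card W = Suc i"
    have "y (insert a W) \<in> free_module V (D j)" if "a \<in> V - W" for a
      using graded_part_free[OF y(1)[rule_format]] ins[OF W that] by blast
    then have "\<psi> j (kz e V y W) = kz e V (\<lambda>W. \<psi> j (y W)) W" by (rule kz_hom[OF hom V])
    then show "kz e V (\<lambda>W. \<psi> j (y W)) W = z W" using y(2) \<psi>x W by simp
  qed
qed


section \<open>Koszul cycles in squarefree multidegree\<close>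

context colour_classes
begin

text \<open>A cocycle \<open>x\<close> on subsets of \<open>R\<close> becomes a Koszul cycle of
  multidegree \<open>R\<close>, whose coefficient at \<open>W\<close> is \<open>x (R - W)\<close>
  times the monomial of \<open>R - W\<close>. Its homological degree is
  \<open>i = card R - (n + Suc d)\<close>, so that the total degree \<open>card R\<close> exceeds
  \<open>n + i\<close>, the degree of the basis of step \<open>i\<close>, and the cycle
  bounds.\<close>

lemma linear_resolution_imp_coacyc:
  assumes T: "T \<subseteq> (\<Pi>\<^sub>E i\<in>{1..n}. A i)"
    and "has_linear_resolution n V (rainbow_ideal n A T :: ('a, 'k::field) mpoly set)"
  shows "coacyc TYPE('k) T"
  unfolding coacyc_def
proof (intro allI impI)
  obtain D \<epsilon> \<phi> where res: "minimal_graded_free_resolution V (rainbow_ideal n A T :: ('a, 'k) mpoly set) D \<epsilon> \<phi>"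
    and lin: "\<And>i d. d \<in> set (D i) \<Longrightarrow> d = int n + int i"
    using assms(2) unfolding has_linear_resolution_def by blast
  \<comment> \<open>The augmentation is made the differential number 0, so that the ideal itself is
    the first of the syzygy modules.\<close>
  define \<psi> where "\<psi> j = (case j of 0 \<Rightarrow> \<epsilon> | Suc i \<Rightarrow> \<phi> i)" for j
  define E where "E j = (case j of 0 \<Rightarrow> [0] | Suc i \<Rightarrow> D i)" for j
  have hom: "graded_hom V (D j) (E j) (\<psi> j)" for j
    using res unfolding minimal_graded_free_resolution_def by (cases j) (auto simp: \<psi>_def E_def)
  have exact: "{v \<in> free_module V (D j). \<psi> j v = (\<lambda>_. 0)} = \<psi> (Suc j) ` free_module V (D (Suc j))" for j
    using res unfolding minimal_graded_free_resolution_def by (cases j) (auto simp: \<psi>_def E_def)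
  have im: "(\<lambda>v. \<psi> 0 v 0) ` free_module V (D 0) = rainbow_ideal n A T"
    using res unfolding minimal_graded_free_resolution_def by (auto simp: \<psi>_def)
  note I = rainbow_ideal_eq[OF T, where 'k = 'k]
  fix R d and x :: "'a set \<Rightarrow> 'k"
  assume R: "R \<subseteq> V" and x: "supp_in (hit T) R (Suc d) x" and cyc: "\<forall>S\<subseteq>R. cobd eps x S = 0"
  show "\<exists>y. supp_in (hit T) R d y \<and> (\<forall>S\<subseteq>R. cobd eps y S = x S)"
  proof (cases "n + Suc d \<le> card R")
    case False
    have "x S = 0" for S
      using supp_inD(2,3)[OF x, of S] False card_mono[of R S] finite_subset[OF R finV] by fastforce
    then show ?thesis by (intro exI[of _ "\<lambda>_. 0"]) (simp add: supp_in_def cobd_def)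
  next
    case True
    define i where "i = card R - (n + Suc d)"
    have cR: "card R = n + Suc d + i" using True by (simp add: i_def)
    have finR: "finite R" using finite_subset[OF R finV] .
    \<comment> \<open>The signs are read at the complement in \<open>R\<close>, so that
      \<open>kz\<close> on \<open>W\<close> turns into \<open>cobd eps\<close> on
      \<open>R - W\<close>. The symmetric difference extends them to sets \<open>W\<close> not
      contained in \<open>R\<close>.\<close>
    define e :: "'a \<Rightarrow> 'a set \<Rightarrow> 'k" where "e a W = eps a (insert a ((R - W) \<union> (W - R)))" for a W
    have e: "anticommuting V e"
      unfolding e_def[abs_def] by (rule anticommuting_twist[OF anticommuting_eps R])
    have e_eq: "e a (insert a W) = eps a (R - W)" if "a \<in> R - W" "W \<subseteq> R" for a W
    proof -
      have "insert a ((R - insert a W) \<union> (insert a W - R)) = R - W" using that by blast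
      then show ?thesis by (simp add: e_def)
    qed
    define z :: "'a set \<Rightarrow> nat \<Rightarrow> ('a, 'k) mpoly" where
      "z W j = (if W \<subseteq> R \<and> j = 0 then Poly_Mapping.single (ind (R - W)) (x (R - W)) else 0)" for W j
    have "\<exists>u. (\<forall>W\<subseteq>V. card W = Suc i \<longrightarrow>
          u W \<in> \<psi> 0 ` free_module V (D 0) \<inter> graded_part V (E 0) (int (card R) - int (Suc i))) \<and>
        (\<forall>W\<subseteq>V. card W = i \<longrightarrow> kz e V u W = z W)"
    proof (rule koszul_syzygies[where D = D and E = E and \<psi> = \<psi> and j = 0 and z = z,
          OF e finV hom _ lin exact])
      show "E (Suc j) = D j" for j by (simp add: E_def)
      show "int (card R) > int n + int i + int 0" using cR by simp
    next
      fix W assume W: "W \<subseteq> V" "card W = i"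
      have zI: "z W 0 \<in> rainbow_ideal n A T"
      proof (cases "W \<subseteq> R \<and> x (R - W) \<noteq> 0")
        case True
        have "Poly_Mapping.single (ind (R - W)) (x (R - W)) \<in> polys V"
          using finR R by (intro polys_single) (auto simp: keys_ind)
        then show ?thesis using True supp_inD(1)[OF x, of "R - W"] finR
          by (simp add: z_def I keys_ind)
      next
        case False
        then have "z W 0 = 0" by (auto simp: z_def)
        then show ?thesis by (simp add: I polys_0)
      qed
      then obtain v where v: "v \<in> free_module V (D 0)" "z W 0 = \<psi> 0 v 0" unfolding im[symmetric] by blast
      have "\<psi> 0 v \<in> free_module V [0]" using graded_homD(1)[OF hom v(1)] by (simp add: E_def)
      then have "\<psi> 0 v j = z W j" for j
        using v(2) by (cases j) (auto simp: free_module_iff z_def)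
      then have "z W = \<psi> 0 v" by auto
      then have "z W \<in> \<psi> 0 ` free_module V (D 0)" using v(1) by blast
      moreover have "z W \<in> graded_part V [0] (int (card R) - int i)"
        unfolding graded_part_iff
      proof (intro conjI allI impI)
        show "z W \<in> free_module V [0]"
        proof -
          have "Poly_Mapping.single (ind (R - W)) (x (R - W)) \<in> polys V"
            using finR R by (intro polys_single) (auto simp: keys_ind)
          then show ?thesis by (auto simp: free_module_iff z_def polys_0)
        qed
        fix j m assume "cf (z W j) m \<noteq> 0"
        then have "W \<subseteq> R" "j = 0" "m = ind (R - W)"
          by (auto simp: z_def lookup_single when_def split: if_splits)
        moreover have "card (R - W) = card R - i" "i \<le> card R" if "W \<subseteq> R"
          using that W(2) finR finite_subset[OF that finR] card_Diff_subset[of W R] card_mono[of R W] by auto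
        ultimately show "int (mon_deg m) + [0] ! j = int (card R) - int i"
          using finR by (simp add: mon_deg_ind)
      qed
      ultimately show "z W \<in> \<psi> 0 ` free_module V (D 0) \<inter> graded_part V (E 0) (int (card R) - int i)"
        by (simp add: E_def)
    next
      fix W assume W: "W \<subseteq> V" "Suc (card W) = i"
      show "kz e V z W = (\<lambda>_. 0)"
      proof
        fix j
        show "kz e V z W j = 0"
        proof (cases "W \<subseteq> R \<and> j = 0")
          case False
          then have "z (insert a W) j = 0" for a unfolding z_def by auto
          then show ?thesis by (simp add: kz_def)
        next
          case True
          have "kz e V z W j = (\<Sum>a\<in>R - W. Poly_Mapping.single (ind (R - W)) (eps a (R - W) * x (R - W - {a})))"
            unfolding kz_def
          proof (rule sum.mono_neutral_cong_right)
            show "finite (V - W)" "R - W \<subseteq> V - W" using finV R by auto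
            show "\<forall>a\<in>V - W - (R - W). Poly_Mapping.single (var a) (e a (insert a W)) * z (insert a W) j = 0"
              by (auto simp: z_def)
            fix a assume a: "a \<in> R - W"
            have "R - insert a W = R - W - {a}" by blast
            moreover have "ind (R - W) = var a + ind (R - W - {a})"
              using a finR by (intro ind_remove) auto
            ultimately show "Poly_Mapping.single (var a) (e a (insert a W)) * z (insert a W) j =
               Poly_Mapping.single (ind (R - W)) (eps a (R - W) * x (R - W - {a}))"
              using a True e_eq[OF a] by (simp add: z_def mult_single)
          qed
          also have "\<dots> = Poly_Mapping.single (ind (R - W)) (cobd eps x (R - W))"
            unfolding cobd_def
            by (intro poly_mapping_eqI) (simp add: lookup_sum lookup_single when_def)
          also have "\<dots> = 0" using cyc by simp
          finally show ?thesis .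
        qed
      qed
    qed
    then obtain u where u: "\<And>W. W \<subseteq> V \<Longrightarrow> card W = Suc i \<Longrightarrow> u W \<in> \<psi> 0 ` free_module V (D 0)"
      "\<And>W. W \<subseteq> V \<Longrightarrow> card W = i \<Longrightarrow> kz e V u W = z W" by blast
    \<comment> \<open>The resolution need not respect multidegrees, so only the term of
      \<open>u (R - S)\<close> of multidegree \<open>R\<close> is kept. This term still lies in the
      monomial ideal, whence \<open>hit T S\<close>.\<close>
    define y where "y S = (if S \<subseteq> R \<and> card S = n + d then cf (u (R - S) 0) (ind S) else 0)" for S
    have cdiff: "card (R - S) = card R - card S \<and> card S \<le> card R" if "S \<subseteq> R" for S
      using that finR finite_subset[OF that finR] card_Diff_subset[of S R] card_mono[of R S] by auto
    have "supp_in (hit T) R d y"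
    proof (rule supp_inI)
      fix S assume nz: "y S \<noteq> 0"
      then show S: "S \<subseteq> R" "card S = n + d" by (auto simp: y_def split: if_splits)
      have "card (R - S) = Suc i" using cdiff[OF S(1)] S(2) cR by simp
      moreover have "R - S \<subseteq> V" using R by blast
      ultimately have "u (R - S) \<in> \<psi> 0 ` free_module V (D 0)" by (intro u(1))
      then have "u (R - S) 0 \<in> rainbow_ideal n A T"
        unfolding im[symmetric] by (elim imageE) (intro image_eqI, simp_all)
      moreover have "ind S \<in> Poly_Mapping.keys (u (R - S) 0)"
        using nz by (auto simp: y_def in_keys_iff split: if_splits)
      ultimately show "hit T S"
        using finite_subset[OF S(1) finR] unfolding I by (auto simp: keys_ind)
    qed
    moreover have "cobd eps y S = x S" if S: "S \<subseteq> R" for S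
    proof (cases "card S = n + Suc d")
      case False
      have finS: "finite S" using finite_subset[OF S finR] .
      have "y (S - {a}) = 0" if "a \<in> S" for a
        using card_Suc_Diff1[OF finS that] False by (auto simp: y_def)
      then have "cobd eps y S = 0" by (simp add: cobd_def)
      moreover have "x S = 0" using supp_inD(3)[OF x, of S] False by blast
      ultimately show ?thesis by simp
    next
      case True
      have finS: "finite S" using finite_subset[OF S finR] .
      define W where "W = R - S"
      have W: "W \<subseteq> V" "W \<subseteq> R" "card W = i" "R - W = S"
        using R S cdiff[OF S] True cR by (auto simp: W_def)
      have "x S = cf (z W 0) (ind S)" using W by (simp add: z_def)
      also have "\<dots> = cf (kz e V u W 0) (ind S)" using u(2)[OF W(1,3)] by simp
      also have "\<dots> = (\<Sum>a\<in>S. eps a S * y (S - {a}))"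
        unfolding cf_kz
      proof (rule sum.mono_neutral_cong_right)
        show "finite (V - W)" "S \<subseteq> V - W" using finV R S by (auto simp: W_def)
        show "\<forall>b\<in>V - W - S. (if 0 < ex (ind S) b then e b (insert b W) * cf (u (insert b W) 0) (ind S - var b) else 0) = 0"
          using finS by (simp add: ex_ind)
        fix a assume a: "a \<in> S"
        have "R - (S - {a}) = insert a W" using a S by (auto simp: W_def)
        moreover have "ind S - var a = ind (S - {a})" using ind_remove[OF finS a] by simp
        moreover have "card (S - {a}) = n + d" using card_Suc_Diff1[OF finS a] True by simp
        moreover have "e a (insert a W) = eps a S" using e_eq[of a W] a S W(2,4) by auto
        ultimately show "(if 0 < ex (ind S) a then e a (insert a W) * cf (u (insert a W) 0) (ind S - var a) else 0) =
            eps a S * y (S - {a})"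
          using a S finS by (auto simp: ex_ind y_def)
      qed
      finally show ?thesis by (simp add: cobd_def)
    qed
    ultimately show ?thesis by blast
  qed
qed

end


section \<open>The cellular resolution\<close>

locale rainbow = colour_classes +
  fixes T :: "(nat \<Rightarrow> 'a) set"
  assumes T: "T \<subseteq> (\<Pi>\<^sub>E i\<in>{1..n}. A i)"
begin

definition cells :: "nat \<Rightarrow> 'a set set" where
  "cells d = {S. cell T S \<and> card S = n + d}"

definition cl :: "nat \<Rightarrow> 'a set list" where
  "cl d = (SOME xs. set xs = cells d \<and> distinct xs)"

definition basis_degs :: "nat \<Rightarrow> int list" where
  "basis_degs d = replicate (length (cl d)) (int n + int d)"

text \<open>Coordinates indexed by cells instead of positions in the arbitrary enumeration
  \<open>cl d\<close>.\<close>

definition coord :: "nat \<Rightarrow> (nat \<Rightarrow> ('a, 'k::field) mpoly) \<Rightarrow> 'a set \<Rightarrow> ('a, 'k) mpoly" where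
  "coord d v S = (if S \<in> cells d then v (THE j. j < length (cl d) \<and> cl d ! j = S) else 0)"

definition cellular_bd :: "nat \<Rightarrow> (nat \<Rightarrow> ('a, 'k::field) mpoly) \<Rightarrow> nat \<Rightarrow> ('a, 'k) mpoly" where
  "cellular_bd d v j = (if j < length (cl d)
     then \<Sum>a\<in>V - cl d ! j. Poly_Mapping.single (var a) (eps a (insert a (cl d ! j))) *
            coord (Suc d) v (insert a (cl d ! j))
     else 0)"

definition cellular_aug :: "(nat \<Rightarrow> ('a, 'k::field) mpoly) \<Rightarrow> nat \<Rightarrow> ('a, 'k) mpoly" where
  "cellular_aug v j = (if j = 0 then \<Sum>S\<in>cells 0. Poly_Mapping.single (ind S) 1 * coord 0 v S else 0)"

text \<open>The part of \<open>v\<close> of multidegree \<open>m\<close>, a chain of the subcomplex on the support of \<open>m\<close>.\<close>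

definition strand :: "nat \<Rightarrow> (nat \<Rightarrow> ('a, 'k::field) mpoly) \<Rightarrow> ('a \<Rightarrow>\<^sub>0 nat) \<Rightarrow> 'a set \<Rightarrow> 'k" where
  "strand d v m S = (if S \<subseteq> Poly_Mapping.keys m then cf (coord d v S) (m - ind S) else 0)"

lemma cellsD: "S \<in> cells d \<Longrightarrow> full S" "S \<in> cells d \<Longrightarrow> S \<subseteq> V" "S \<in> cells d \<Longrightarrow> finite S"
  using finV finite_subset by (auto simp: cells_def cell_def full_def)

lemma cells_face: "full S \<Longrightarrow> a \<in> V - S \<Longrightarrow> insert a S \<in> cells (Suc d) \<Longrightarrow> S \<in> cells d"
  using cell_mono[of T "insert a S" S] cellsD(3)[of "insert a S" "Suc d"] by (auto simp: cells_def)

lemma finite_cells_deg: "finite (cells d)"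
proof -
  have "cells d \<subseteq> Pow V" using cellsD(2) by blast
  then show ?thesis using finV by (meson finite_Pow_iff finite_subset)
qed

lemma cl: "set (cl d) = cells d" "distinct (cl d)"
proof -
  have "\<exists>xs. set xs = cells d \<and> distinct xs" using finite_distinct_list[OF finite_cells_deg] .
  then have "set (cl d) = cells d \<and> distinct (cl d)" unfolding cl_def by (rule someI_ex)
  then show "set (cl d) = cells d" "distinct (cl d)" by blast+
qed

lemma cl_nth: "j < length (cl d) \<Longrightarrow> cl d ! j \<in> cells d"
  using nth_mem[of j "cl d"] cl(1) by simp

lemma coord_nth: "j < length (cl d) \<Longrightarrow> coord d v (cl d ! j) = v j"
proof -
  assume j: "j < length (cl d)"
  have "(THE i. i < length (cl d) \<and> cl d ! i = cl d ! j) = j"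
    using j cl(2) nth_eq_iff_index_eq by (intro the_equality) blast+
  then show ?thesis using cl_nth[OF j] by (simp add: coord_def)
qed

lemma cells_nth:
  assumes "S \<in> cells d"
  obtains j where "j < length (cl d)" "cl d ! j = S"
  using assms cl(1) by (metis in_set_conv_nth)

lemma coord_outside: "S \<notin> cells d \<Longrightarrow> coord d v S = 0"
  by (simp add: coord_def)

lemma coord_add: "coord d (\<lambda>j. v j + w j) S = coord d v S + coord d w S"
  by (simp add: coord_def)

lemma coord_smult: "coord d (\<lambda>j. p * v j) S = p * coord d v S"
  by (simp add: coord_def)

lemma coord_polys: "v \<in> free_module V \<delta> \<Longrightarrow> coord d v S \<in> polys V"
  by (simp add: coord_def free_module_iff polys_0)

lemma coord_degree:
  assumes v: "v \<in> graded_part V (basis_degs d) e" and nz: "cf (coord d v S) m \<noteq> 0"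
  shows "int (mon_deg m) + (int n + int d) = e"
proof -
  have "S \<in> cells d"
  proof (rule ccontr)
    assume "S \<notin> cells d"
    then show False using nz coord_outside[of S d v] by simp
  qed
  then obtain j where j: "j < length (cl d)" "cl d ! j = S" by (rule cells_nth)
  then have "cf (v j) m \<noteq> 0" using nz coord_nth[OF j(1), of v] by simp
  then have "int (mon_deg m) + basis_degs d ! j = e" using v unfolding graded_part_iff by blast
  then show ?thesis using j(1) by (simp add: basis_degs_def)
qed

lemma coord_cellular_bd:
  assumes "S \<in> cells d"
  shows "coord d (cellular_bd d v) S =
    (\<Sum>a\<in>V - S. Poly_Mapping.single (var a) (eps a (insert a S)) * coord (Suc d) v (insert a S))"
proof -
  obtain j where j: "j < length (cl d)" "cl d ! j = S" using assms by (rule cells_nth)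
  then show ?thesis using coord_nth[OF j(1), of "cellular_bd d v"] by (simp add: cellular_bd_def)
qed

lemma strand_outside: "S \<notin> cells d \<Longrightarrow> strand d v m S = 0"
  by (simp add: strand_def coord_outside)

lemma strand_0: "strand d (\<lambda>_. 0) m S = 0"
  by (simp add: strand_def coord_def)

lemma strand_add_ind: "finite S \<Longrightarrow> strand d v (\<mu> + ind S) S = cf (coord d v S) \<mu>"
  by (simp add: strand_def keys_add_nat keys_ind)

text \<open>The coefficient of \<open>\<mu>\<close> at the cell \<open>S\<close> reappears in
  multidegree \<open>\<mu> + ind S\<close>, so no information is lost in the strands.\<close>

lemma strand_ext:
  assumes v: "v \<in> free_module V (basis_degs d)" and w: "w \<in> free_module V (basis_degs d)"
    and eq: "\<And>m S. full S \<Longrightarrow> strand d v m S = strand d w m S"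
  shows "v = w"
proof (intro ext poly_mapping_eqI)
  fix j \<mu>
  show "cf (v j) \<mu> = cf (w j) \<mu>"
  proof (cases "j < length (cl d)")
    case True
    note S = cl_nth[OF True]
    show ?thesis
      using eq[OF cellsD(1)[OF S], of "\<mu> + ind (cl d ! j)"] strand_add_ind[OF cellsD(3)[OF S]] coord_nth[OF True]
      by metis
  next
    case False
    then show ?thesis using v w by (simp add: free_module_iff basis_degs_def)
  qed
qed

lemma supp_strand:
  assumes "v \<in> free_module V \<delta>"
  shows "supp_in (cell T) (Poly_Mapping.keys m \<inter> V) d (strand d v m)"
proof (rule supp_inI)
  fix S assume "strand d v m S \<noteq> 0"
  moreover from this have "S \<in> cells d" using strand_outside by blast
  ultimately have "S \<in> cells d" "S \<subseteq> Poly_Mapping.keys m" by (auto simp: strand_def split: if_splits)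
  then show "cell T S" "S \<subseteq> Poly_Mapping.keys m \<inter> V" "card S = n + d"
    using cellsD(2) by (auto simp: cells_def)
qed

text \<open>The matrix entry between \<open>insert a S\<close> and \<open>S\<close> is, up to sign,
  the variable \<open>a\<close>, the quotient of their monomials; in a fixed multidegree it acts as
  the scalar \<open>eps a (insert a S)\<close>. For \<open>S\<close> that is not full the right side
  may be nonzero.\<close>

lemma strand_bd:
  assumes S: "full S"
  shows "strand d (cellular_bd d v) m S = bd eps V (strand (Suc d) v m) S"
proof (cases "S \<in> cells d \<and> S \<subseteq> Poly_Mapping.keys m")
  case False
  have "strand (Suc d) v m (insert a S) = 0" if "a \<in> V - S" for a
  proof (cases "S \<in> cells d")
    case True
    then show ?thesis using False by (simp add: strand_def)
  next
    case False
    then have "insert a S \<notin> cells (Suc d)" using cells_face[OF S that] by blast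
    then show ?thesis by (rule strand_outside)
  qed
  then have "bd eps V (strand (Suc d) v m) S = 0" by (simp add: bd_def)
  moreover have "strand d (cellular_bd d v) m S = 0"
  proof (cases "S \<in> cells d")
    case True
    then show ?thesis using False by (simp add: strand_def)
  qed (rule strand_outside)
  ultimately show ?thesis by simp
next
  case True
  have finS: "finite S" using True cellsD(3) by blast
  have "strand d (cellular_bd d v) m S = (\<Sum>a\<in>V - S. cf (Poly_Mapping.single (var a) (eps a (insert a S)) *
      coord (Suc d) v (insert a S)) (m - ind S))"
    using True by (simp add: strand_def coord_cellular_bd lookup_sum)
  also have "\<dots> = (\<Sum>a\<in>V - S. eps a (insert a S) * strand (Suc d) v m (insert a S))"
  proof (intro sum.cong refl)
    fix a assume a: "a \<in> V - S"
    have "ex (m - ind S) a = ex m a" using a finS by (simp add: lookup_minus ex_ind)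
    moreover have "m - ind S - var a = m - ind (insert a S)"
      using a finS by (simp add: ind_insert diff_diff_add add.commute)
    ultimately show "cf (Poly_Mapping.single (var a) (eps a (insert a S)) *
        coord (Suc d) v (insert a S)) (m - ind S) = eps a (insert a S) * strand (Suc d) v m (insert a S)"
      using True by (auto simp: cf_var_mult strand_def in_keys_iff)
  qed
  finally show ?thesis by (simp add: bd_def)
qed

text \<open>Multiplying by the label of a vertex undoes the shift by \<open>ind S\<close> in
  \<open>strand\<close>. In each multidegree this is the augmentation that defines the reduced
  cycles in degree 0.\<close>

lemma cf_cellular_aug: "cf (cellular_aug v 0) m = (\<Sum>S\<in>cells 0. strand 0 v m S)"
  unfolding cellular_aug_def using cellsD(3)
  by (auto simp: lookup_sum cf_ind_mult strand_def intro!: sum.cong)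

lemma cellular_bd_free:
  assumes v: "v \<in> free_module V (basis_degs (Suc d))"
  shows "cellular_bd d v \<in> free_module V (basis_degs d)"
proof -
  have "Poly_Mapping.single (var a) c \<in> polys V" if "a \<in> V" for a and c :: 'b
    using that by (intro polys_single) (simp add: keys_var)
  then have "cellular_bd d v j \<in> polys V" for j
    unfolding cellular_bd_def using coord_polys[OF v] by (auto simp: polys_0 intro!: polys_sum polys_mult)
  then show ?thesis by (simp add: free_module_iff cellular_bd_def basis_degs_def)
qed

lemma cellular_aug_free:
  assumes v: "v \<in> free_module V (basis_degs 0)"
  shows "cellular_aug v \<in> free_module V [0]"
proof -
  have "Poly_Mapping.single (ind S) c \<in> polys V" if "S \<in> cells 0" for S and c :: 'b
    using cellsD(2,3)[OF that] by (intro polys_single) (simp add: keys_ind)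
  then have "cellular_aug v j \<in> polys V" for j
    unfolding cellular_aug_def using coord_polys[OF v] by (auto simp: polys_0 intro!: polys_sum polys_mult)
  then show ?thesis by (simp add: free_module_iff cellular_aug_def)
qed

lemma cellular_bd_hom: "graded_hom V (basis_degs (Suc d)) (basis_degs d) (cellular_bd d)"
  unfolding graded_hom_def
proof (intro conjI ballI allI funcsetI)
  fix v :: "nat \<Rightarrow> ('a, 'b) mpoly" assume v: "v \<in> free_module V (basis_degs (Suc d))"
  show "cellular_bd d v \<in> free_module V (basis_degs d)" by (rule cellular_bd_free[OF v])
  show "cellular_bd d (\<lambda>j. v j + w j) = (\<lambda>j. cellular_bd d v j + cellular_bd d w j)" for w
    by (intro ext) (simp add: cellular_bd_def coord_add distrib_left sum.distrib)
  show "cellular_bd d (\<lambda>j. p * v j) = (\<lambda>j. p * cellular_bd d v j)" for p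
    by (intro ext) (simp add: cellular_bd_def coord_smult sum_distrib_left mult.left_commute)
next
  fix e and v :: "nat \<Rightarrow> ('a, 'b) mpoly" assume v: "v \<in> graded_part V (basis_degs (Suc d)) e"
  show "cellular_bd d v \<in> graded_part V (basis_degs d) e"
    unfolding graded_part_iff
  proof (intro conjI allI impI)
    show "cellular_bd d v \<in> free_module V (basis_degs d)"
      by (rule cellular_bd_free[OF graded_part_free[OF v]])
    fix j m assume nz: "cf (cellular_bd d v j) m \<noteq> 0"
    then have j: "j < length (cl d)" by (auto simp: cellular_bd_def split: if_splits)
    have "(\<Sum>a\<in>V - cl d ! j. cf (Poly_Mapping.single (var a) (eps a (insert a (cl d ! j))) *
        coord (Suc d) v (insert a (cl d ! j))) m) \<noteq> 0"
      using nz j by (simp add: cellular_bd_def lookup_sum)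
    then obtain a where "cf (Poly_Mapping.single (var a) (eps a (insert a (cl d ! j))) *
        coord (Suc d) v (insert a (cl d ! j))) m \<noteq> 0" by (meson sum.neutral)
    then have a: "ex m a > 0" "cf (coord (Suc d) v (insert a (cl d ! j))) (m - var a) \<noteq> 0"
      by (auto simp: cf_var_mult split: if_splits)
    have "mon_deg m = mon_deg (m - var a) + 1"
      using minus_var_add[OF a(1)] mon_deg_add[of "m - var a" "var a"] by (simp add: mon_deg_var)
    then show "int (mon_deg m) + basis_degs d ! j = e"
      using coord_degree[OF v a(2)] j by (simp add: basis_degs_def)
  qed
qed

lemma cellular_aug_hom: "graded_hom V (basis_degs 0) [0] cellular_aug"
  unfolding graded_hom_def
proof (intro conjI ballI allI funcsetI)
  fix v :: "nat \<Rightarrow> ('a, 'b) mpoly" assume v: "v \<in> free_module V (basis_degs 0)"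
  show "cellular_aug v \<in> free_module V [0]" by (rule cellular_aug_free[OF v])
  show "cellular_aug (\<lambda>j. v j + w j) = (\<lambda>j. cellular_aug v j + cellular_aug w j)" for w
    by (intro ext) (simp add: cellular_aug_def coord_add distrib_left sum.distrib)
  show "cellular_aug (\<lambda>j. p * v j) = (\<lambda>j. p * cellular_aug v j)" for p
    by (intro ext) (simp add: cellular_aug_def coord_smult sum_distrib_left mult.left_commute)
next
  fix e and v :: "nat \<Rightarrow> ('a, 'b) mpoly" assume v: "v \<in> graded_part V (basis_degs 0) e"
  show "cellular_aug v \<in> graded_part V [0] e"
    unfolding graded_part_iff
  proof (intro conjI allI impI)
    show "cellular_aug v \<in> free_module V [0]"
      by (rule cellular_aug_free[OF graded_part_free[OF v]])
    fix j m assume nz: "cf (cellular_aug v j) m \<noteq> 0"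
    then have j: "j = 0" by (auto simp: cellular_aug_def split: if_splits)
    then have "(\<Sum>S\<in>cells 0. strand 0 v m S) \<noteq> 0" using nz cf_cellular_aug by metis
    then obtain S where S: "S \<in> cells 0" "strand 0 v m S \<noteq> 0" by (meson sum.neutral)
    then have Sm: "S \<subseteq> Poly_Mapping.keys m" "cf (coord 0 v S) (m - ind S) \<noteq> 0"
      by (auto simp: strand_def split: if_splits)
    have "mon_deg m = mon_deg (m - ind S) + card S"
      using minus_ind_add[OF cellsD(3)[OF S(1)] Sm(1)] mon_deg_add[of "m - ind S" "ind S"]
        mon_deg_ind[OF cellsD(3)[OF S(1)]] by simp
    then show "int (mon_deg m) + [0] ! j = e"
      using coord_degree[OF v Sm(2)] S(1) j by (simp add: cells_def)
  qed
qed

lemma cellular_bd_minimal: "cf (cellular_bd d v j) 0 = 0"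
  by (simp add: cellular_bd_def lookup_sum cf_var_mult)

lemma cellular_bd_bd:
  fixes v :: "nat \<Rightarrow> ('a, 'k::field) mpoly"
  assumes v: "v \<in> free_module V (basis_degs (Suc (Suc d)))"
  shows "cellular_bd d (cellular_bd (Suc d) v) = (\<lambda>_. 0)"
proof (rule strand_ext[where d = d])
  show "cellular_bd d (cellular_bd (Suc d) v) \<in> free_module V (basis_degs d)"
    using v by (intro cellular_bd_free)
  show "(\<lambda>_. 0) \<in> free_module V (basis_degs d)" by (rule free_module_0)
  fix m S assume S: "full S"
  have "strand d (cellular_bd d (cellular_bd (Suc d) v)) m S =
      bd eps V (strand (Suc d) (cellular_bd (Suc d) v) m) S" by (rule strand_bd[OF S])
  also have "\<dots> = bd eps V (bd eps V (strand (Suc (Suc d)) v m)) S"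
    unfolding bd_def[of eps V "strand (Suc d) (cellular_bd (Suc d) v) m"]
      bd_def[of eps V "bd eps V (strand (Suc (Suc d)) v m)"]
  proof (intro sum.cong refl)
    fix a assume "a \<in> V - S"
    \<comment> \<open>The strand identity for the inner boundary holds on full sets only, and
      cofaces of full sets are full.\<close>
    then have "full (insert a S)" using S by (auto simp: full_def)
    then show "eps a (insert a S) * strand (Suc d) (cellular_bd (Suc d) v) m (insert a S) =
        eps a (insert a S) * bd eps V (strand (Suc (Suc d)) v m) (insert a S)"
      by (simp add: strand_bd)
  qed
  also have "\<dots> = 0" using S by (intro bd_bd[OF anticommuting_eps _ finV]) (simp add: full_def)
  finally show "strand d (cellular_bd d (cellular_bd (Suc d) v)) m S = strand d (\<lambda>_. 0) m S"
    by (simp add: strand_0)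
qed

text \<open>An edge has two end points, with opposite signs.\<close>

lemma cobd_vertices:
  assumes S: "full S" "card S = Suc n"
  shows "cobd eps (\<lambda>S. if full S \<and> card S = n then 1 else 0) S = (0::'k::field)"
proof -
  have SV: "S \<subseteq> V" using S by (simp add: full_def)
  have finS: "finite S" using SV finV finite_subset by blast
  have ge: "card (S \<inter> A i) \<ge> 1" if "i \<in> {1..n}" for i
    using S(1) that finS by (auto simp: full_def Suc_le_eq card_gt_0_iff)
  \<comment> \<open>There are \<open>n + 1\<close> vertices and at least one in each of
    \<open>n\<close> colours, so exactly one colour has two.\<close>
  have "\<exists>i\<in>{1..n}. card (S \<inter> A i) \<noteq> 1"
  proof (rule ccontr)
    assume "\<not> ?thesis"
    then have "(\<Sum>i\<in>{1..n}. card (S \<inter> A i)) = n" by simp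
    then show False using card_eq_sum[OF SV] S(2) by simp
  qed
  then obtain i where i: "i \<in> {1..n}" "card (S \<inter> A i) \<noteq> 1" by blast
  have sum: "(\<Sum>j\<in>{1..n} - {i}. card (S \<inter> A j)) + card (S \<inter> A i) = Suc n"
    using card_eq_sum[OF SV] S(2) i(1) by (simp add: sum.remove)
  have rest: "(\<Sum>j\<in>{1..n} - {i}. (1::nat)) = n - 1" using i(1) by simp
  have "(\<Sum>j\<in>{1..n} - {i}. (1::nat)) \<le> (\<Sum>j\<in>{1..n} - {i}. card (S \<inter> A j))"
    using ge by (intro sum_mono) auto
  then have two: "card (S \<inter> A i) = 2" using sum rest ge[OF i(1)] i by simp
  then obtain a b where ab: "S \<inter> A i = {a, b}" "a \<noteq> b" by (auto simp: card_2_iff)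
  have one: "card (S \<inter> A j) = 1" if "j \<in> {1..n}" "j \<noteq> i" for j
  proof (rule ccontr)
    assume "card (S \<inter> A j) \<noteq> 1"
    then have "1 < card (S \<inter> A j)" using ge[OF that(1)] by simp
    then have "(\<Sum>j\<in>{1..n} - {i}. (1::nat)) < (\<Sum>j\<in>{1..n} - {i}. card (S \<inter> A j))"
      using ge that by (intro sum_strict_mono_ex1) auto
    then show False using sum rest two i by simp
  qed
  \<comment> \<open>Any other vertex is the only one of its colour, so its removal leaves a set that
    is not full.\<close>
  have face: "full (S - {c}) \<longleftrightarrow> c = a \<or> c = b" if c: "c \<in> S" for c
  proof
    assume f: "full (S - {c})"
    have cV: "c \<in> V" using c SV by blast
    show "c = a \<or> c = b"
    proof (rule ccontr)
      assume "\<not> (c = a \<or> c = b)"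
      then have "idx c \<noteq> i" using c ab(1) idx_in[OF cV] by blast
      then obtain x where x: "S \<inter> A (idx c) = {x}" using one idx_in[OF cV] by (metis card_1_singletonE)
      moreover have "c \<in> S \<inter> A (idx c)" using c idx_in[OF cV] by blast
      ultimately have "x = c" by simp
      then show False using x f idx_in(1)[OF cV] unfolding full_def by blast
    qed
  next
    assume c': "c = a \<or> c = b"
    have "(S - {c}) \<inter> A j \<noteq> {}" if j: "j \<in> {1..n}" for j
    proof (cases "j = i")
      case True
      have "a \<in> S \<inter> A i" "b \<in> S \<inter> A i" using ab by auto
      then show ?thesis using c' ab(2) True by auto
    next
      case False
      have "c \<in> A i" using ab(1) c' by blast
      then have "c \<notin> A j" using A_unique[OF i(1) j] False by blast
      then show ?thesis using S(1) j unfolding full_def by blast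
    qed
    then show "full (S - {c})" using SV by (auto simp: full_def)
  qed
  have ab_S: "a \<in> S" "b \<in> S" using ab by blast+
  have "cobd eps (\<lambda>S. if full S \<and> card S = n then 1 else 0) S = (\<Sum>c\<in>{a, b}. (eps c S :: 'k))"
    unfolding cobd_def
  proof (rule sum.mono_neutral_cong_right[OF finS])
    show "{a, b} \<subseteq> S" using ab_S by blast
    show "\<forall>c\<in>S - {a, b}. eps c S * (if full (S - {c}) \<and> card (S - {c}) = n then 1 else 0) = (0::'k)"
      using face by auto
    fix c assume c: "c \<in> {a, b}"
    then have "full (S - {c})" "card (S - {c}) = n" using face ab_S card_Suc_Diff1[OF finS, of c] S(2) by auto
    then show "eps c S * (if full (S - {c}) \<and> card (S - {c}) = n then 1 else 0) = (eps c S :: 'k)" by simp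
  qed
  also have "\<dots> = eps a S + eps b S" using ab(2) by simp
  also have "\<dots> = eps a S + eps a S * (eps a S * eps b S)"
    using eps_sq[OF SV ab_S(1), where 'k = 'k] by (simp add: mult.assoc[symmetric])
  also have "\<dots> = 0" by (simp add: eps_edge[OF SV i(1) ab])
  finally show ?thesis .
qed

lemma cellular_aug_bd:
  fixes v :: "nat \<Rightarrow> ('a, 'k::field) mpoly"
  assumes v: "v \<in> free_module V (basis_degs (Suc 0))"
  shows "cellular_aug (cellular_bd 0 v) = (\<lambda>_. 0)"
proof -
  have "cf (cellular_aug (cellular_bd 0 v) 0) m = 0" for m
  proof -
    define c where "c = strand (Suc 0) v m"
    have c: "supp_in (cell T) (Poly_Mapping.keys m \<inter> V) (Suc 0) c"
      unfolding c_def by (rule supp_strand[OF v])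
    \<comment> \<open>The augmentation is the pairing with this cochain, so it kills boundaries
      because the cochain is a cocycle.\<close>
    define x :: "'a set \<Rightarrow> 'k" where "x S = (if full S \<and> card S = n then 1 else 0)" for S
    have "cf (cellular_aug (cellular_bd 0 v) 0) m = (\<Sum>S\<in>cells 0. strand 0 (cellular_bd 0 v) m S)"
      by (rule cf_cellular_aug)
    also have "\<dots> = (\<Sum>S\<in>Pow V. x S * bd eps V c S)"
    proof (rule sum.mono_neutral_cong_left)
      show "finite (Pow V)" "cells 0 \<subseteq> Pow V" using finV cellsD(2) by auto
      show "\<forall>S\<in>Pow V - cells 0. x S * bd eps V c S = 0"
      proof
        fix S assume S: "S \<in> Pow V - cells 0"
        show "x S * bd eps V c S = 0"
        proof (cases "full S")
          case True
          then have "bd eps V c S = 0" using S by (simp add: c_def strand_outside flip: strand_bd)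
          then show ?thesis by simp
        qed (simp add: x_def)
      qed
      fix S assume S: "S \<in> cells 0"
      then show "strand 0 (cellular_bd 0 v) m S = x S * bd eps V c S"
        using cellsD(1)[OF S] by (simp add: strand_bd c_def x_def cells_def)
    qed
    also have "\<dots> = (\<Sum>S\<in>Pow V. cobd eps x S * c S)" by (rule sum_cobd_mult[OF finV, symmetric])
    also have "\<dots> = 0"
    proof (rule sum.neutral, rule ballI)
      fix S
      show "cobd eps x S * c S = 0"
      proof (cases "c S = 0")
        case False
        then have "full S" "card S = Suc n" using supp_inD[OF c] cell_full by force+
        then show ?thesis using cobd_vertices[where 'k = 'k] by (simp add: x_def[abs_def])
      qed simp
    qed
    finally show ?thesis .
  qed
  then have "cellular_aug (cellular_bd 0 v) j = 0" for j
    by (cases "j = 0") (auto simp: cellular_aug_def intro: poly_mapping_eqI)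
  then show ?thesis by blast
qed

text \<open>A preimage is assembled from preimages of all strands.\<close>

lemma cellular_bd_lift:
  fixes v :: "nat \<Rightarrow> ('a, 'k::field) mpoly"
  assumes v: "v \<in> free_module V (basis_degs d)"
    and b: "\<And>m. \<exists>b. supp_in (cell T) (Poly_Mapping.keys m \<inter> V) (Suc d) b \<and>
      (\<forall>S. full S \<longrightarrow> bd eps V b S = strand d v m S)"
  shows "v \<in> cellular_bd d ` free_module V (basis_degs (Suc d))"
proof -
  obtain b where b: "\<And>m. supp_in (cell T) (Poly_Mapping.keys m \<inter> V) (Suc d) (b m)"
    "\<And>m S. full S \<Longrightarrow> bd eps V (b m) S = strand d v m S"
    using b by metis
  \<comment> \<open>The preimage is forced to be zero where the strand is zero. Then only finitely
    many multidegrees contribute, and the coefficients collected in \<open>w\<close> form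
    polynomials.\<close>
  define B where "B m S = (if strand d v m = (\<lambda>_. 0) then 0 else b m S)" for m S
  have B0: "B m S = 0" if "S \<notin> cells (Suc d) \<or> \<not> S \<subseteq> Poly_Mapping.keys m" for m S
    using supp_inD[OF b(1), of m S] that by (auto simp: B_def cells_def)
  have Bbd: "bd eps V (B m) S = strand d v m S" if "full S" for m S
    using b(2)[OF that] by (cases "strand d v m = (\<lambda>_. 0)") (simp_all add: B_def[abs_def] bd_def)
  have Bnz: "\<exists>S'\<in>cells d. S' \<subseteq> Poly_Mapping.keys m \<and> cf (coord d v S') (m - ind S') \<noteq> 0"
    if nz: "B m S \<noteq> 0" for m S
  proof -
    have "strand d v m \<noteq> (\<lambda>_. 0)" using nz by (auto simp: B_def)
    then obtain S' where S': "strand d v m S' \<noteq> 0" by auto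
    then have "S' \<in> cells d" using strand_outside by blast
    then show ?thesis using S' by (auto simp: strand_def split: if_splits)
  qed
  have fin: "finite {\<mu>. B (\<mu> + ind S) S \<noteq> 0}" for S
  proof (rule finite_subset)
    show "{\<mu>. B (\<mu> + ind S) S \<noteq> 0} \<subseteq>
        (\<Union>S'\<in>cells d. (\<lambda>\<nu>. \<nu> + ind S' - ind S) ` Poly_Mapping.keys (coord d v S'))"
    proof
      fix \<mu> assume "\<mu> \<in> {\<mu>. B (\<mu> + ind S) S \<noteq> 0}"
      then obtain S' where S': "S' \<in> cells d" "S' \<subseteq> Poly_Mapping.keys (\<mu> + ind S)"
          "cf (coord d v S') (\<mu> + ind S - ind S') \<noteq> 0" using Bnz by blast
      have "\<mu> + ind S - ind S' + ind S' = \<mu> + ind S"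
        by (rule minus_ind_add[OF cellsD(3)[OF S'(1)] S'(2)])
      then have "\<mu> = (\<mu> + ind S - ind S') + ind S' - ind S" by simp
      moreover have "\<mu> + ind S - ind S' \<in> Poly_Mapping.keys (coord d v S')"
        using S'(3) by (simp add: in_keys_iff)
      ultimately show "\<mu> \<in> (\<Union>S'\<in>cells d. (\<lambda>\<nu>. \<nu> + ind S' - ind S) ` Poly_Mapping.keys (coord d v S'))"
        using S'(1) by (intro UN_I[of S'] image_eqI)
    qed
  qed (simp add: finite_cells_deg)
  define w :: "nat \<Rightarrow> ('a, 'k) mpoly" where
    "w j = (if j < length (cl (Suc d))
       then Abs_poly_mapping (\<lambda>\<mu>. B (\<mu> + ind (cl (Suc d) ! j)) (cl (Suc d) ! j)) else 0)" for j
  have cfw: "cf (w j) \<mu> = B (\<mu> + ind (cl (Suc d) ! j)) (cl (Suc d) ! j)" if "j < length (cl (Suc d))" for j \<mu>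
    using that fin[of "cl (Suc d) ! j"] by (simp add: w_def)
  have "w j \<in> polys V" for j
  proof (rule polysI)
    fix \<mu> assume nz: "cf (w j) \<mu> \<noteq> 0"
    then have j: "j < length (cl (Suc d))" by (auto simp: w_def split: if_splits)
    define m where "m = \<mu> + ind (cl (Suc d) ! j)"
    have "B m (cl (Suc d) ! j) \<noteq> 0" using nz cfw[OF j] by (simp add: m_def)
    then obtain S' where S': "S' \<in> cells d" "S' \<subseteq> Poly_Mapping.keys m"
        "cf (coord d v S') (m - ind S') \<noteq> 0" using Bnz by blast
    have "m = m - ind S' + ind S'" using minus_ind_add[OF cellsD(3)[OF S'(1)] S'(2)] by simp
    moreover have "Poly_Mapping.keys (m - ind S' + ind S') \<subseteq> V"
      using polysD[OF coord_polys[OF v] S'(3)] cellsD(2,3)[OF S'(1)] by (simp add: keys_add_nat keys_ind)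
    ultimately have "Poly_Mapping.keys m \<subseteq> V" by simp
    then show "Poly_Mapping.keys \<mu> \<subseteq> V" by (simp add: m_def keys_add_nat)
  qed
  then have w: "w \<in> free_module V (basis_degs (Suc d))"
    by (simp add: free_module_iff w_def basis_degs_def)
  have sw: "strand (Suc d) w m = B m" for m
  proof
    fix S
    show "strand (Suc d) w m S = B m S"
    proof (cases "S \<in> cells (Suc d) \<and> S \<subseteq> Poly_Mapping.keys m")
      case True
      then obtain j where j: "j < length (cl (Suc d))" "cl (Suc d) ! j = S" using cells_nth by blast
      have "m - ind S + ind S = m" using True cellsD(3) by (intro minus_ind_add) auto
      then show ?thesis using True coord_nth[OF j(1), of w] j(2) cfw[OF j(1)] by (simp add: strand_def)
    next
      case False
      then show ?thesis using B0 strand_outside[of S "Suc d" w m] by (auto simp: strand_def)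
    qed
  qed
  have "cellular_bd d w = v"
  proof (rule strand_ext[OF cellular_bd_free[OF w] v])
    fix m S assume "full S"
    then show "strand d (cellular_bd d w) m S = strand d v m S" by (simp add: strand_bd sw Bbd)
  qed
  then show ?thesis using w by blast
qed

lemma cellular_aug_image:
  "(\<lambda>v. cellular_aug v 0) ` free_module V (basis_degs 0) = (rainbow_ideal n A T :: ('a, 'k::field) mpoly set)"
proof (intro subset_antisym subsetI)
  fix p :: "('a, 'k) mpoly" assume "p \<in> (\<lambda>v. cellular_aug v 0) ` free_module V (basis_degs 0)"
  then obtain v where v: "v \<in> free_module V (basis_degs 0)" "p = cellular_aug v 0" by blast
  have p: "p \<in> polys V" using cellular_aug_free[OF v(1)] v(2) by (simp add: free_module_iff)
  have "hit T (Poly_Mapping.keys m)" if m: "m \<in> Poly_Mapping.keys p" for m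
  proof -
    have "(\<Sum>S\<in>cells 0. strand 0 v m S) \<noteq> 0" using m v(2) cf_cellular_aug by (metis in_keys_iff)
    then obtain S where S: "S \<in> cells 0" "strand 0 v m S \<noteq> 0" by (meson sum.neutral)
    have "full S" "trans S \<subseteq> T" using S(1) by (auto simp: cells_def cell_def)
    then have "hit T S" using full_iff_trans[of S] by (auto simp: hit_def full_def)
    moreover have "S \<subseteq> Poly_Mapping.keys m" using S(2) by (auto simp: strand_def split: if_splits)
    moreover have "Poly_Mapping.keys m \<subseteq> V" using p m by (auto simp: polys_iff)
    ultimately show ?thesis by (rule hit_mono)
  qed
  then show "p \<in> rainbow_ideal n A T" using p by (simp add: rainbow_ideal_eq[OF T])
next
  fix p :: "('a, 'k) mpoly" assume "p \<in> rainbow_ideal n A T"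
  then have p: "p \<in> polys V" "\<And>m. m \<in> Poly_Mapping.keys p \<Longrightarrow> hit T (Poly_Mapping.keys m)"
    by (auto simp: rainbow_ideal_eq[OF T])
  have "\<exists>S. S \<in> cells 0 \<and> S \<subseteq> Poly_Mapping.keys m" if m: "m \<in> Poly_Mapping.keys p" for m
  proof -
    obtain f where f: "f \<in> T" "f \<in> (\<Pi>\<^sub>E i\<in>{1..n}. A i)" "f ` {1..n} \<subseteq> Poly_Mapping.keys m"
      by (rule hit_transversal[OF p(2)[OF m] T])
    then show ?thesis using transversal_full[OF f(2)] f(1)
      by (intro exI[of _ "f ` {1..n}"]) (auto simp: cells_def cell_def)
  qed
  \<comment> \<open>Each term of \<open>p\<close> is assigned to one vertex of the complex whose
    monomial divides it; \<open>g\<close> collects the quotients.\<close>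
  then obtain F where F: "\<And>m. m \<in> Poly_Mapping.keys p \<Longrightarrow> F m \<in> cells 0"
    "\<And>m. m \<in> Poly_Mapping.keys p \<Longrightarrow> F m \<subseteq> Poly_Mapping.keys m" by metis
  define g where "g S = (\<Sum>m\<in>{m \<in> Poly_Mapping.keys p. F m = S}. Poly_Mapping.single (m - ind S) (cf p m))" for S
  define v where "v j = (if j < length (cl 0) then g (cl 0 ! j) else 0)" for j
  have coord_v: "coord 0 v S = g S" if "S \<in> cells 0" for S
  proof -
    obtain j where j: "j < length (cl 0)" "cl 0 ! j = S" using \<open>S \<in> cells 0\<close> by (rule cells_nth)
    then show ?thesis using coord_nth[OF j(1), of v] by (simp add: v_def)
  qed
  have "g S \<in> polys V" for S
    unfolding g_def
  proof (intro polys_sum polys_single)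
    fix m assume "m \<in> {m \<in> Poly_Mapping.keys p. F m = S}"
    then have "Poly_Mapping.keys m \<subseteq> V" using p(1) by (auto simp: polys_iff)
    moreover have "Poly_Mapping.keys (m - ind S) \<subseteq> Poly_Mapping.keys m"
      by (auto simp: in_keys_iff lookup_minus)
    ultimately show "Poly_Mapping.keys (m - ind S) \<subseteq> V" by blast
  qed
  then have "v \<in> free_module V (basis_degs 0)"
    by (simp add: free_module_iff v_def basis_degs_def polys_0)
  moreover have "cellular_aug v 0 = p"
  proof -
    have "cellular_aug v 0 = (\<Sum>S\<in>cells 0. Poly_Mapping.single (ind S) 1 * g S)"
      by (simp add: cellular_aug_def coord_v cong: sum.cong)
    also have "\<dots> = (\<Sum>S\<in>cells 0. \<Sum>m\<in>{m \<in> Poly_Mapping.keys p. F m = S}. Poly_Mapping.single m (cf p m))"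
    proof (intro sum.cong refl)
      fix S assume "S \<in> cells 0"
      show "Poly_Mapping.single (ind S) 1 * g S =
          (\<Sum>m\<in>{m \<in> Poly_Mapping.keys p. F m = S}. Poly_Mapping.single m (cf p m))"
        unfolding g_def sum_distrib_left
      proof (intro sum.cong refl)
        fix m assume "m \<in> {m \<in> Poly_Mapping.keys p. F m = S}"
        then have "m - ind S + ind S = m" using F(2)[of m] cellsD(3)[OF \<open>S \<in> cells 0\<close>]
          by (intro minus_ind_add) auto
        then show "Poly_Mapping.single (ind S) 1 * Poly_Mapping.single (m - ind S) (cf p m) =
            Poly_Mapping.single m (cf p m)" by (simp add: mult_single add.commute)
      qed
    qed
    also have "\<dots> = (\<Sum>m\<in>Poly_Mapping.keys p. Poly_Mapping.single m (cf p m))"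
      using F(1) finite_cells_deg by (intro sum.group) auto
    also have "\<dots> = p" by (rule poly_sum_monomials[symmetric])
    finally show ?thesis .
  qed
  ultimately show "p \<in> (\<lambda>v. cellular_aug v 0) ` free_module V (basis_degs 0)" by blast
qed

lemma acyc_imp_linear_resolution:
  assumes acyc: "acyc TYPE('k::field) T"
  shows "has_linear_resolution n V (rainbow_ideal n A T :: ('a, 'k) mpoly set)"
proof -
  \<comment> \<open>Acyclicity over the support of \<open>m\<close>. An exponent vector may involve
    variables outside \<open>V\<close>, whence the intersection.\<close>
  have bounds: "\<exists>b. supp_in (cell T) (Poly_Mapping.keys m \<inter> V) (Suc d) b \<and>
      (\<forall>S. full S \<longrightarrow> bd eps V b S = strand d v m S)"
    if "v \<in> free_module V (basis_degs d)"
      "if d = 0 then (\<Sum>S\<in>Pow (Poly_Mapping.keys m \<inter> V). strand d v m S) = 0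
       else (\<forall>S. full S \<longrightarrow> bd eps V (strand d v m) S = 0)"
    for d m and v :: "nat \<Rightarrow> ('a, 'k) mpoly"
    using acyc[unfolded acyc_def, rule_format, OF Int_lower2 supp_strand[OF that(1)] that(2)[rule_format]] .
  have ex0: "{v \<in> free_module V (basis_degs 0). cellular_aug v = (\<lambda>_. 0)} =
      (cellular_bd 0 ` free_module V (basis_degs 1) :: (nat \<Rightarrow> ('a, 'k) mpoly) set)" (is "?K = ?B")
  proof (intro subset_antisym subsetI)
    fix v :: "nat \<Rightarrow> ('a, 'k) mpoly" assume "v \<in> ?K"
    then have v: "v \<in> free_module V (basis_degs 0)" "cellular_aug v = (\<lambda>_. 0)" by auto
    have "(\<Sum>S\<in>Pow (Poly_Mapping.keys m \<inter> V). strand 0 v m S) = 0" for m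
    proof -
      have "(\<Sum>S\<in>Pow (Poly_Mapping.keys m \<inter> V). strand 0 v m S) = (\<Sum>S\<in>cells 0. strand 0 v m S)"
      proof (rule sum.mono_neutral_cong)
        show "strand 0 v m S = 0" if "S \<in> cells 0 - Pow (Poly_Mapping.keys m \<inter> V)" for S
          using that cellsD(2) by (auto simp: strand_def)
      qed (auto simp: finite_cells_deg strand_outside)
      then show ?thesis using cf_cellular_aug[of v m] v(2) by simp
    qed
    then have "v \<in> cellular_bd 0 ` free_module V (basis_degs (Suc 0))"
      by (intro cellular_bd_lift[OF v(1)] bounds[OF v(1)]) simp
    then show "v \<in> ?B" by simp
  next
    fix v :: "nat \<Rightarrow> ('a, 'k) mpoly" assume "v \<in> ?B"
    then show "v \<in> ?K" using cellular_bd_free cellular_aug_bd by auto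
  qed
  have ex: "{v \<in> free_module V (basis_degs (Suc i)). cellular_bd i v = (\<lambda>_. 0)} =
      (cellular_bd (Suc i) ` free_module V (basis_degs (Suc (Suc i))) :: (nat \<Rightarrow> ('a, 'k) mpoly) set)"
    (is "?K = ?B") for i
  proof (intro subset_antisym subsetI)
    fix v :: "nat \<Rightarrow> ('a, 'k) mpoly" assume "v \<in> ?K"
    then have v: "v \<in> free_module V (basis_degs (Suc i))" "cellular_bd i v = (\<lambda>_. 0)" by auto
    have "bd eps V (strand (Suc i) v m) S = 0" if "full S" for m S
      using strand_bd[OF that, of i v m] v(2) by (simp add: strand_0)
    then show "v \<in> ?B" by (intro cellular_bd_lift[OF v(1)] bounds[OF v(1)]) simp
  next
    fix v :: "nat \<Rightarrow> ('a, 'k) mpoly" assume "v \<in> ?B"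
    then show "v \<in> ?K" using cellular_bd_free cellular_bd_bd by auto
  qed
  have "minimal_graded_free_resolution V (rainbow_ideal n A T :: ('a, 'k) mpoly set)
      basis_degs cellular_aug cellular_bd"
    unfolding minimal_graded_free_resolution_def
    by (intro conjI allI ballI cellular_aug_hom cellular_bd_hom cellular_aug_image ex0 ex cellular_bd_minimal)
  moreover have "d = int n + int i" if "d \<in> set (basis_degs i)" for d i
    using that by (auto simp: basis_degs_def)
  ultimately show ?thesis unfolding has_linear_resolution_def by blast
qed

end

theorem corollary8p5:
  fixes n :: nat and A :: "nat \<Rightarrow> 'a set" and T :: "(nat \<Rightarrow> 'a) set"
  assumes "\<forall>i\<in>{1..n}. finite (A i) \<and> A i \<noteq> {}"
    and "disjoint_family_on A {1..n}"
    and "T \<subseteq> (\<Pi>\<^sub>E i\<in>{1..n}. A i)"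
  shows "(has_linear_resolution n (\<Union>i\<in>{1..n}. A i) (rainbow_ideal n A T :: ('a, 'k::field) mpoly set)
          \<longrightarrow> has_linear_resolution n (\<Union>i\<in>{1..n}. A i)
                (rainbow_ideal n A ((\<Pi>\<^sub>E i\<in>{1..n}. A i) - T) :: ('a, 'k) mpoly set))
       \<and> (acyclic_over TYPE('k) n A T
          \<longleftrightarrow> acyclic_over TYPE('k) n A ((\<Pi>\<^sub>E i\<in>{1..n}. A i) - T))"
proof -
  define P where "P = (\<Pi>\<^sub>E i\<in>{1..n}. A i)"
  interpret colour_classes n A
    by unfold_locales (use assms in auto)
  have to_acyc: "acyc TYPE('k) (P - U)"
    if "has_linear_resolution n V (rainbow_ideal n A U :: ('a, 'k) mpoly set)" "U \<subseteq> P" for U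
    using that coacyc_imp_acyc_compl linear_resolution_imp_coacyc unfolding P_def by blast
  have to_linear: "has_linear_resolution n V (rainbow_ideal n A U :: ('a, 'k) mpoly set)"
    if "acyc TYPE('k) U" "U \<subseteq> P" for U
  proof -
    interpret rainbow n A U by unfold_locales (use that(2) in \<open>simp add: P_def\<close>)
    show ?thesis by (rule acyc_imp_linear_resolution[OF that(1)])
  qed
  have T: "T \<subseteq> P" "P - T \<subseteq> P" "P - (P - T) = T"
    using assms(3) by (auto simp: P_def)
  have "has_linear_resolution n V (rainbow_ideal n A (P - T) :: ('a, 'k) mpoly set)"
    if "has_linear_resolution n V (rainbow_ideal n A T :: ('a, 'k) mpoly set)"
    using to_linear[OF to_acyc[OF that T(1)] T(2)] .
  \<comment> \<open>Acyclicity passes to the complement through linearity of the ideal; the converse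
    is the same for \<open>P - T\<close>, whose complement is \<open>T\<close>.\<close>
  moreover have "acyc TYPE('k) T \<longleftrightarrow> acyc TYPE('k) (P - T)"
    using to_acyc[OF to_linear] T by metis
  ultimately show ?thesis
    unfolding acyclic_over_iff P_def[symmetric] V_def by blast
qed

end
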